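(* Let $E=\dot B^{-1,\infty}_\infty(\mathbb R^3)$. There is no Banach space $F$ such that the couple $(E,F)$ is admissible.
   Context: Everything is on $\mathbb R^3$; $\mathcal S'$ is the space of tempered distributions. $\dot B^{-1,\infty}_\infty$ is the homogeneous Besov space of tempered distributions $f$ with $S_jf\to0$ in $\mathcal S'$ as $j\to-\infty$ and $\sup_{j\in\mathbb Z}2^{-j}\|\Delta_jf\|_{L^\infty}<\infty$, where $S_j,\Delta_j$ are Littlewood-Paley operators: $S_j=\varphi^0(-4^{-j}\Delta)$, $\Delta_j=S_{j+1}-S_j$, with $\varphi^0\in C^\infty([0,\infty))$, $\varphi^0=1$ on $[0,\frac14]$, $\operatorname{Supp}\varphi^0\subset[0,1]$. It is equipped with the equivalent norm $\sup_{t>0}\sqrt t\,\|e^{t\Delta}f\|_{L^\infty}$. The bilinear operator: $P(D)$ is a fixed pseudo-differential operator (Fourier multiplier), homogeneous of degree 1, whose symbol $P(\xi)$ is nonzero and $C^\infty$ away from $0$, and $$B(u,v)(t)=\int_0^te^{(t-\tau)\Delta}P(D)\{u(\tau)v(\tau)\}\,d\tau .$$ Admissible couple: Banach spaces $(E,F)$ such that: (P1) $E$ injects continuously in $\mathcal S'$ and is invariant: $\|\lambda f(\lambda\cdot-x_0)\|_E=\|f\|_E$ for all $f\in E$, $x_0\in\mathbb R^3$, $\lambda>0$. (P2) (a) $F$ injects continuously in $\mathcal S'$; (b) the norm of $F$ is translation invariant, and $f(\lambda\cdot)\in F$ iff $f\in F$, for every $\lambda>0$; (c) on every compact subset of $]0,\infty[$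 the norms $\|f\|_{t,F}=\sqrt t\,\|f(\sqrt t\,\cdot)\|_F$ are uniformly equivalent to each other; (d) $e^\Delta$ is continuous from $E$ to $F$. (P3) Let $\mathcal F$ be the space of continuous functions $u:]0,\infty[\to F$ with $\|u\|_{\mathcal F}=\sup_{t>0}\|u(t)\|_{t,F}<\infty$. Then (a) $B$ is (well defined and) continuous from $\mathcal F\times\mathcal F$ to $\mathcal F$; (b) $\lim_{t\to0}B(u,v)(t)=0$ in $\mathcal S'$ for all $u,v\in\mathcal F$. *)

theory Defs
  imports "HOL-Analysis.Analysis" "HOL-Library.Function_Algebras"
begin

section \<open>Schwartz functions and tempered distributions on three-space\<close>

type_synonym space = "real ^ 3"
type_synonym tdist = "(space \<Rightarrow> complex) \<Rightarrow> complex"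

fun partials :: "3 list \<Rightarrow> (space \<Rightarrow> complex) \<Rightarrow> space \<Rightarrow> complex" where
  "partials [] f = f"
| "partials (i # is) f = (\<lambda>x. frechet_derivative (partials is f) (at x) (axis i 1))"

text \<open>Smoothness on an open set: every iterated partial derivative exists and is differentiable.\<close>

definition smooth_on :: "space set \<Rightarrow> (space \<Rightarrow> complex) \<Rightarrow> bool" where
  "smooth_on U f \<longleftrightarrow> (\<forall>is. \<forall>x\<in>U. partials is f differentiable (at x))"

definition schwartz :: "(space \<Rightarrow> complex) set" where
  "schwartz = {\<phi>. smooth_on UNIV \<phi> \<and>
     (\<forall>is k. bounded (range (\<lambda>x. (1 + norm x) ^ k *\<^sub>R partials is \<phi> x)))}"

definition schwartz_seminorm :: "nat \<Rightarrow> (space \<Rightarrow> complex) \<Rightarrow> real" where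
  "schwartz_seminorm m \<phi> =
     (SUP (is, x) \<in> {is. length is \<le> m} \<times> UNIV. (1 + norm x) ^ m * norm (partials is \<phi> x))"

text \<open>
  A tempered distribution is a functional on all functions that vanishes off the Schwartz space,
  so that two distributions are equal iff they agree on Schwartz functions.  With this convention
  the topology of pointwise convergence that HOL-Analysis puts on the function type restricts
  on \<open>tempered\<close> to the weak-star topology.  For maps from a Banach space, and for limits along
  sequences or along a real parameter, this gives the same notion of continuity and convergence
  as the strong topology.
\<close>

definition on_schwartz :: "tdist \<Rightarrow> tdist" where
  "on_schwartz T = (\<lambda>\<phi>. if \<phi> \<in> schwartz then T \<phi> else 0)"

definition tempered :: "tdist set" where
  "tempered = {T. T = on_schwartz T \<and>
     (\<forall>\<phi>\<in>schwartz. \<forall>\<psi>\<in>schwartz. T (\<lambda>x. \<phi> x + \<psi> x) = T \<phi> + T \<psi>) \<and>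
     (\<forall>c. \<forall>\<phi>\<in>schwartz. T (\<lambda>x. c * \<phi> x) = c * T \<phi>) \<and>
     (\<exists>C m. \<forall>\<phi>\<in>schwartz. norm (T \<phi>) \<le> C * schwartz_seminorm m \<phi>)}"

definition regular :: "(space \<Rightarrow> complex) \<Rightarrow> tdist" where
  "regular g = on_schwartz (\<lambda>\<phi>. LINT x|lborel. g x * \<phi> x)"

definition cscale :: "complex \<Rightarrow> tdist \<Rightarrow> tdist" where
  "cscale c T = (\<lambda>\<phi>. c * T \<phi>)"

text \<open>The distribution \<open>T(r \<cdot> - a)\<close> for \<open>r > 0\<close>, by change of variables.\<close>

definition affine_comp :: "real \<Rightarrow> space \<Rightarrow> tdist \<Rightarrow> tdist" where
  "affine_comp r a T = on_schwartz (\<lambda>\<phi>. T (\<lambda>y. \<phi> ((y + a) /\<^sub>R r)) / of_real (r ^ 3))"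

text \<open>
  The sup norm of a distribution, with value \<open>\<infinity>\<close> if it is not a bounded measurable function.
\<close>

definition linf_norm :: "tdist \<Rightarrow> ennreal" where
  "linf_norm T = Inf {ennreal C | C. 0 \<le> C \<and>
     (\<exists>g \<in> borel_measurable lborel. (AE x in lborel. norm (g x) \<le> C) \<and> T = regular g)}"


section \<open>Fourier multipliers and Littlewood-Paley operators\<close>

definition fourier :: "(space \<Rightarrow> complex) \<Rightarrow> space \<Rightarrow> complex" where
  "fourier f \<xi> = (LINT x|lborel. exp (- (\<i> * of_real (x \<bullet> \<xi>))) * f x)"

definition inv_fourier :: "(space \<Rightarrow> complex) \<Rightarrow> space \<Rightarrow> complex" where
  "inv_fourier f x = (LINT \<xi>|lborel. exp (\<i> * of_real (x \<bullet> \<xi>)) * f \<xi>) / of_real ((2 * pi) ^ 3)"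

definition mult_fun :: "(space \<Rightarrow> complex) \<Rightarrow> (space \<Rightarrow> complex) \<Rightarrow> space \<Rightarrow> complex" where
  "mult_fun m \<phi> = inv_fourier (\<lambda>\<xi>. m \<xi> * fourier \<phi> \<xi>)"

text \<open>
  The operator \<open>m(D)\<close> on tempered distributions, by duality; the transpose of \<open>m(D)\<close> is
  \<open>m(-D)\<close>.  It is used only for smooth symbols all of whose derivatives have at most polynomial
  growth, so that \<open>m(-D)\<close> preserves Schwartz functions.
\<close>

definition mult_op :: "(space \<Rightarrow> complex) \<Rightarrow> tdist \<Rightarrow> tdist" where
  "mult_op m T = on_schwartz (\<lambda>\<phi>. T (mult_fun (\<lambda>\<xi>. m (- \<xi>)) \<phi>))"

definition heat :: "real \<Rightarrow> tdist \<Rightarrow> tdist" where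
  "heat t = mult_op (\<lambda>\<xi>. of_real (exp (- t * (norm \<xi>)\<^sup>2)))"

text \<open>
  Smoothness is asked on \<open>]0,\<infinity>[\<close> only: smoothness up to \<open>0\<close> follows since the function is
  constant on \<open>[0,1/4]\<close>.  Values at negative arguments are never used.
\<close>

definition lp_cutoff :: "(real \<Rightarrow> real) \<Rightarrow> bool" where
  "lp_cutoff \<phi>0 \<longleftrightarrow>
     (\<forall>n. \<forall>x>0. ((deriv ^^ n) \<phi>0) field_differentiable (at x)) \<and>
     (\<forall>x\<in>{0..1/4}. \<phi>0 x = 1) \<and> (\<forall>x>1. \<phi>0 x = 0)"

definition S_symbol :: "(real \<Rightarrow> real) \<Rightarrow> int \<Rightarrow> space \<Rightarrow> complex" where
  "S_symbol \<phi>0 j \<xi> = of_real (\<phi>0 (4 powi (- j) * (norm \<xi>)\<^sup>2))"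

definition S_op :: "(real \<Rightarrow> real) \<Rightarrow> int \<Rightarrow> tdist \<Rightarrow> tdist" where
  "S_op \<phi>0 j = mult_op (S_symbol \<phi>0 j)"

definition Delta_op :: "(real \<Rightarrow> real) \<Rightarrow> int \<Rightarrow> tdist \<Rightarrow> tdist" where
  "Delta_op \<phi>0 j T = S_op \<phi>0 (j + 1) T - S_op \<phi>0 j T"

text \<open>\<open>S_j T\<close> as a smooth function: the convolution of \<open>T\<close> with the kernel of \<open>S_j\<close>.\<close>

definition S_fun :: "(real \<Rightarrow> real) \<Rightarrow> int \<Rightarrow> tdist \<Rightarrow> space \<Rightarrow> complex" where
  "S_fun \<phi>0 j T x = T (\<lambda>y. inv_fourier (S_symbol \<phi>0 j) (x - y))"


section \<open>The homogeneous Besov space of order -1\<close>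

definition besov :: "(real \<Rightarrow> real) \<Rightarrow> tdist set" where
  "besov \<phi>0 = {f \<in> tempered. ((\<lambda>j. S_op \<phi>0 j f) \<longlongrightarrow> 0) at_bot \<and>
     (SUP j. ennreal (2 powi (- j)) * linf_norm (Delta_op \<phi>0 j f)) < \<infinity>}"

definition besov_norm :: "tdist \<Rightarrow> real" where
  "besov_norm f = enn2real (SUP t\<in>{0<..}. ennreal (sqrt t) * linf_norm (heat t f))"


section \<open>Banach spaces of tempered distributions\<close>

text \<open>The distance is cut off outside \<open>V\<close> because \<open>Metric_space\<close> asks for symmetry everywhere.\<close>

definition norm_dist :: "('a::minus) set \<Rightarrow> ('a \<Rightarrow> real) \<Rightarrow> 'a \<Rightarrow> 'a \<Rightarrow> real" where
  "norm_dist V N f g = (if f \<in> V \<and> g \<in> V then N (f - g) else 0)"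

abbreviation norm_topology :: "('a::minus) set \<Rightarrow> ('a \<Rightarrow> real) \<Rightarrow> 'a topology" where
  "norm_topology V N \<equiv> Metric_space.mtopology V (norm_dist V N)"

text \<open>
  A complex Banach space with an injection into the tempered distributions is identified with
  its image, carrying the transported norm \<open>N\<close>.
\<close>

definition banach_distributions :: "tdist set \<Rightarrow> (tdist \<Rightarrow> real) \<Rightarrow> bool" where
  "banach_distributions V N \<longleftrightarrow>
     V \<subseteq> tempered \<and> 0 \<in> V \<and> (\<forall>f\<in>V. \<forall>g\<in>V. f + g \<in> V) \<and> (\<forall>c. \<forall>f\<in>V. cscale c f \<in> V) \<and>
     (\<forall>f\<in>V. 0 \<le> N f \<and> (N f = 0 \<longleftrightarrow> f = 0)) \<and>
     (\<forall>f\<in>V. \<forall>g\<in>V. N (f + g) \<le> N f + N g) \<and>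
     (\<forall>c. \<forall>f\<in>V. N (cscale c f) = norm c * N f) \<and>
     Metric_space.mcomplete V (norm_dist V N)"

definition injects_continuously :: "tdist set \<Rightarrow> (tdist \<Rightarrow> real) \<Rightarrow> bool" where
  "injects_continuously V N \<longleftrightarrow> continuous_map (norm_topology V N) (top_of_set tempered) id"


section \<open>The bilinear operator\<close>

text \<open>
  ``Nonzero'' is read as ``not identically zero'', which covers \<open>P(\<xi>) = i \<xi>\<^sub>k\<close> and is implied by
  nonvanishing off the origin.  The value at \<open>0\<close> is irrelevant.
\<close>

definition degree_one_symbol :: "(space \<Rightarrow> complex) \<Rightarrow> bool" where
  "degree_one_symbol P \<longleftrightarrow> smooth_on (- {0}) P \<and>
     (\<forall>r>0. \<forall>\<xi>. \<xi> \<noteq> 0 \<longrightarrow> P (r *\<^sub>R \<xi>) = of_real r * P \<xi>) \<and> (\<exists>\<xi>. \<xi> \<noteq> 0 \<and> P \<xi> \<noteq> 0)"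

text \<open>
  Products of distributions are taken in the usual Littlewood-Paley (Bony) sense: \<open>f g\<close> is the
  limit of \<open>S_j f S_j g\<close> as \<open>j\<close> tends to infinity, if this limit exists.  For uniformly locally
  square integrable functions this is the pointwise product.
\<close>

definition has_product :: "(real \<Rightarrow> real) \<Rightarrow> tdist \<Rightarrow> tdist \<Rightarrow> tdist \<Rightarrow> bool" where
  "has_product \<phi>0 f g h \<longleftrightarrow> h \<in> tempered \<and>
     ((\<lambda>j. regular (\<lambda>x. S_fun \<phi>0 j f x * S_fun \<phi>0 j g x)) \<longlongrightarrow> h) at_top"

text \<open>
  The symbol of \<open>e\<^sup>s\<^sup>\<Delta> P(D)\<close> is not smooth at \<open>0\<close>, so this operator does not act on all
  tempered distributions.  The value is defined, when it exists, as the homogeneous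
  Littlewood-Paley sum of the \<open>\<Delta>_k e\<^sup>s\<^sup>\<Delta> P(D) g\<close>, that is, as the limit of
  \<open>(1 - S_j) e\<^sup>s\<^sup>\<Delta> P(D) g\<close> as \<open>j\<close> tends to minus infinity.  For uniformly locally integrable \<open>g\<close>
  this is the convolution of \<open>g\<close> with the (integrable) kernel of \<open>e\<^sup>s\<^sup>\<Delta> P(D)\<close>.
\<close>

definition has_heat_P ::
    "(real \<Rightarrow> real) \<Rightarrow> (space \<Rightarrow> complex) \<Rightarrow> real \<Rightarrow> tdist \<Rightarrow> tdist \<Rightarrow> bool" where
  "has_heat_P \<phi>0 P s g h \<longleftrightarrow> h \<in> tempered \<and>
     ((\<lambda>j. mult_op (\<lambda>\<xi>. (1 - S_symbol \<phi>0 j \<xi>) * of_real (exp (- s * (norm \<xi>)\<^sup>2)) * P \<xi>) g)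
        \<longlongrightarrow> h) at_bot"

text \<open>The time integral is the weak integral in the space of tempered distributions.\<close>

definition has_bilinear ::
    "(real \<Rightarrow> real) \<Rightarrow> (space \<Rightarrow> complex) \<Rightarrow> (real \<Rightarrow> tdist) \<Rightarrow> (real \<Rightarrow> tdist) \<Rightarrow> real \<Rightarrow> tdist \<Rightarrow> bool"
  where
  "has_bilinear \<phi>0 P u v t w \<longleftrightarrow> w \<in> tempered \<and>
     (\<exists>g h. (\<forall>\<tau>\<in>{0<..<t}. has_product \<phi>0 (u \<tau>) (v \<tau>) (g \<tau>) \<and>
                            has_heat_P \<phi>0 P (t - \<tau>) (g \<tau>) (h \<tau>)) \<and>
       (\<forall>\<phi>\<in>schwartz. set_integrable lborel {0<..<t} (\<lambda>\<tau>. h \<tau> \<phi>) \<and>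
                       w \<phi> = (LINT \<tau>:{0<..<t}|lborel. h \<tau> \<phi>)))"

text \<open>
  Functions on \<open>]0,\<infinity>[\<close> are extended by \<open>0\<close>, so that equality of functions means equality
  on \<open>]0,\<infinity>[\<close>.
\<close>

definition bilinear ::
    "(real \<Rightarrow> real) \<Rightarrow> (space \<Rightarrow> complex) \<Rightarrow> (real \<Rightarrow> tdist) \<Rightarrow> (real \<Rightarrow> tdist) \<Rightarrow> real \<Rightarrow> tdist" where
  "bilinear \<phi>0 P u v t = (if 0 < t then (THE w. has_bilinear \<phi>0 P u v t w) else 0)"


section \<open>Admissible couples\<close>

definition scaled_norm :: "(tdist \<Rightarrow> real) \<Rightarrow> real \<Rightarrow> tdist \<Rightarrow> real" where
  "scaled_norm N t f = sqrt t * N (affine_comp (sqrt t) 0 f)"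

definition path_space :: "tdist set \<Rightarrow> (tdist \<Rightarrow> real) \<Rightarrow> (real \<Rightarrow> tdist) set" where
  "path_space F N = {u. (\<forall>t\<le>0. u t = 0) \<and>
     continuous_map (top_of_set {0<..}) (norm_topology F N) u \<and>
     bdd_above ((\<lambda>t. scaled_norm N t (u t)) ` {0<..})}"

definition path_norm :: "(tdist \<Rightarrow> real) \<Rightarrow> (real \<Rightarrow> tdist) \<Rightarrow> real" where
  "path_norm N u = (SUP t\<in>{0<..}. scaled_norm N t (u t))"

definition property_P1 :: "tdist set \<Rightarrow> (tdist \<Rightarrow> real) \<Rightarrow> bool" where
  "property_P1 E NE \<longleftrightarrow> injects_continuously E NE \<and>
     (\<forall>f\<in>E. \<forall>a. \<forall>r>0. cscale (of_real r) (affine_comp r a f) \<in> E \<and>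
                        NE (cscale (of_real r) (affine_comp r a f)) = NE f)"

definition property_P2 ::
    "tdist set \<Rightarrow> (tdist \<Rightarrow> real) \<Rightarrow> tdist set \<Rightarrow> (tdist \<Rightarrow> real) \<Rightarrow> bool" where
  "property_P2 E NE F NF \<longleftrightarrow> injects_continuously F NF \<and>
     (\<forall>f\<in>F. \<forall>a. affine_comp 1 a f \<in> F \<and> NF (affine_comp 1 a f) = NF f) \<and>
     (\<forall>f\<in>tempered. \<forall>r>0. affine_comp r 0 f \<in> F \<longleftrightarrow> f \<in> F) \<and>
     (\<forall>K. compact K \<and> K \<subseteq> {0<..} \<longrightarrow>
        (\<exists>C. \<forall>s\<in>K. \<forall>t\<in>K. \<forall>f\<in>F. scaled_norm NF s f \<le> C * scaled_norm NF t f)) \<and>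
     continuous_map (norm_topology E NE) (norm_topology F NF) (heat 1)"

definition property_P3 ::
    "(real \<Rightarrow> real) \<Rightarrow> (space \<Rightarrow> complex) \<Rightarrow> tdist set \<Rightarrow> (tdist \<Rightarrow> real) \<Rightarrow> bool" where
  "property_P3 \<phi>0 P F NF \<longleftrightarrow>
     (let X = path_space F NF; TX = norm_topology X (path_norm NF) in
       (\<forall>u\<in>X. \<forall>v\<in>X. \<forall>t>0. \<exists>w. has_bilinear \<phi>0 P u v t w) \<and>
       continuous_map (prod_topology TX TX) TX (\<lambda>(u, v). bilinear \<phi>0 P u v) \<and>
       (\<forall>u\<in>X. \<forall>v\<in>X. (bilinear \<phi>0 P u v \<longlongrightarrow> 0) (at_right 0)))"

definition admissible_couple ::
    "(real \<Rightarrow> real) \<Rightarrow> (space \<Rightarrow> complex) \<Rightarrow>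
     tdist set \<Rightarrow> (tdist \<Rightarrow> real) \<Rightarrow> tdist set \<Rightarrow> (tdist \<Rightarrow> real) \<Rightarrow> bool" where
  "admissible_couple \<phi>0 P E NE F NF \<longleftrightarrow>
     banach_distributions E NE \<and> banach_distributions F NF \<and>
     property_P1 E NE \<and> property_P2 E NE F NF \<and> property_P3 \<phi>0 P F NF"

end

(*
  Testing B on heat flows of lacunary sums shows that the time integral diverges logarithmically.
  With real frequencies parallel to a vector \<eta> such that P(\<eta>) is nonzero, the data
  f_n = \<Sum>_{j<n} 2^j exp(i x.2^{j+1} \<eta>)  and  g_n = \<Sum>_{j<n} 2^j exp(i x.(1 - 2^{j+1}) \<eta>)
  are bounded in E uniformly in n, so by (P2) their heat flows are bounded in the path space.
  The product of the flows at time \<tau> carries the frequency \<eta> with amplitude of the order of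
  \<Sum>_{j<n} 4^j exp(-c 4^j \<tau>), whose integral over ]0,1[ grows like n.  Hence the component of
  B(u_n,v_n)(1) at the frequency \<eta> is unbounded, against the continuity of B at (0,0) and the
  continuous injection of F into the tempered distributions.

  All functions involved are finite trigonometric polynomials, on which Fourier multipliers act
  diagonally by Fourier inversion on the Schwartz space.
*)
theory Submission
  imports Defs "HOL-Probability.Characteristic_Functions" "HOL-Probability.Sinc_Integral"
begin

subsection \<open>Schwartz functions\<close>

text \<open>The frequencies make the resonance exact: 2^(j+1) \<eta> and (1 - 2^(k+1)) \<eta> add up
  to \<eta> for j = k, while for j \<noteq> k their sum is at distance at least 2 |\<eta>| from
  \<eta>. A test function whose Fourier transform lives in a ball of radius |\<eta>|/2 therefore
  isolates the resonant pairs; it also stays away from the origin, where P is singular. All resonant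
  pairs contribute positive multiples of the same number P(\<eta>), so nothing cancels. Since F is
  abstract, it is reached through inequalities from both sides. The identity sqrt t (e^(t\<Delta>)
  f)(sqrt t x) = e^\<Delta> (sqrt t f(sqrt t x)) bounds the path norm of a heat flow by the Besov
  norm, and the continuous injection bounds the value at one test function by the norm of F.
  Membership in F is available because an exponential with nonzero frequency is e^\<Delta> of a
  multiple of itself. Continuity of B at (0,0) controls pairs of small path norm. The data are
  therefore multiplied by an amplitude e that depends on the constants of the couple but not on
  n.\<close>

definition pd :: "3 \<Rightarrow> (space \<Rightarrow> complex) \<Rightarrow> space \<Rightarrow> complex" where
  "pd i f x = frechet_derivative f (at x) (axis i 1)"

text \<open>The decay condition of \<open>schwartz\<close> for the empty list of derivatives.
  Separating it from differentiation allows the Schwartz property to be proved by closure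
  arguments.\<close>

definition rapid :: "(space \<Rightarrow> complex) \<Rightarrow> bool" where
  "rapid f \<longleftrightarrow> (\<forall>k. bounded (range (\<lambda>x. (1 + norm x) ^ k *\<^sub>R f x)))"

lemma rapidD:
  assumes "rapid f"
  shows "\<exists>C\<ge>0. \<forall>x. (1 + norm x) ^ k * norm (f x) \<le> C"
proof -
  obtain C where "C > 0" "\<forall>y\<in>range (\<lambda>x. (1 + norm x) ^ k *\<^sub>R f x). norm y \<le> C"
    using assms unfolding rapid_def bounded_pos by blast
  then show ?thesis by (intro exI[of _ C]) auto
qed

lemma rapidI:
  assumes "\<And>k. \<exists>C. \<forall>x. (1 + norm x) ^ k * norm (f x) \<le> C"
  shows "rapid f"
  unfolding rapid_def bounded_iff using assms by simp

lemma pd_eqI: "(f has_derivative f') (at x) \<Longrightarrow> pd i f x = f' (axis i 1)"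
  unfolding pd_def by (metis frechet_derivative_at)

lemma partials_Cons_pd: "partials (i # is) f = pd i (partials is f)"
  by (simp add: pd_def fun_eq_iff)

lemma partials_append: "partials (is @ js) f = partials is (partials js f)"
  by (induction "is") auto

text \<open>All iterated partial derivatives stay in \<open>X\<close>, so conditions quantified over
  lists of directions reduce to conditions on single members of \<open>X\<close>.\<close>

lemma schwartz_coinduct:
  assumes "f \<in> X"
    and "\<And>g x. g \<in> X \<Longrightarrow> g differentiable (at x)"
    and "\<And>g i. g \<in> X \<Longrightarrow> pd i g \<in> X"
    and "\<And>g. g \<in> X \<Longrightarrow> rapid g"
  shows "f \<in> schwartz"
proof -
  have "partials is f \<in> X" for "is"
    by (induction "is") (use assms(1,3) in \<open>auto simp: partials_Cons_pd simp del: partials.simps(2)\<close>)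
  then show ?thesis
    using assms(2,4) by (auto simp: schwartz_def smooth_on_def rapid_def)
qed

lemma schwartz_differentiable: "f \<in> schwartz \<Longrightarrow> f differentiable (at x)"
  unfolding schwartz_def smooth_on_def by (auto dest: spec[of _ "[]"])

lemma schwartz_rapid: "f \<in> schwartz \<Longrightarrow> rapid f"
  unfolding schwartz_def rapid_def by (auto dest: spec[of _ "[]"])

lemma schwartz_pd: "f \<in> schwartz \<Longrightarrow> pd i f \<in> schwartz"
proof -
  assume f: "f \<in> schwartz"
  \<comment> \<open>\<open>partials\<close> applies the head of its list last, so the derivative
    taken first goes to the end of the list.\<close>
  have "partials is (pd i f) = partials (is @ [i]) f" for "is"
    by (simp add: partials_append pd_def[abs_def])
  with f show ?thesis
    unfolding schwartz_def smooth_on_def by auto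
qed

lemma schwartz_has_derivative:
  assumes "f \<in> schwartz"
  shows "(f has_derivative (\<lambda>h. \<Sum>i\<in>UNIV. of_real (h $ i) * pd i f x)) (at x)"
proof -
  have D: "(f has_derivative frechet_derivative f (at x)) (at x)"
    using schwartz_differentiable[OF assms] frechet_derivative_works by blast
  then have lin: "linear (frechet_derivative f (at x))"
    using has_derivative_linear by blast
  have "frechet_derivative f (at x) h = (\<Sum>i\<in>UNIV. of_real (h $ i) * pd i f x)" for h
  proof -
    have "frechet_derivative f (at x) h = frechet_derivative f (at x) (\<Sum>i\<in>UNIV. h $ i *\<^sub>R axis i 1)"
      by (metis (no_types, lifting) basis_expansion scalar_mult_eq_scaleR sum.cong)
    also have "\<dots> = (\<Sum>i\<in>UNIV. h $ i *\<^sub>R frechet_derivative f (at x) (axis i 1))"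
      by (simp add: linear_sum[OF lin] linear_scale[OF lin])
    finally show ?thesis by (simp add: pd_def scaleR_conv_of_real)
  qed
  then have "frechet_derivative f (at x) = (\<lambda>h. \<Sum>i\<in>UNIV. of_real (h $ i) * pd i f x)" by blast
  then show ?thesis using D by simp
qed

text \<open>
  If the partial derivatives of the generators in \<open>B\<close> stay in this span, then the span is
  closed under differentiation, so that the Schwartz property only has to be checked on \<open>B\<close>.
\<close>

inductive_set closure_span :: "(space \<Rightarrow> complex) set \<Rightarrow> (space \<Rightarrow> complex) set" for B where
  base: "f \<in> B \<Longrightarrow> f \<in> closure_span B"
| add: "f \<in> closure_span B \<Longrightarrow> g \<in> closure_span B \<Longrightarrow> (\<lambda>x. f x + g x) \<in> closure_span B"
| scale: "f \<in> closure_span B \<Longrightarrow> (\<lambda>x. c * f x) \<in> closure_span B"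
| coord: "f \<in> closure_span B \<Longrightarrow> (\<lambda>x. of_real (x $ i) * f x) \<in> closure_span B"

lemma rapid_add: "rapid f \<Longrightarrow> rapid g \<Longrightarrow> rapid (\<lambda>x. f x + g x)"
  unfolding rapid_def by (auto simp: scaleR_add_right intro!: bounded_plus_comp)

lemma rapid_scale: "rapid f \<Longrightarrow> rapid (\<lambda>x. c * f x)"
proof (rule rapidI)
  fix k assume "rapid f"
  then obtain C where C: "\<forall>x. (1 + norm x) ^ k * norm (f x) \<le> C" using rapidD by blast
  show "\<exists>C. \<forall>x. (1 + norm x) ^ k * norm (c * f x) \<le> C"
  proof (rule exI[of _ "norm c * C"], rule allI)
    fix x show "(1 + norm x) ^ k * norm (c * f x) \<le> norm c * C"
      using mult_left_mono[OF C[rule_format, of x], of "norm c"] by (simp add: norm_mult ac_simps)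
  qed
qed

lemma rapid_dominated:
  assumes "rapid f" and "\<And>x. norm (g x) \<le> C * (1 + norm x) ^ n * norm (f x)" and "C \<ge> 0"
  shows "rapid g"
proof (rule rapidI)
  fix k
  obtain D where D: "\<forall>x. (1 + norm x) ^ (k + n) * norm (f x) \<le> D" using rapidD[OF assms(1)] by blast
  show "\<exists>C. \<forall>x. (1 + norm x) ^ k * norm (g x) \<le> C"
  proof (rule exI[of _ "C * D"], rule allI)
    fix x
    have "(1 + norm x) ^ k * norm (g x) \<le> (1 + norm x) ^ k * (C * (1 + norm x) ^ n * norm (f x))"
      by (intro mult_left_mono assms(2)) auto
    also have "\<dots> = C * ((1 + norm x) ^ (k + n) * norm (f x))" by (simp add: power_add)
    also have "\<dots> \<le> C * D" using D assms(3) by (intro mult_left_mono) auto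
    finally show "(1 + norm x) ^ k * norm (g x) \<le> C * D" .
  qed
qed

lemma rapid_coord: "rapid f \<Longrightarrow> rapid (\<lambda>x. of_real (x $ i) * f x)"
  by (erule rapid_dominated[where C=1 and n=1])
     (auto simp: norm_mult intro!: mult_right_mono order_trans[OF component_le_norm_cart])

lemma pd_add:
  "f differentiable (at x) \<Longrightarrow> g differentiable (at x) \<Longrightarrow> pd i (\<lambda>x. f x + g x) x = pd i f x + pd i g x"
  unfolding frechet_derivative_works by (subst pd_eqI[OF has_derivative_add]) (auto simp: pd_def)

lemma pd_mult:
  assumes "f differentiable (at x)" and "g differentiable (at x)"
  shows "pd i (\<lambda>x. f x * g x) x = f x * pd i g x + pd i f x * g x"
  by (subst pd_eqI[OF has_derivative_mult[OF assms[unfolded frechet_derivative_works]]]) (simp add: pd_def)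

lemma coord_has_derivative:
  "((\<lambda>x::space. of_real (x $ i) :: complex) has_derivative (\<lambda>h. of_real (h $ i))) (at x)"
  by (intro bounded_linear_imp_has_derivative bounded_linear_compose[OF bounded_linear_of_real bounded_linear_vec_nth])

lemma pd_coord: "pd k (\<lambda>x. of_real (x $ i)) x = of_real (axis k 1 $ i)"
  by (rule pd_eqI[OF coord_has_derivative])

lemma coord_differentiable: "(\<lambda>x::space. of_real (x $ i) :: complex) differentiable (at x)"
  using coord_has_derivative differentiable_def by blast

lemma closure_span_subset_schwartz:
  assumes D: "\<And>f x. f \<in> B \<Longrightarrow> f differentiable (at x)"
    and P: "\<And>f i. f \<in> B \<Longrightarrow> pd i f \<in> closure_span B"
    and R: "\<And>f. f \<in> B \<Longrightarrow> rapid f"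
  shows "closure_span B \<subseteq> schwartz"
proof
  fix f assume f: "f \<in> closure_span B"
  have diff: "g differentiable (at x)" if "g \<in> closure_span B" for g x
    using that
  proof induction
    case (base f) then show ?case by (rule D)
  next
    case (add f g) then show ?case by (intro differentiable_add)
  next
    case (scale f c) then show ?case by (intro differentiable_mult differentiable_const)
  next
    case (coord f i) then show ?case by (intro differentiable_mult coord_differentiable)
  qed
  show "f \<in> schwartz"
  proof (rule schwartz_coinduct[OF f diff])
    show "rapid g" if "g \<in> closure_span B" for g
      using that by induction (auto intro: R rapid_add rapid_scale rapid_coord)
    show "pd i g \<in> closure_span B" if "g \<in> closure_span B" for g i
      using that
    proof induction
      case (base f) then show ?case by (rule P)
    next
      case (add f g)
      have "pd i (\<lambda>x. f x + g x) = (\<lambda>x. pd i f x + pd i g x)"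
        using add by (auto simp: pd_add diff)
      then show ?case using add by (auto intro: closure_span.intros)
    next
      case (scale f c)
      have "pd i (\<lambda>x. c * f x) x = c * pd i f x" for x
        using pd_mult[of "\<lambda>_. c" x f i] scale(1) by (simp add: diff) (simp add: pd_def)
      then show ?case using scale by (auto intro: closure_span.intros simp: fun_eq_iff[symmetric])
    next
      case (coord f k)
      have "pd i (\<lambda>x. of_real (x $ k) * f x) = (\<lambda>x. of_real (x $ k) * pd i f x + of_real (axis i 1 $ k) * f x)"
        using coord(1) by (auto simp: pd_mult coord_differentiable pd_coord diff)
      then show ?case using coord by (auto intro: closure_span.intros)
    qed
  qed
qed

text \<open>With the whole Schwartz space as set of generators, closure under sums, scalars and
  multiplication by coordinates follows at once.\<close>

lemma closure_span_schwartz: "closure_span schwartz \<subseteq> schwartz"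
  by (rule closure_span_subset_schwartz)
     (auto intro: schwartz_differentiable schwartz_rapid closure_span.base schwartz_pd)

lemma schwartz_add: "f \<in> schwartz \<Longrightarrow> g \<in> schwartz \<Longrightarrow> (\<lambda>x. f x + g x) \<in> schwartz"
  by (rule subsetD[OF closure_span_schwartz]) (intro closure_span.add closure_span.base)

lemma schwartz_scale: "f \<in> schwartz \<Longrightarrow> (\<lambda>x. c * f x) \<in> schwartz"
  by (rule subsetD[OF closure_span_schwartz]) (intro closure_span.scale closure_span.base)

lemma schwartz_coord: "f \<in> schwartz \<Longrightarrow> (\<lambda>x. of_real (x $ i) * f x) \<in> schwartz"
  by (rule subsetD[OF closure_span_schwartz]) (intro closure_span.coord closure_span.base)

lemma rapid_bounded: "rapid f \<Longrightarrow> \<exists>C\<ge>0. \<forall>x. norm (f x) \<le> C"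
  using rapidD[of f 0] by simp

text \<open>Products of two Schwartz functions are the generators: by the product rule a derivative
  of one is a sum of two others.\<close>

lemma schwartz_mult:
  assumes "f \<in> schwartz" "g \<in> schwartz"
  shows "(\<lambda>x. f x * g x) \<in> schwartz"
proof -
  define B where "B = {\<lambda>x. f x * g x | f g. f \<in> schwartz \<and> g \<in> schwartz}"
  have "closure_span B \<subseteq> schwartz"
  proof (rule closure_span_subset_schwartz)
    fix h assume "h \<in> B"
    then obtain f g where h: "h = (\<lambda>x. f x * g x)" and fg: "f \<in> schwartz" "g \<in> schwartz"
      by (auto simp: B_def)
    note d = schwartz_differentiable[OF fg(1)] schwartz_differentiable[OF fg(2)]
    show "h differentiable (at x)" for x unfolding h by (intro differentiable_mult d)
    obtain C where "C \<ge> 0" "\<forall>x. norm (f x) \<le> C" using rapid_bounded schwartz_rapid fg by blast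
    then show "rapid h" unfolding h
      by (intro rapid_dominated[OF schwartz_rapid[OF fg(2)], of _ C 0]) (auto simp: norm_mult intro: mult_right_mono)
    have "pd i h = (\<lambda>x. f x * pd i g x + pd i f x * g x)" for i
      unfolding h using pd_mult[OF d] by auto
    moreover have "(\<lambda>x. f x * pd i g x) \<in> B" "(\<lambda>x. pd i f x * g x) \<in> B" for i
      unfolding B_def using fg schwartz_pd by blast+
    ultimately show "pd i h \<in> closure_span B" for i
      by (simp only: closure_span.base closure_span.add)
  qed
  moreover have "(\<lambda>x. f x * g x) \<in> B" using assms by (auto simp: B_def)
  ultimately show ?thesis by (meson closure_span.base subsetD)
qed

section \<open>Affine substitutions and radial Schwartz functions\<close>

lemma one_plus_norm_affine_le: "1 + norm x \<le> (1 + norm b / a + 1 / a) * (1 + norm (a *\<^sub>R x + b))"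
  if "a > 0" for x b :: "'a::real_normed_vector"
proof -
  have "norm (a *\<^sub>R x) \<le> norm (a *\<^sub>R x + b) + norm b"
    by (metis add_diff_cancel_right' norm_triangle_ineq4)
  then have "norm x \<le> (norm (a *\<^sub>R x + b) + norm b) / a"
    using that by (simp add: field_simps)
  moreover have "0 \<le> norm b * norm (a *\<^sub>R x + b) / a" "1 / a > 0" using that by simp_all
  \<comment> \<open>The constant is chosen so that this expansion contains 1 and the bound for |x|,
    all other terms being nonnegative.\<close>
  moreover have "(1 + norm b / a + 1 / a) * (1 + n) = 1 + n + 1 / a + (n + norm b) / a + norm b * n / a" for n
    using that by (simp add: field_simps)
  ultimately show ?thesis by (smt (verit) norm_ge_zero)
qed

lemma rapid_affine:
  assumes "rapid f" "a \<noteq> 0"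
  shows "rapid (\<lambda>x. f (a *\<^sub>R x + b))"
proof -
  define K where "K = 1 + norm b / \<bar>a\<bar> + 1 / \<bar>a\<bar>"
  have K: "1 + norm x \<le> K * (1 + norm (a *\<^sub>R x + b))" for x :: space
  proof (cases "a > 0")
    case True then show ?thesis using one_plus_norm_affine_le[of a x b] unfolding K_def by simp
  next
    case False
    then show ?thesis using one_plus_norm_affine_le[of "-a" "-x" b] assms unfolding K_def by simp
  qed
  show ?thesis
  proof (rule rapidI)
    fix k
    obtain C where C: "\<forall>x. (1 + norm x) ^ k * norm (f x) \<le> C" using rapidD[OF assms(1)] by blast
    have K0: "K \<ge> 0" unfolding K_def by auto
    have "(1 + norm x) ^ k * norm (f (a *\<^sub>R x + b)) \<le> K ^ k * C" for x
    proof -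
      have "(1 + norm x) ^ k \<le> (K * (1 + norm (a *\<^sub>R x + b))) ^ k" by (intro power_mono K) auto
      then have "(1 + norm x) ^ k * norm (f (a *\<^sub>R x + b)) \<le> (K * (1 + norm (a *\<^sub>R x + b))) ^ k * norm (f (a *\<^sub>R x + b))"
        by (intro mult_right_mono) auto
      also have "\<dots> = K ^ k * ((1 + norm (a *\<^sub>R x + b)) ^ k * norm (f (a *\<^sub>R x + b)))" by (simp add: power_mult_distrib)
      also have "\<dots> \<le> K ^ k * C" using C K0 by (intro mult_left_mono) auto
      finally show ?thesis .
    qed
    then show "\<exists>C. \<forall>x. (1 + norm x) ^ k * norm (f (a *\<^sub>R x + b)) \<le> C" by blast
  qed
qed

lemma affine_has_derivative:
  fixes b :: space
  shows "((\<lambda>x. a *\<^sub>R x + b) has_derivative (\<lambda>h. a *\<^sub>R h)) (at x)"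
  by (auto intro!: derivative_eq_intros)

lemma compose_affine_has_derivative:
  fixes f :: "space \<Rightarrow> complex"
  assumes "f differentiable (at (a *\<^sub>R x + b))"
  shows "((\<lambda>x. f (a *\<^sub>R x + b)) has_derivative (\<lambda>h. frechet_derivative f (at (a *\<^sub>R x + b)) (a *\<^sub>R h))) (at x)"
  using diff_chain_at[OF affine_has_derivative, of f _ a x b] assms unfolding frechet_derivative_works o_def by blast

lemma pd_affine:
  assumes "f differentiable (at (a *\<^sub>R x + b))"
  shows "pd i (\<lambda>x. f (a *\<^sub>R x + b)) x = of_real a * pd i f (a *\<^sub>R x + b)"
  using linear_scale[OF has_derivative_linear[OF assms[unfolded frechet_derivative_works]]]
  by (subst pd_eqI[OF compose_affine_has_derivative[OF assms]]) (simp add: pd_def scaleR_conv_of_real)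

lemma schwartz_affine:
  assumes "f \<in> schwartz" "a \<noteq> 0"
  shows "(\<lambda>x. f (a *\<^sub>R x + b)) \<in> schwartz"
proof -
  define B where "B = {\<lambda>x. f (a *\<^sub>R x + b) | f. f \<in> schwartz}"
  have "closure_span B \<subseteq> schwartz"
  proof (rule closure_span_subset_schwartz)
    fix h assume "h \<in> B"
    then obtain f where h: "h = (\<lambda>x. f (a *\<^sub>R x + b))" and f: "f \<in> schwartz" by (auto simp: B_def)
    note d = schwartz_differentiable[OF f]
    show "h differentiable (at x)" for x
      unfolding h using compose_affine_has_derivative[OF d] differentiable_def by blast
    show "rapid h" unfolding h by (intro rapid_affine schwartz_rapid f assms)
    have "pd i h = (\<lambda>x. of_real a * pd i f (a *\<^sub>R x + b))" for i
      unfolding h using pd_affine[OF d] by auto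
    moreover have "(\<lambda>x. pd i f (a *\<^sub>R x + b)) \<in> B" for i
      unfolding B_def using f schwartz_pd by blast+
    ultimately show "pd i h \<in> closure_span B" for i
      by (simp only: closure_span.base closure_span.scale)
  qed
  moreover have "(\<lambda>x. f (a *\<^sub>R x + b)) \<in> B" using assms by (auto simp: B_def)
  ultimately show ?thesis by (meson closure_span.base subsetD)
qed

lemma radial_has_derivative:
  fixes \<psi> :: "real \<Rightarrow> real"
  assumes "(\<psi> has_real_derivative d) (at (c * (norm x)\<^sup>2))"
  shows "((\<lambda>x::space. of_real (\<psi> (c * (norm x)\<^sup>2)) :: complex) has_derivative
     (\<lambda>h. of_real (d * (c * (2 * (x \<bullet> h)))))) (at x)"
proof -
  have "((\<lambda>x::space. c * (norm x)\<^sup>2) has_derivative (\<lambda>h. c * (2 * (x \<bullet> h)))) (at x)"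
    by (auto intro!: derivative_eq_intros simp: power2_norm_eq_inner inner_commute)
  then have "((\<lambda>x::space. \<psi> (c * (norm x)\<^sup>2)) has_derivative (\<lambda>h. d * (c * (2 * (x \<bullet> h))))) (at x)"
    using assms diff_chain_at unfolding o_def has_field_derivative_def by fastforce
  then show ?thesis
    by (rule bounded_linear.has_derivative[OF bounded_linear_of_real])
qed

text \<open>\<open>\<psi> n\<close> is the n-th derivative of the profile. Differentiating
  \<open>\<psi> n\<close> at c |x|^2 in direction i gives 2 c x_i times
  \<open>\<psi> (Suc n)\<close> at the same point, which stays in the span because multiplication by
  coordinates is built into \<open>closure_span\<close>.\<close>

lemma schwartz_radial:
  fixes \<psi> :: "nat \<Rightarrow> real \<Rightarrow> real"
  assumes D: "\<And>n x. (\<psi> n has_real_derivative \<psi> (Suc n) x) (at x)"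
    and bd: "\<And>n k. \<exists>C. \<forall>x\<ge>0. (1 + x) ^ k * \<bar>\<psi> n x\<bar> \<le> C"
    and c: "c > 0"
  shows "(\<lambda>x. of_real (\<psi> 0 (c * (norm x)\<^sup>2))) \<in> schwartz"
proof -
  define b :: "nat \<Rightarrow> space \<Rightarrow> complex" where "b n x = of_real (\<psi> n (c * (norm x)\<^sup>2))" for n x
  have d: "(b n has_derivative (\<lambda>h. of_real (\<psi> (Suc n) (c * (norm x)\<^sup>2) * (c * (2 * (x \<bullet> h)))))) (at x)" for n x
    unfolding b_def[abs_def] by (rule radial_has_derivative[OF D])
  have "closure_span (range b) \<subseteq> schwartz"
  proof (rule closure_span_subset_schwartz)
    fix f assume "f \<in> range b"
    then obtain n where f: "f = b n" by blast
    show "f differentiable (at x)" for x using d f differentiable_def by blast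
    show "rapid f"
    proof (rule rapidI)
      fix k
      obtain C where C: "\<And>x. x \<ge> 0 \<Longrightarrow> (1 + x) ^ k * \<bar>\<psi> n x\<bar> \<le> C" using bd by blast
      \<comment> \<open>With |x| \<le> 1 + |x|^2 this yields 1 + |x| \<le> K (1 + c |x|^2), so that
        decay in c |x|^2 gives decay in |x|.\<close>
      define K where "K = 2 + 1 / c"
      have "(1 + norm x) ^ k * norm (b n x) \<le> K ^ k * C" for x :: space
      proof -
        have "norm x \<le> 1 + (norm x)\<^sup>2" using zero_le_power2[of "norm x - 1"] norm_ge_zero[of x]
          unfolding power2_diff by (smt (verit) mult_cancel_left2 one_power2)
        moreover have "K * (1 + c * (norm x)\<^sup>2) = 2 + 1 / c + (norm x)\<^sup>2 + 2 * (c * (norm x)\<^sup>2)"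
          using c unfolding K_def by (simp add: distrib_left distrib_right)
        moreover have "0 \<le> c * (norm x)\<^sup>2" "0 < 1 / c" using c by simp_all
        ultimately have "1 + norm x \<le> K * (1 + c * (norm x)\<^sup>2)" by linarith
        then have "(1 + norm x) ^ k \<le> (K * (1 + c * (norm x)\<^sup>2)) ^ k" by (intro power_mono) auto
        then have "(1 + norm x) ^ k * norm (b n x) \<le> (K * (1 + c * (norm x)\<^sup>2)) ^ k * norm (b n x)"
          by (intro mult_right_mono) auto
        also have "\<dots> = K ^ k * ((1 + c * (norm x)\<^sup>2) ^ k * \<bar>\<psi> n (c * (norm x)\<^sup>2)\<bar>)"
          by (simp add: power_mult_distrib b_def)
        also have "\<dots> \<le> K ^ k * C" using c by (intro mult_left_mono C) (auto simp: K_def)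
        finally show ?thesis .
      qed
      then show "\<exists>C. \<forall>x. (1 + norm x) ^ k * norm (f x) \<le> C" unfolding f by blast
    qed
    fix i
    have "pd i f = (\<lambda>x. of_real (2 * c) * (of_real (x $ i) * b (Suc n) x))"
      unfolding f by (auto simp: pd_eqI[OF d] inner_axis b_def)
    then show "pd i f \<in> closure_span (range b)" by (simp only: closure_span.intros rangeI)
  qed
  then have "b 0 \<in> schwartz" by (meson closure_span.base rangeI subsetD)
  then show ?thesis by (simp add: b_def[abs_def])
qed

subsection \<open>The Fourier transform of Schwartz functions\<close>

text \<open>Fubini in coordinates: Lebesgue measure is the image of a product of one-dimensional
  Lebesgue measures. It reduces the integrability of \<open>weight\<close> and the transform of the
  Gaussian to the line.\<close>

lemma lborel_integral_prod_Basis: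
  fixes F :: "'a::euclidean_space \<Rightarrow> real \<Rightarrow> complex"
  assumes F: "\<And>b. b \<in> Basis \<Longrightarrow> integrable lborel (F b)"
  shows "integrable lborel (\<lambda>x. \<Prod>b\<in>Basis. F b (x \<bullet> b))"
    and "(LINT x|lborel. (\<Prod>b\<in>Basis. F b (x \<bullet> b))) = (\<Prod>b\<in>Basis. LINT x|lborel. F b x)"
proof -
  interpret product_sigma_finite "\<lambda>_::'a. lborel :: real measure" ..
  have [measurable]: "\<And>b. b \<in> Basis \<Longrightarrow> F b \<in> borel_measurable borel"
    using F by (auto dest: borel_measurable_integrable)
  have m: "(\<lambda>f::'a \<Rightarrow> real. \<Sum>b\<in>Basis. f b *\<^sub>R b) \<in> (\<Pi>\<^sub>M b\<in>(Basis::'a set). lborel) \<rightarrow>\<^sub>M borel"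
    by simp
  have I: "integrable (\<Pi>\<^sub>M b\<in>(Basis::'a set). lborel) (\<lambda>x. \<Prod>b\<in>Basis. F b (x b))"
    by (rule product_integrable_prod[OF finite_Basis F])
  have eq: "(\<Prod>b\<in>Basis. F b ((\<Sum>c\<in>Basis. x c *\<^sub>R c) \<bullet> b)) = (\<Prod>b\<in>Basis. F b (x b))" for x
    by (intro prod.cong refl arg_cong[where f="F _"] inner_sum_left_Basis)
  have m': "(\<lambda>x::'a. \<Prod>b\<in>Basis. F b (x \<bullet> b)) \<in> borel_measurable borel"
    by measurable
  show "integrable lborel (\<lambda>x. \<Prod>b\<in>Basis. F b (x \<bullet> b))"
    unfolding lborel_eq[where 'a='a] integrable_distr_eq[OF m m'] eq by (rule I)
  show "(LINT x|lborel. (\<Prod>b\<in>Basis. F b (x \<bullet> b))) = (\<Prod>b\<in>Basis. LINT x|lborel. F b x)"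
    unfolding lborel_eq[where 'a='a] integral_distr[OF m m'] eq
    by (rule product_integral_prod[OF finite_Basis F])
qed

section \<open>An integrable majorant for rapidly decreasing functions\<close>

lemma integrable_inverse_one_plus_square: "integrable lborel (\<lambda>x::real. inverse (1 + x\<^sup>2))"
  using integrable_inverse_1_plus_square by (simp add: set_integrable_def)

text \<open>The product form makes integrability a one-dimensional fact, while the function is still
  bounded below by a power of 1 + |x|.\<close>

definition weight :: "space \<Rightarrow> real" where
  "weight x = (\<Prod>b\<in>Basis. inverse (1 + (x \<bullet> b)\<^sup>2))"

lemma weight_integrable: "integrable lborel weight"
proof -
  have "integrable lborel (\<lambda>x::space. \<Prod>b\<in>Basis. (of_real (inverse (1 + (x \<bullet> b)\<^sup>2)) :: complex))"
    by (rule lborel_integral_prod_Basis) (rule integrable_of_real[OF integrable_inverse_one_plus_square])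
  then have "integrable lborel (\<lambda>x::space. Re (of_real (weight x)))"
    unfolding weight_def of_real_prod[symmetric] by (rule integrable_Re)
  then show ?thesis by (simp add: eta_contract_eq)
qed

text \<open>Each of the three factors 1 + x_b^2 is at most (1 + |x|)^2, hence the exponent
  6.\<close>

lemma inverse_le_weight: "inverse ((1 + norm x) ^ 6) \<le> weight x"
proof -
  have "(\<Prod>b\<in>Basis. (1 + (x \<bullet> b)\<^sup>2)) \<le> (\<Prod>b\<in>(Basis::space set). (1 + norm x)\<^sup>2)"
  proof (intro prod_mono conjI)
    fix b :: space assume "b \<in> Basis"
    then have "\<bar>x \<bullet> b\<bar> \<le> norm x" by (rule Basis_le_norm)
    then have "(x \<bullet> b)\<^sup>2 \<le> (norm x)\<^sup>2" by (metis abs_norm_cancel abs_le_square_iff)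
    then show "1 + (x \<bullet> b)\<^sup>2 \<le> (1 + norm x)\<^sup>2" by (simp add: power2_sum add_increasing2)
  qed simp
  also have "\<dots> = (1 + norm x) ^ 6" by (simp flip: power_mult)
  finally have "(\<Prod>b\<in>Basis. (1 + (x \<bullet> b)\<^sup>2)) \<le> (1 + norm x) ^ 6" .
  moreover have "0 < (\<Prod>b\<in>Basis. (1 + (x \<bullet> b)\<^sup>2))" by (intro prod_pos) (simp add: add_pos_nonneg)
  ultimately have "inverse ((1 + norm x) ^ 6) \<le> inverse (\<Prod>b\<in>Basis. (1 + (x \<bullet> b)\<^sup>2))"
    by (rule le_imp_inverse_le)
  then show ?thesis by (simp add: weight_def prod_inversef[symmetric])
qed

lemma le_weightI:
  assumes "(1 + norm x) ^ 6 * r \<le> C" "C \<ge> 0"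
  shows "r \<le> C * weight x"
proof -
  have "r \<le> C * inverse ((1 + norm x) ^ 6)"
    using assms add_pos_nonneg[OF zero_less_one norm_ge_zero[of x]]
    by (simp add: pos_le_divide_eq mult.commute flip: divide_inverse)
  also have "\<dots> \<le> C * weight x" by (intro mult_left_mono inverse_le_weight assms)
  finally show ?thesis .
qed

lemma rapid_integrable:
  assumes "rapid f" and m: "f \<in> borel_measurable borel"
  shows "integrable lborel f"
proof -
  obtain C where C: "C \<ge> 0" "\<forall>x. (1 + norm x) ^ 6 * norm (f x) \<le> C" using rapidD[OF assms(1)] by blast
  have "norm (f x) \<le> norm (C * weight x)" for x
    using le_weightI[of x "norm (f x)" C] C unfolding real_norm_def by (meson abs_ge_self order_trans)
  then show ?thesis
    by (intro Bochner_Integration.integrable_bound[OF integrable_mult_right[OF weight_integrable, of C]]) (use m in auto)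
qed

lemma schwartz_continuous: "f \<in> schwartz \<Longrightarrow> continuous_on S f"
  by (intro continuous_at_imp_continuous_on ballI differentiable_imp_continuous_within schwartz_differentiable)

lemma schwartz_measurable: "f \<in> schwartz \<Longrightarrow> f \<in> borel_measurable borel"
  by (intro borel_measurable_continuous_onI schwartz_continuous)

lemma schwartz_integrable: "f \<in> schwartz \<Longrightarrow> integrable lborel f"
  by (intro rapid_integrable schwartz_rapid schwartz_measurable)

lemma lborel_integral_affine_space:
  fixes f :: "space \<Rightarrow> complex"
  assumes "a \<noteq> 0" and [measurable]: "f \<in> borel_measurable borel"
  shows "(LINT x|lborel. f x) = of_real (\<bar>a\<bar> ^ 3) * (LINT x|lborel. f (a *\<^sub>R x + b))"
proof -
  have "(LINT x|lborel. f x) = (LINT x|distr lborel borel (\<lambda>x. b + a *\<^sub>R x). \<bar>a\<bar> ^ 3 *\<^sub>R f x)"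
    using assms by (subst lborel_affine[OF assms(1), of b], subst integral_density) (auto simp: DIM_cart)
  also have "\<dots> = (LINT x|lborel. \<bar>a\<bar> ^ 3 *\<^sub>R f (a *\<^sub>R x + b))"
    by (subst integral_distr) (auto simp: add.commute)
  finally show ?thesis by (simp add: scaleR_conv_of_real)
qed

section \<open>Elementary rules for the Fourier transform\<close>

lemma integrable_exp_mult:
  assumes "integrable lborel f" "\<And>x. norm (e x) = 1" "e \<in> borel_measurable borel"
  shows "integrable lborel (\<lambda>x. e x * f x :: complex)"
  by (rule Bochner_Integration.integrable_bound[OF assms(1)])
     (use assms borel_measurable_integrable[OF assms(1)] in \<open>auto simp: norm_mult\<close>)

lemma fourier_integrable:
  "integrable lborel f \<Longrightarrow> integrable lborel (\<lambda>x. exp (- (\<i> * of_real (x \<bullet> \<xi>))) * f x)"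
  by (rule integrable_exp_mult) (auto simp: norm_exp_eq_Re)

lemma norm_fourier_le: "norm (fourier f \<xi>) \<le> (LINT x|lborel. norm (f x))"
  unfolding fourier_def by (rule order_trans[OF integral_norm_bound]) (simp add: norm_mult norm_exp_eq_Re)

lemma fourier_add:
  "integrable lborel f \<Longrightarrow> integrable lborel g \<Longrightarrow> fourier (\<lambda>x. f x + g x) \<xi> = fourier f \<xi> + fourier g \<xi>"
  unfolding fourier_def by (simp add: distrib_left fourier_integrable)

lemma fourier_scale: "fourier (\<lambda>x. c * f x) \<xi> = c * fourier f \<xi>"
proof -
  have "(\<lambda>x. exp (- (\<i> * of_real (x \<bullet> \<xi>))) * (c * f x)) = (\<lambda>x. c * (exp (- (\<i> * of_real (x \<bullet> \<xi>))) * f x))"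
    by auto
  then show ?thesis unfolding fourier_def by (simp only: integral_mult_right_zero)
qed

text \<open>One substitution rule for translations (a = 1), reflections (a = -1) and dilations; the
  modulus of a appears because a may be negative.\<close>

lemma fourier_affine:
  assumes "a \<noteq> 0" "f \<in> borel_measurable borel"
  shows "fourier f (\<xi> /\<^sub>R a) = of_real (\<bar>a\<bar> ^ 3) * exp (- (\<i> * of_real (b \<bullet> \<xi> / a))) * fourier (\<lambda>x. f (a *\<^sub>R x + b)) \<xi>"
proof -
  have "exp (- (\<i> * of_real ((a *\<^sub>R x + b) \<bullet> (\<xi> /\<^sub>R a)))) * f (a *\<^sub>R x + b)
      = exp (- (\<i> * of_real (b \<bullet> \<xi> / a))) * (exp (- (\<i> * of_real (x \<bullet> \<xi>))) * f (a *\<^sub>R x + b))" for x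
  proof -
    have "(a *\<^sub>R x + b) \<bullet> (\<xi> /\<^sub>R a) = b \<bullet> \<xi> / a + x \<bullet> \<xi>"
      using assms by (simp add: inner_simps field_simps)
    then have "exp (- (\<i> * of_real ((a *\<^sub>R x + b) \<bullet> (\<xi> /\<^sub>R a)))) = exp (- (\<i> * of_real (b \<bullet> \<xi> / a))) * exp (- (\<i> * of_real (x \<bullet> \<xi>)))"
      by (simp add: exp_add[symmetric] algebra_simps)
    then show ?thesis by simp
  qed
  note eq = this
  have [measurable]: "f \<in> borel_measurable borel" by fact
  have "fourier f (\<xi> /\<^sub>R a) = of_real (\<bar>a\<bar> ^ 3) *
      (LINT x|lborel. exp (- (\<i> * of_real ((a *\<^sub>R x + b) \<bullet> (\<xi> /\<^sub>R a)))) * f (a *\<^sub>R x + b))"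
    unfolding fourier_def by (rule lborel_integral_affine_space[OF assms(1)]) measurable
  then show ?thesis unfolding eq fourier_def by (simp only: integral_mult_right_zero mult.assoc)
qed

lemma fourier_translate:
  assumes "f \<in> borel_measurable borel"
  shows "fourier (\<lambda>x. f (x + b)) \<xi> = exp (\<i> * of_real (b \<bullet> \<xi>)) * fourier f \<xi>"
  using fourier_affine[of 1 f \<xi> b] assms by (simp add: exp_minus field_simps)

section \<open>The Fourier transform exchanges derivatives and coordinates\<close>

lemma one_plus_norm_shift: "1 + norm x \<le> 2 * (1 + norm (x + y))" if "norm y \<le> 1"
proof -
  have "norm x \<le> norm (x + y) + norm y" using norm_triangle_ineq4[of "x + y" y] by simp
  moreover have "0 \<le> norm (x + y)" by simp
  ultimately show ?thesis using that by argo
qed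

text \<open>Prepares dominated convergence for difference quotients. The mean value inequality
  bounds the quotient by the partial derivative on a segment of length at most 1, and shifting the
  decay back to x costs the factor 2^6.\<close>

lemma schwartz_difference_quotient:
  assumes f: "f \<in> schwartz"
  obtains C where "C \<ge> 0" "\<And>x s. 0 < s \<Longrightarrow> s \<le> 1 \<Longrightarrow> norm ((f (x + s *\<^sub>R axis i 1) - f x) / of_real s) \<le> C * weight x"
    "\<And>x. ((\<lambda>s. (f (x + s *\<^sub>R axis i 1) - f x) / of_real s) \<longlongrightarrow> pd i f x) (at 0)"
proof -
  let ?e = "axis i 1 :: space"
  obtain D where D: "D \<ge> 0" "\<forall>x. (1 + norm x) ^ 6 * norm (pd i f x) \<le> D"
    using rapidD[OF schwartz_rapid[OF schwartz_pd[OF f]]] by blast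
  have der: "((\<lambda>t. f (x + t *\<^sub>R ?e)) has_vector_derivative pd i f (x + t *\<^sub>R ?e)) (at t)" for x t
  proof -
    have "((\<lambda>t. x + t *\<^sub>R ?e) has_derivative (\<lambda>h. h *\<^sub>R ?e)) (at t)"
      by (auto intro!: derivative_eq_intros)
    from diff_chain_at[OF this schwartz_has_derivative[OF f]]
    have "((\<lambda>t. f (x + t *\<^sub>R ?e)) has_derivative (\<lambda>h. \<Sum>k\<in>UNIV. of_real ((h *\<^sub>R ?e) $ k) * pd k f (x + t *\<^sub>R ?e))) (at t)"
      by (simp add: o_def)
    moreover have "(\<Sum>k\<in>UNIV. of_real ((h *\<^sub>R ?e) $ k) * pd k f (x + t *\<^sub>R ?e)) = h *\<^sub>R pd i f (x + t *\<^sub>R ?e)" for h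
    proof -
      have "of_real ((h *\<^sub>R ?e) $ k) * pd k f (x + t *\<^sub>R ?e) = (if k = i then of_real h * pd i f (x + t *\<^sub>R ?e) else 0)" for k
        by (simp add: axis_def)
      then show ?thesis by (simp only: sum.delta finite scaleR_conv_of_real) simp
    qed
    ultimately show ?thesis by (simp add: has_vector_derivative_def)
  qed
  show thesis
  proof
    show "2 ^ 6 * D \<ge> 0" using D by simp
    show "((\<lambda>s. (f (x + s *\<^sub>R ?e) - f x) / of_real s) \<longlongrightarrow> pd i f x) (at 0)" for x
    proof -
      have "(\<lambda>h. norm (f (x + h *\<^sub>R ?e) - f x - h *\<^sub>R pd i f x) / norm h) \<midarrow>0\<rightarrow> 0"
        using der[of x 0] unfolding has_vector_derivative_def has_derivative_at by simp
      then have "(\<lambda>s. norm ((f (x + s *\<^sub>R ?e) - f x) / of_real s - pd i f x)) \<midarrow>0\<rightarrow> 0"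
      proof (rule Lim_transform_eventually)
        show "\<forall>\<^sub>F h in at 0. norm (f (x + h *\<^sub>R ?e) - f x - h *\<^sub>R pd i f x) / norm h
            = norm ((f (x + h *\<^sub>R ?e) - f x) / of_real h - pd i f x)"
        proof (rule eventually_at_topological[THEN iffD2], intro exI[of _ UNIV] conjI ballI impI)
          fix h :: real assume h: "h \<noteq> 0"
          have "(f (x + h *\<^sub>R ?e) - f x) / of_real h - pd i f x = (f (x + h *\<^sub>R ?e) - f x - h *\<^sub>R pd i f x) / of_real h"
            using h by (simp add: diff_divide_distrib scaleR_conv_of_real)
          then show "norm (f (x + h *\<^sub>R ?e) - f x - h *\<^sub>R pd i f x) / norm h
            = norm ((f (x + h *\<^sub>R ?e) - f x) / of_real h - pd i f x)"
            by (simp add: norm_divide)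
        qed auto
      qed
      then show ?thesis by (rule LIM_zero_cancel[OF tendsto_norm_zero_cancel])
    qed
    show "norm ((f (x + s *\<^sub>R ?e) - f x) / of_real s) \<le> 2 ^ 6 * D * weight x" if s: "0 < s" "s \<le> 1" for x s
    proof (rule le_weightI)
      have bd: "norm (pd i f (x + t *\<^sub>R ?e)) \<le> 2 ^ 6 * D / (1 + norm x) ^ 6" if t: "t \<in> {0..s}" for t
      proof -
        have "(1 + norm x) ^ 6 * norm (pd i f (x + t *\<^sub>R ?e)) \<le> (2 * (1 + norm (x + t *\<^sub>R ?e))) ^ 6 * norm (pd i f (x + t *\<^sub>R ?e))"
          by (intro mult_right_mono power_mono one_plus_norm_shift) (use s t in auto)
        also have "\<dots> = 2 ^ 6 * ((1 + norm (x + t *\<^sub>R ?e)) ^ 6 * norm (pd i f (x + t *\<^sub>R ?e)))"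
          by (simp only: power_mult_distrib mult.assoc)
        also have "\<dots> \<le> 2 ^ 6 * D" using D by (intro mult_left_mono) auto
        finally show ?thesis using zero_less_power[OF add_pos_nonneg[OF zero_less_one norm_ge_zero[of x]], of 6]
          by (simp add: pos_le_divide_eq mult.commute)
      qed
      have "norm (f (x + s *\<^sub>R ?e) - f (x + 0 *\<^sub>R ?e)) \<le> 2 ^ 6 * D / (1 + norm x) ^ 6 * norm (s - 0)"
      proof (rule differentiable_bound[of "{0..s}" _ "\<lambda>t h. h *\<^sub>R pd i f (x + t *\<^sub>R ?e)"])
        show "((\<lambda>t. f (x + t *\<^sub>R ?e)) has_derivative (\<lambda>h. h *\<^sub>R pd i f (x + t *\<^sub>R ?e))) (at t within {0..s})" for t
          by (rule has_derivative_at_withinI[OF der[unfolded has_vector_derivative_def]])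
        show "onorm (\<lambda>h. h *\<^sub>R pd i f (x + t *\<^sub>R ?e)) \<le> 2 ^ 6 * D / (1 + norm x) ^ 6" if "t \<in> {0..s}" for t
          by (rule onorm_le) (use mult_left_mono[OF bd[OF that]] in \<open>simp add: mult.commute\<close>)
      qed (use s in auto)
      then have "norm (f (x + s *\<^sub>R ?e) - f x) / s \<le> 2 ^ 6 * D / (1 + norm x) ^ 6"
        using s by (simp add: field_simps)
      moreover have "(1 + norm x) ^ 6 > 0" by (intro zero_less_power add_pos_nonneg) auto
      ultimately show "(1 + norm x) ^ 6 * norm ((f (x + s *\<^sub>R ?e) - f x) / of_real s) \<le> 2 ^ 6 * D"
        using s by (simp add: norm_divide pos_le_divide_eq mult.commute)
      show "2 ^ 6 * D \<ge> 0" using D by simp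
    qed
  qed
qed

text \<open>Difference quotients take the place of integration by parts: translation by s in
  direction i multiplies the transform by exp(i s \<xi>_i), so the transformed quotient carries the
  factor (exp(i s \<xi>_i) - 1) / s, which tends to i \<xi>_i.\<close>

lemma fourier_pd:
  assumes f: "f \<in> schwartz"
  shows "fourier (pd i f) \<xi> = \<i> * of_real (\<xi> $ i) * fourier f \<xi>"
proof -
  let ?e = "axis i 1 :: space"
  define s where "s n = 1 / real (Suc n)" for n
  have s: "0 < s n" "s n \<le> 1" "s n \<noteq> 0" for n by (auto simp: s_def)
  have s0: "s \<longlonglongrightarrow> 0" unfolding s_def by (rule LIMSEQ_Suc) (rule lim_1_over_n)
  define q where "q n x = (f (x + s n *\<^sub>R ?e) - f x) / of_real (s n)" for n x
  obtain C where C: "C \<ge> 0" "\<And>x s. 0 < s \<Longrightarrow> s \<le> 1 \<Longrightarrow> norm ((f (x + s *\<^sub>R ?e) - f x) / of_real s) \<le> C * weight x"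
    "\<And>x. ((\<lambda>s. (f (x + s *\<^sub>R ?e) - f x) / of_real s) \<longlongrightarrow> pd i f x) (at 0)"
    using schwartz_difference_quotient[OF f] by blast
  have at0: "filterlim s (at 0) sequentially"
    using s0 s by (simp add: filterlim_at)
  have l1: "(\<lambda>n. fourier (q n) \<xi>) \<longlonglongrightarrow> fourier (pd i f) \<xi>"
    unfolding fourier_def
  proof (rule integral_dominated_convergence)
    show "integrable lborel (\<lambda>x. C * weight x)" using weight_integrable by simp
    show "AE x in lborel. (\<lambda>n. exp (- (\<i> * of_real (x \<bullet> \<xi>))) * q n x) \<longlonglongrightarrow> exp (- (\<i> * of_real (x \<bullet> \<xi>))) * pd i f x"
      unfolding q_def by (intro AE_I2 tendsto_mult tendsto_const filterlim_compose[OF C(3) at0])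
    show "AE x in lborel. norm (exp (- (\<i> * of_real (x \<bullet> \<xi>))) * q n x) \<le> C * weight x" for n
      unfolding q_def norm_mult using C(2)[OF s(1,2)] by (auto simp: norm_exp_eq_Re)
    have [measurable]: "f \<in> borel_measurable borel" "pd i f \<in> borel_measurable borel"
      by (auto intro: schwartz_measurable schwartz_pd f)
    show "(\<lambda>x. exp (- (\<i> * of_real (x \<bullet> \<xi>))) * pd i f x) \<in> borel_measurable lborel"
      by measurable
    show "(\<lambda>x. exp (- (\<i> * of_real (x \<bullet> \<xi>))) * q n x) \<in> borel_measurable lborel" for n
      unfolding q_def by measurable
  qed
  have eq: "fourier (q n) \<xi> = (exp (of_real (s n) * (\<i> * of_real (\<xi> $ i))) - 1) / of_real (s n) * fourier f \<xi>" for n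
  proof -
    have tr: "(\<lambda>x. f (x + b)) \<in> schwartz" for b using schwartz_affine[OF f, of 1 b] by simp
    have "q n = (\<lambda>x. (1 / of_real (s n)) * (f (x + s n *\<^sub>R ?e) + (- 1) * f x))"
      by (auto simp: q_def)
    then have "fourier (q n) \<xi> = (1 / of_real (s n)) * (fourier (\<lambda>x. f (x + s n *\<^sub>R ?e)) \<xi> + (- 1) * fourier f \<xi>)"
      using fourier_add[OF schwartz_integrable[OF tr] schwartz_integrable[OF schwartz_scale[OF f]]]
      by (simp only: fourier_scale)
    then show ?thesis
      using fourier_translate[OF schwartz_measurable[OF f], of "s n *\<^sub>R ?e" \<xi>]
      by (simp add: inner_axis' field_simps)
  qed
  have l2: "(\<lambda>n. (exp (of_real (s n) * (\<i> * of_real (\<xi> $ i))) - 1) / of_real (s n) * fourier f \<xi>)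
      \<longlonglongrightarrow> \<i> * of_real (\<xi> $ i) * fourier f \<xi>"
  proof (intro tendsto_mult tendsto_const)
    have "((\<lambda>z. exp (z * (\<i> * of_real (\<xi> $ i)))) has_field_derivative \<i> * of_real (\<xi> $ i)) (at 0)"
      by (auto intro!: derivative_eq_intros)
    then have l: "((\<lambda>z. (exp (z * (\<i> * of_real (\<xi> $ i))) - 1) / z) \<longlongrightarrow> \<i> * of_real (\<xi> $ i)) (at 0)"
      by (simp add: has_field_derivative_iff)
    have "filterlim (\<lambda>n. of_real (s n) :: complex) (at 0) sequentially"
      using tendsto_of_real[OF s0, where 'a=complex] s by (simp add: filterlim_at)
    from filterlim_compose[OF l this]
    show "(\<lambda>n. (exp (of_real (s n) * (\<i> * of_real (\<xi> $ i))) - 1) / of_real (s n)) \<longlonglongrightarrow> \<i> * of_real (\<xi> $ i)" .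
  qed
  show ?thesis using l1 l2 unfolding eq by (rule LIMSEQ_unique)
qed

lemma cmod_exp_minus_linear_le: "norm (exp (- (\<i> * of_real t)) - 1 + \<i> * of_real t) \<le> t\<^sup>2 / 2"
  using iexp_approx1[of "- t" 1] by (simp add: power2_eq_square algebra_simps)

lemma schwartz_second_moment:
  assumes f: "f \<in> schwartz"
  shows "integrable lborel (\<lambda>x. (norm x)\<^sup>2 * norm (f x))"
proof -
  have [measurable]: "f \<in> borel_measurable borel" by (rule schwartz_measurable[OF f])
  have "rapid (\<lambda>x. of_real ((norm x)\<^sup>2) * f x)"
  proof (rule rapid_dominated[OF schwartz_rapid[OF f], of _ 1 2])
    fix x :: space
    have "(norm x)\<^sup>2 \<le> (1 + norm x)\<^sup>2" by (intro power_mono) auto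
    then show "norm (of_real ((norm x)\<^sup>2) * f x) \<le> 1 * (1 + norm x)\<^sup>2 * norm (f x)"
      by (simp add: norm_mult norm_power mult_right_mono)
  qed simp
  then have "integrable lborel (\<lambda>x. of_real ((norm x)\<^sup>2) * f x)"
    by (rule rapid_integrable) measurable
  from integrable_norm[OF this] show ?thesis by (simp add: norm_mult norm_power)
qed

text \<open>The second-order estimate for exp(-i x.h) bounds the remainder by K |h|^2 / 2, where K
  is the absolute second moment of f. This gives the total derivative directly, which
  \<open>smooth_on\<close> requires.\<close>

lemma fourier_has_derivative:
  assumes f: "f \<in> schwartz"
  shows "(fourier f has_derivative (\<lambda>h. \<Sum>i\<in>UNIV. of_real (h $ i) * fourier (\<lambda>x. - \<i> * (of_real (x $ i) * f x)) \<xi>)) (at \<xi>)"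
proof -
  let ?g = "\<lambda>i x. - \<i> * (of_real (x $ i) * f x)"
  let ?D = "\<lambda>h. \<Sum>i\<in>UNIV. of_real (h $ i) * fourier (?g i) \<xi>"
  define K where "K = (LINT x|lborel. (norm x)\<^sup>2 * norm (f x))"
  have K0: "K \<ge> 0" unfolding K_def by (intro Bochner_Integration.integral_nonneg) auto
  have g: "integrable lborel (?g i)" for i
    by (intro schwartz_integrable schwartz_scale schwartz_coord f)
  have bl: "bounded_linear ?D"
    by (intro bounded_linear_sum bounded_linear_mult_const bounded_linear_compose[OF bounded_linear_of_real bounded_linear_vec_nth])
  have D: "?D h = (LINT x|lborel. - \<i> * of_real (x \<bullet> h) * exp (- (\<i> * of_real (x \<bullet> \<xi>))) * f x)"
    and Di: "integrable lborel (\<lambda>x. - \<i> * of_real (x \<bullet> h) * exp (- (\<i> * of_real (x \<bullet> \<xi>))) * f x)" for h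
  proof -
    have eq: "(\<Sum>i\<in>UNIV. of_real (h $ i) * (exp (- (\<i> * of_real (x \<bullet> \<xi>))) * ?g i x))
        = - \<i> * of_real (x \<bullet> h) * exp (- (\<i> * of_real (x \<bullet> \<xi>))) * f x" for x
      by (simp add: inner_vec_def sum_distrib_left sum_distrib_right sum_negf ac_simps)
    have i: "integrable lborel (\<lambda>x. of_real (h $ i) * (exp (- (\<i> * of_real (x \<bullet> \<xi>))) * ?g i x))" for i
      by (intro integrable_mult_right fourier_integrable g)
    show "integrable lborel (\<lambda>x. - \<i> * of_real (x \<bullet> h) * exp (- (\<i> * of_real (x \<bullet> \<xi>))) * f x)"
      unfolding eq[symmetric] by (intro Bochner_Integration.integrable_sum i)
    show "?D h = (LINT x|lborel. - \<i> * of_real (x \<bullet> h) * exp (- (\<i> * of_real (x \<bullet> \<xi>))) * f x)"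
      unfolding eq[symmetric] fourier_def
      by (subst Bochner_Integration.integral_sum[OF i]) (simp only: integral_mult_right_zero)
  qed
  have bound: "norm (fourier f y - fourier f \<xi> - ?D (y - \<xi>)) \<le> K / 2 * (norm (y - \<xi>))\<^sup>2" for y
  proof -
    define h where "h = y - \<xi>"
    have I: "integrable lborel f" by (rule schwartz_integrable[OF f])
    have "fourier f y - fourier f \<xi> - ?D h = (LINT x|lborel. exp (- (\<i> * of_real (x \<bullet> y))) * f x
        - exp (- (\<i> * of_real (x \<bullet> \<xi>))) * f x - (- \<i> * of_real (x \<bullet> h) * exp (- (\<i> * of_real (x \<bullet> \<xi>))) * f x))"
      unfolding D unfolding fourier_def
      by (simp only: Bochner_Integration.integral_diff Bochner_Integration.integrable_diff fourier_integrable[OF I] Di)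
    also have "\<dots> = (LINT x|lborel. exp (- (\<i> * of_real (x \<bullet> \<xi>))) * (exp (- (\<i> * of_real (x \<bullet> h))) - 1 + \<i> * of_real (x \<bullet> h)) * f x)"
    proof (rule Bochner_Integration.integral_cong[OF refl])
      fix x
      have "exp (- (\<i> * of_real (x \<bullet> y))) = exp (- (\<i> * of_real (x \<bullet> \<xi>))) * exp (- (\<i> * of_real (x \<bullet> h)))"
        unfolding h_def exp_add[symmetric] by (simp add: inner_diff_right algebra_simps)
      then show "exp (- (\<i> * of_real (x \<bullet> y))) * f x
        - exp (- (\<i> * of_real (x \<bullet> \<xi>))) * f x - (- \<i> * of_real (x \<bullet> h) * exp (- (\<i> * of_real (x \<bullet> \<xi>))) * f x)
        = exp (- (\<i> * of_real (x \<bullet> \<xi>))) * (exp (- (\<i> * of_real (x \<bullet> h))) - 1 + \<i> * of_real (x \<bullet> h)) * f x"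
        by (simp add: algebra_simps)
    qed
    also have "norm \<dots> \<le> (LINT x|lborel. (norm h)\<^sup>2 / 2 * ((norm x)\<^sup>2 * norm (f x)))"
    proof (rule order_trans[OF integral_norm_bound Bochner_Integration.integral_mono])
      show "integrable lborel (\<lambda>x. (norm h)\<^sup>2 / 2 * ((norm x)\<^sup>2 * norm (f x)))"
        by (intro integrable_mult_right schwartz_second_moment f)
      fix x
      have "norm (exp (- (\<i> * of_real (x \<bullet> h))) - 1 + \<i> * of_real (x \<bullet> h)) \<le> (x \<bullet> h)\<^sup>2 / 2"
        by (rule cmod_exp_minus_linear_le)
      also have "\<dots> \<le> (norm x * norm h)\<^sup>2 / 2"
        using Cauchy_Schwarz_ineq2[of x h] by (intro divide_right_mono) (metis abs_ge_zero power2_abs power_mono, simp)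
      finally have b: "norm (exp (- (\<i> * of_real (x \<bullet> h))) - 1 + \<i> * of_real (x \<bullet> h)) \<le> (norm h)\<^sup>2 / 2 * (norm x)\<^sup>2"
        by (simp add: power_mult_distrib mult.commute)
      show "norm (exp (- (\<i> * of_real (x \<bullet> \<xi>))) * (exp (- (\<i> * of_real (x \<bullet> h))) - 1 + \<i> * of_real (x \<bullet> h)) * f x)
        \<le> (norm h)\<^sup>2 / 2 * ((norm x)\<^sup>2 * norm (f x))"
        using mult_right_mono[OF b norm_ge_zero[of "f x"]] unfolding norm_mult by (simp add: norm_exp_eq_Re mult.assoc)
    next
      have "integrable lborel (\<lambda>x. exp (- (\<i> * of_real (x \<bullet> y))) * f x
        - exp (- (\<i> * of_real (x \<bullet> \<xi>))) * f x - (- \<i> * of_real (x \<bullet> h) * exp (- (\<i> * of_real (x \<bullet> \<xi>))) * f x))"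
        by (intro Bochner_Integration.integrable_diff fourier_integrable I Di)
      moreover have "exp (- (\<i> * of_real (x \<bullet> y))) * f x
        - exp (- (\<i> * of_real (x \<bullet> \<xi>))) * f x - (- \<i> * of_real (x \<bullet> h) * exp (- (\<i> * of_real (x \<bullet> \<xi>))) * f x)
        = exp (- (\<i> * of_real (x \<bullet> \<xi>))) * (exp (- (\<i> * of_real (x \<bullet> h))) - 1 + \<i> * of_real (x \<bullet> h)) * f x" for x
      proof -
        have "exp (- (\<i> * of_real (x \<bullet> y))) = exp (- (\<i> * of_real (x \<bullet> \<xi>))) * exp (- (\<i> * of_real (x \<bullet> h)))"
          unfolding h_def exp_add[symmetric] by (simp add: inner_diff_right algebra_simps)
        then show ?thesis by (simp add: algebra_simps)
      qed
      ultimately show "integrable lborel (\<lambda>x. norm (exp (- (\<i> * of_real (x \<bullet> \<xi>))) * (exp (- (\<i> * of_real (x \<bullet> h))) - 1 + \<i> * of_real (x \<bullet> h)) * f x))"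
        by (intro integrable_norm) simp
    qed
    also have "\<dots> = K / 2 * (norm h)\<^sup>2" unfolding K_def by simp
    finally show ?thesis unfolding h_def .
  qed
  show ?thesis
    unfolding has_derivative_at_alt
  proof (intro conjI bl allI impI)
    fix e :: real assume e: "e > 0"
    show "\<exists>d>0. \<forall>y. norm (y - \<xi>) < d \<longrightarrow> norm (fourier f y - fourier f \<xi> - ?D (y - \<xi>)) \<le> e * norm (y - \<xi>)"
    \<comment> \<open>The summand 1 keeps the denominator positive when K = 0.\<close>
    proof (intro exI[of _ "e / (K / 2 + 1)"] conjI allI impI)
      show "0 < e / (K / 2 + 1)" using e K0 by (intro divide_pos_pos) auto
      fix y assume y: "norm (y - \<xi>) < e / (K / 2 + 1)"
      have "K / 2 + 1 > 0" using K0 by simp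
      then have "(K / 2 + 1) * norm (y - \<xi>) \<le> e" using y by (simp add: pos_less_divide_eq mult.commute)
      moreover have "K / 2 * norm (y - \<xi>) \<le> (K / 2 + 1) * norm (y - \<xi>)" by (intro mult_right_mono) auto
      ultimately have "K / 2 * norm (y - \<xi>) \<le> e" by linarith
      then have "K / 2 * norm (y - \<xi>) * norm (y - \<xi>) \<le> e * norm (y - \<xi>)" by (intro mult_right_mono) auto
      then show "norm (fourier f y - fourier f \<xi> - ?D (y - \<xi>)) \<le> e * norm (y - \<xi>)"
        using bound[of y] by (simp add: power2_eq_square mult.assoc)
    qed
  qed
qed

lemma pd_fourier:
  assumes "f \<in> schwartz"
  shows "pd i (fourier f) = fourier (\<lambda>x. - \<i> * (of_real (x $ i) * f x))"
proof
  fix \<xi>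
  have "of_real (axis i 1 $ k) * fourier (\<lambda>x. - \<i> * (of_real (x $ k) * f x)) \<xi>
      = (if k = i then fourier (\<lambda>x. - \<i> * (of_real (x $ k) * f x)) \<xi> else 0)" for k
    by (simp add: axis_def)
  then show "pd i (fourier f) \<xi> = fourier (\<lambda>x. - \<i> * (of_real (x $ i) * f x)) \<xi>"
    unfolding pd_eqI[OF fourier_has_derivative[OF assms]] by (simp only: sum.delta finite) simp
qed

text \<open>Trades one power of 1 + |\<xi>| for one derivative of f; this is the induction step for
  the decay of the transform.\<close>

lemma one_plus_norm_fourier_le:
  assumes f: "f \<in> schwartz"
  shows "(1 + norm \<xi>) * norm (fourier f \<xi>) \<le> norm (fourier f \<xi>) + (\<Sum>i\<in>UNIV. norm (fourier (pd i f) \<xi>))"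
proof -
  have "norm \<xi> * norm (fourier f \<xi>) \<le> (\<Sum>i\<in>UNIV. \<bar>\<xi> $ i\<bar>) * norm (fourier f \<xi>)"
    by (intro mult_right_mono norm_le_l1_cart) auto
  also have "\<dots> = (\<Sum>i\<in>UNIV. norm (fourier (pd i f) \<xi>))"
    unfolding fourier_pd[OF f] sum_distrib_right by (simp add: norm_mult)
  finally show ?thesis by (simp add: distrib_right)
qed

lemma fourier_rapid:
  assumes "f \<in> schwartz"
  shows "rapid (fourier f)"
proof (rule rapidI)
  fix k
  show "\<exists>C. \<forall>\<xi>. (1 + norm \<xi>) ^ k * norm (fourier f \<xi>) \<le> C"
    using assms
  proof (induction k arbitrary: f)
    case 0
    then show ?case using norm_fourier_le by auto
  next
    case (Suc k)
    obtain C where C: "\<And>\<xi>. (1 + norm \<xi>) ^ k * norm (fourier f \<xi>) \<le> C" using Suc by blast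
    have "\<forall>i. \<exists>D. \<forall>\<xi>. (1 + norm \<xi>) ^ k * norm (fourier (pd i f) \<xi>) \<le> D" using Suc schwartz_pd by blast
    then obtain D where D: "\<And>i \<xi>. (1 + norm \<xi>) ^ k * norm (fourier (pd i f) \<xi>) \<le> D i" by metis
    have "(1 + norm \<xi>) ^ Suc k * norm (fourier f \<xi>) \<le> C + (\<Sum>i\<in>UNIV. D i)" for \<xi>
    proof -
      have "(1 + norm \<xi>) ^ Suc k * norm (fourier f \<xi>) = (1 + norm \<xi>) ^ k * ((1 + norm \<xi>) * norm (fourier f \<xi>))"
        by (simp only: power_Suc2 mult.assoc)
      also have "\<dots> \<le> (1 + norm \<xi>) ^ k * (norm (fourier f \<xi>) + (\<Sum>i\<in>UNIV. norm (fourier (pd i f) \<xi>)))"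
        by (intro mult_left_mono one_plus_norm_fourier_le Suc.prems) auto
      also have "\<dots> = (1 + norm \<xi>) ^ k * norm (fourier f \<xi>) + (\<Sum>i\<in>UNIV. (1 + norm \<xi>) ^ k * norm (fourier (pd i f) \<xi>))"
        by (simp only: distrib_left sum_distrib_left)
      also have "\<dots> \<le> C + (\<Sum>i\<in>UNIV. D i)" by (intro add_mono C sum_mono D)
      finally show ?thesis .
    qed
    then show ?case by blast
  qed
qed

text \<open>The image of the Schwartz space is itself closed under differentiation, since
  differentiating the transform amounts to multiplying f by -i x_i.\<close>

lemma fourier_schwartz:
  assumes "f \<in> schwartz"
  shows "fourier f \<in> schwartz"
proof (rule schwartz_coinduct[of _ "fourier ` schwartz"])
  show "fourier f \<in> fourier ` schwartz" using assms by blast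
  fix g assume "g \<in> fourier ` schwartz"
  then obtain f where f: "f \<in> schwartz" "g = fourier f" by blast
  show "g differentiable (at x)" for x
    unfolding f(2) using fourier_has_derivative[OF f(1)] differentiable_def by blast
  show "pd i g \<in> fourier ` schwartz" for i
    unfolding f(2) pd_fourier[OF f(1)] by (intro imageI schwartz_scale schwartz_coord f)
  show "rapid g" unfolding f(2) by (rule fourier_rapid[OF f(1)])
qed

lemma inv_fourier_eq: "inv_fourier f x = fourier f (- x) / of_real ((2 * pi) ^ 3)"
  unfolding inv_fourier_def fourier_def by (simp add: inner_commute)

lemma inv_fourier_schwartz: "f \<in> schwartz \<Longrightarrow> inv_fourier f \<in> schwartz"
  using schwartz_scale[OF schwartz_affine[OF fourier_schwartz, of f "-1" 0], of "1 / of_real ((2 * pi) ^ 3)"]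
  by (simp add: inv_fourier_eq[abs_def])

section \<open>Gaussians and Fourier inversion\<close>

definition gauss :: "space \<Rightarrow> real" where
  "gauss x = exp (- (norm x)\<^sup>2 / 2)"

text \<open>Up to the factor sqrt(2 pi), the integral is the characteristic function of the standard
  normal distribution at -t.\<close>

lemma gaussian_transform_real:
  "integrable lborel (\<lambda>x::real. exp (- (\<i> * of_real (x * t))) * of_real (exp (- x\<^sup>2 / 2)))"
  "(LINT x|lborel. exp (- (\<i> * of_real (x * t))) * of_real (exp (- x\<^sup>2 / 2))) = of_real (sqrt (2 * pi) * exp (- t\<^sup>2 / 2))"
proof -
  have eq: "exp (- (\<i> * of_real (x * t))) * of_real (exp (- x\<^sup>2 / 2))
      = of_real (sqrt (2 * pi)) * (std_normal_density x *\<^sub>R iexp (- t * x))" for x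
    by (simp add: std_normal_density_def scaleR_conv_of_real mult.commute)
  have "integrable lborel (\<lambda>x. std_normal_density x *\<^sub>R iexp (- t * x))"
    by (rule Bochner_Integration.integrable_bound[OF integrable_normal_density[of 1 0]]) (auto simp: norm_mult)
  then show "integrable lborel (\<lambda>x::real. exp (- (\<i> * of_real (x * t))) * of_real (exp (- x\<^sup>2 / 2)))"
    unfolding eq by (rule integrable_mult_right)
  have "(LINT x|lborel. std_normal_density x *\<^sub>R iexp (- t * x)) = char std_normal_distribution (- t)"
    unfolding char_def by (subst integral_density) auto
  then show "(LINT x|lborel. exp (- (\<i> * of_real (x * t))) * of_real (exp (- x\<^sup>2 / 2))) = of_real (sqrt (2 * pi) * exp (- t\<^sup>2 / 2))"
    unfolding eq integral_mult_right_zero by (simp add: char_std_normal_distribution)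
qed

lemma gauss_prod: "of_real (gauss x) = (\<Prod>b\<in>Basis. of_real (exp (- (x \<bullet> b)\<^sup>2 / 2)) :: complex)"
proof -
  have "- (norm x)\<^sup>2 / 2 = (\<Sum>b\<in>Basis. - (x \<bullet> b)\<^sup>2 / 2)"
    by (simp add: norm_eq_sqrt_inner euclidean_inner[of x x] sum_negf sum_divide_distrib sum_nonneg power2_eq_square)
  then have "gauss x = (\<Prod>b\<in>Basis. exp (- (x \<bullet> b)\<^sup>2 / 2))"
    by (simp only: gauss_def exp_sum finite_Basis)
  then show ?thesis by (simp only: of_real_prod)
qed

lemma fourier_gauss:
  "integrable lborel (\<lambda>x. of_real (gauss x) :: complex)"
  "fourier (\<lambda>x. of_real (gauss x)) \<xi> = of_real (sqrt (2 * pi) ^ 3 * gauss \<xi>)"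
proof -
  define F where "F \<xi> b t = exp (- (\<i> * of_real (t * (\<xi> \<bullet> b)))) * of_real (exp (- t\<^sup>2 / 2))" for \<xi> b :: space and t :: real
  have eq: "exp (- (\<i> * of_real (x \<bullet> \<xi>))) * of_real (gauss x) = (\<Prod>b\<in>Basis. F \<xi> b (x \<bullet> b))" for x \<xi>
  proof -
    have "exp (- (\<i> * of_real (x \<bullet> \<xi>))) = (\<Prod>b\<in>Basis. exp (- (\<i> * of_real ((x \<bullet> b) * (\<xi> \<bullet> b)))))"
      by (simp add: euclidean_inner[of x \<xi>] sum_distrib_left flip: exp_sum sum_negf)
    then show ?thesis unfolding gauss_prod F_def by (simp only: prod.distrib)
  qed
  have I: "integrable lborel (F \<xi> b)" for \<xi> b unfolding F_def by (rule gaussian_transform_real)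
  show "fourier (\<lambda>x. of_real (gauss x)) \<xi> = of_real (sqrt (2 * pi) ^ 3 * gauss \<xi>)"
  proof -
    have "(LINT t|lborel. F \<xi> b t) = of_real (sqrt (2 * pi)) * of_real (exp (- (\<xi> \<bullet> b)\<^sup>2 / 2))" for b
      unfolding F_def gaussian_transform_real by simp
    then show ?thesis
      unfolding fourier_def eq lborel_integral_prod_Basis(2)[OF I] unfolding of_real_mult gauss_prod
      by (simp only: prod.distrib prod_constant) (simp add: DIM_cart)
  qed
  show "integrable lborel (\<lambda>x. of_real (gauss x) :: complex)"
    using lborel_integral_prod_Basis(1)[of "F 0", OF I] unfolding eq[symmetric] by simp
qed

lemma integral_gauss: "(LINT x|lborel. of_real (gauss x) :: complex) = of_real (sqrt (2 * pi) ^ 3)"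
  using fourier_gauss(2)[of 0] by (simp add: fourier_def gauss_def)

text \<open>Fubini for f(y) g(z) exp(-i z.y), whose modulus is a product of integrable functions. It
  moves the transform from one factor to the other.\<close>

lemma integral_mult_fourier:
  assumes f: "integrable lborel f" and g: "integrable lborel g"
  shows "(LINT y|lborel. f y * fourier g y) = (LINT z|lborel. fourier f z * g z)"
proof -
  have [measurable]: "f \<in> borel_measurable borel" "g \<in> borel_measurable borel"
    using borel_measurable_integrable[OF f] borel_measurable_integrable[OF g] by simp_all
  let ?h = "\<lambda>y z. f y * (exp (- (\<i> * of_real (z \<bullet> y))) * g z)"
  have n: "norm (?h y z) = norm (f y) * norm (g z)" for y z
    by (simp add: norm_mult norm_exp_eq_Re)
  have "integrable (lborel \<Otimes>\<^sub>M lborel) (case_prod ?h)"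
  proof (rule lborel_pair.Fubini_integrable)
    show "case_prod ?h \<in> borel_measurable (lborel \<Otimes>\<^sub>M lborel)" by measurable
    show "integrable lborel (\<lambda>y. LINT z|lborel. norm (case_prod ?h (y, z)))"
      unfolding prod.case n using f by (intro Bochner_Integration.integrable_mult_left integrable_norm | simp)+
    show "AE y in lborel. integrable lborel (\<lambda>z. case_prod ?h (y, z))"
      unfolding prod.case by (intro AE_I2 integrable_mult_right fourier_integrable g)
  qed
  from lborel_pair.Fubini_integral[OF this]
  have "(LINT z|lborel. LINT y|lborel. ?h y z) = (LINT y|lborel. LINT z|lborel. ?h y z)" .
  moreover have "(LINT z|lborel. ?h y z) = f y * fourier g y" for y
    unfolding fourier_def by (rule integral_mult_right_zero)
  moreover have "(LINT y|lborel. ?h y z) = fourier f z * g z" for z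
  proof -
    have "?h y z = exp (- (\<i> * of_real (y \<bullet> z))) * f y * g z" for y by (simp add: inner_commute)
    then show ?thesis unfolding fourier_def by (simp only: integral_mult_left_zero)
  qed
  ultimately show ?thesis by (simp only:)
qed

lemma gauss_le_1: "gauss x \<le> 1" "0 \<le> gauss x" by (auto simp: gauss_def)

lemma gauss_measurable [measurable]: "gauss \<in> borel_measurable borel"
  unfolding gauss_def[abs_def] by measurable

lemma gauss_isCont: "isCont gauss x"
  unfolding gauss_def[abs_def] by (intro continuous_intros) simp

text \<open>The k-th power of y \<le> exp y at y = (1 + x) / k.\<close>

lemma power_mult_exp_minus_le:
  fixes x :: real
  assumes "x \<ge> 0"
  shows "(1 + x) ^ k * exp (- x) \<le> exp 1 * real k ^ k"
proof (cases "k = 0")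
  case True
  then show ?thesis using assms by (simp add: order_trans[of _ 1])
next
  case False
  have "(1 + x) / k \<le> exp ((1 + x) / k)" using exp_ge_add_one_self[of "(1 + x) / k"] by linarith
  then have "((1 + x) / k) ^ k \<le> exp ((1 + x) / k) ^ k" using assms by (intro power_mono) auto
  also have "\<dots> = exp (1 + x)" using False by (simp flip: exp_of_nat_mult)
  finally have "(1 + x) ^ k \<le> exp (1 + x) * real k ^ k" using False by (simp add: power_divide pos_divide_le_eq)
  then have "(1 + x) ^ k * exp (- x) \<le> exp (1 + x) * real k ^ k * exp (- x)" by (intro mult_right_mono) auto
  also have "\<dots> = exp 1 * real k ^ k" by (simp add: exp_add exp_minus field_simps)
  finally show ?thesis .
qed

lemma schwartz_gaussian:
  assumes "t > 0"
  shows "(\<lambda>x::space. of_real (exp (- t * (norm x)\<^sup>2))) \<in> schwartz"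
proof -
  have "(\<lambda>x::space. of_real ((\<lambda>n x. (- 1) ^ n * exp (- x)) 0 (t * (norm x)\<^sup>2)) :: complex) \<in> schwartz"
  proof (rule schwartz_radial[OF _ _ assms])
    show "((\<lambda>x. (- 1) ^ n * exp (- x)) has_real_derivative (- 1) ^ Suc n * exp (- x)) (at x)" for n and x :: real
      by (auto intro!: derivative_eq_intros)
    show "\<exists>C. \<forall>x\<ge>0::real. (1 + x) ^ k * \<bar>(- 1) ^ n * exp (- x)\<bar> \<le> C" for n k
      by (intro exI[of _ "exp 1 * real k ^ k"]) (auto simp: abs_mult power_mult_exp_minus_le)
  qed
  then show ?thesis by simp
qed

lemma inverse_Suc_LIMSEQ: "(\<lambda>n. 1 / real (Suc n)) \<longlonglongrightarrow> 0"
  by (rule LIMSEQ_Suc) (rule lim_1_over_n)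

text \<open>Inversion at the origin. The integrand is damped by the Gaussian of s x, the transform
  is moved onto the Gaussian, and rescaling leaves the integral of \<open>gauss x\<close> times g(s
  x); then s tends to 0 on both sides. One factor (2 pi)^(3/2) comes from the transform of the
  Gaussian, the other from its integral.\<close>

lemma integral_fourier:
  assumes g: "g \<in> schwartz"
  shows "(LINT x|lborel. fourier g x) = of_real ((2 * pi) ^ 3) * g 0"
proof -
  define s where "s n = 1 / real (Suc n)" for n
  have s: "s n > 0" "s n \<noteq> 0" for n by (simp_all add: s_def)
  have s0: "s \<longlonglongrightarrow> 0" unfolding s_def by (rule inverse_Suc_LIMSEQ)
  have sx: "(\<lambda>n. s n *\<^sub>R x) \<longlonglongrightarrow> 0" for x :: space
    using tendsto_scaleR[OF s0 tendsto_const[of x]] by simp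
  have [measurable]: "g \<in> borel_measurable borel" "fourier g \<in> borel_measurable borel"
    by (auto intro: schwartz_measurable fourier_schwartz g)
  have G: "integrable lborel g" by (rule schwartz_integrable[OF g])
  have mg: "(\<lambda>x. of_real (gauss x) :: complex) \<in> borel_measurable borel" by measurable
  have lim1: "(\<lambda>n. LINT x|lborel. of_real (gauss (s n *\<^sub>R x)) * fourier g x) \<longlonglongrightarrow> (LINT x|lborel. fourier g x)"
  proof (rule integral_dominated_convergence)
    show "integrable lborel (\<lambda>x. norm (fourier g x))"
      by (intro integrable_norm schwartz_integrable fourier_schwartz g)
    show "AE x in lborel. (\<lambda>n. of_real (gauss (s n *\<^sub>R x)) * fourier g x) \<longlonglongrightarrow> fourier g x"
    proof (rule AE_I2)
      fix x
      have "(\<lambda>n. of_real (gauss (s n *\<^sub>R x)) * fourier g x) \<longlonglongrightarrow> of_real (gauss 0) * fourier g x"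
        by (intro tendsto_mult tendsto_of_real tendsto_const isCont_tendsto_compose[OF gauss_isCont] sx)
      then show "(\<lambda>n. of_real (gauss (s n *\<^sub>R x)) * fourier g x) \<longlonglongrightarrow> fourier g x" by (simp add: gauss_def)
    qed
    show "AE x in lborel. norm (of_real (gauss (s n *\<^sub>R x)) * fourier g x) \<le> norm (fourier g x)" for n
      using gauss_le_1 by (auto simp: norm_mult intro!: mult_left_le_one_le)
  qed measurable
  obtain C where C: "C \<ge> 0" "\<forall>x. norm (g x) \<le> C" using rapid_bounded schwartz_rapid g by blast
  have lim2: "(\<lambda>n. LINT x|lborel. of_real (gauss x) * g (s n *\<^sub>R x)) \<longlonglongrightarrow> (LINT x|lborel. of_real (gauss x) * g 0)"
  proof (rule integral_dominated_convergence)
    show "integrable lborel (\<lambda>x. norm (of_real (gauss x) :: complex) * C)"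
      by (intro Bochner_Integration.integrable_mult_left integrable_norm fourier_gauss)
    show "AE x in lborel. (\<lambda>n. of_real (gauss x) * g (s n *\<^sub>R x)) \<longlonglongrightarrow> of_real (gauss x) * g 0"
      by (intro AE_I2 tendsto_mult tendsto_const isCont_tendsto_compose[OF _ sx] differentiable_imp_continuous_within schwartz_differentiable g)
    show "AE x in lborel. norm (of_real (gauss x) * g (s n *\<^sub>R x)) \<le> norm (of_real (gauss x) :: complex) * C" for n
      unfolding norm_mult using C by (intro AE_I2 mult_left_mono) auto
  qed measurable
  have "(LINT x|lborel. of_real (gauss (s n *\<^sub>R x)) * fourier g x) = of_real (sqrt (2 * pi) ^ 3) * (LINT x|lborel. of_real (gauss x) * g (s n *\<^sub>R x))" for n
  proof -
    let ?G = "\<lambda>x. of_real (gauss x) :: complex"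
    let ?Gs = "\<lambda>x. of_real (gauss (s n *\<^sub>R x)) :: complex"
    have I: "integrable lborel ?Gs"
    proof -
      have "?Gs = (\<lambda>x. of_real (exp (- ((s n)\<^sup>2 / 2) * (norm x)\<^sup>2)))"
        by (simp add: gauss_def power_mult_distrib)
      then show ?thesis using schwartz_integrable[OF schwartz_gaussian, of "(s n)\<^sup>2 / 2"] s[of n] by simp
    qed
    have "fourier ?Gs z = of_real (sqrt (2 * pi) ^ 3 / s n ^ 3) * of_real (gauss (z /\<^sub>R s n))" for z
      using fourier_affine[OF s(2)[of n] mg, of z 0] s[of n] by (simp add: fourier_gauss field_simps)
    then have "(LINT x|lborel. ?Gs x * fourier g x) = of_real (sqrt (2 * pi) ^ 3 / s n ^ 3) * (LINT z|lborel. of_real (gauss (z /\<^sub>R s n)) * g z)"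
      unfolding integral_mult_fourier[OF I G] by (simp only: mult.assoc integral_mult_right_zero)
    also have "(LINT z|lborel. of_real (gauss (z /\<^sub>R s n)) * g z) = of_real (s n ^ 3) * (LINT x|lborel. of_real (gauss x) * g (s n *\<^sub>R x))"
      by (subst lborel_integral_affine_space[OF s(2)[of n], of _ 0]) (measurable, use s[of n] in simp)
    finally show ?thesis using s[of n] by simp
  qed
  then have "(\<lambda>n. LINT x|lborel. of_real (gauss (s n *\<^sub>R x)) * fourier g x) \<longlonglongrightarrow> of_real (sqrt (2 * pi) ^ 3) * (LINT x|lborel. of_real (gauss x) * g 0)"
    using tendsto_mult[OF tendsto_const lim2] by simp
  from LIMSEQ_unique[OF lim1 this]
  have "(LINT x|lborel. fourier g x) = of_real (sqrt (2 * pi) ^ 3) * (of_real (sqrt (2 * pi) ^ 3) * g 0)"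
    by (simp only: integral_mult_left_zero integral_gauss)
  also have "\<dots> = of_real ((sqrt (2 * pi) ^ 2) ^ 3) * g 0"
    by (simp only: mult.assoc[symmetric] of_real_mult[symmetric] power_mult_distrib[symmetric] power2_eq_square)
  finally show ?thesis by simp
qed

text \<open>Multiplying the transform of f by the character exp(i x.\<xi>) translates f by \<xi>, so
  inversion at \<xi> is inversion at 0 for the translate.\<close>

theorem fourier_inv_fourier:
  assumes f: "f \<in> schwartz"
  shows "fourier (inv_fourier f) = f"
proof
  fix \<xi>
  have tr: "(\<lambda>x. f (x + \<xi>)) \<in> schwartz" using schwartz_affine[OF f, of 1 \<xi>] by simp
  have [measurable]: "fourier f \<in> borel_measurable borel" by (intro schwartz_measurable fourier_schwartz f)
  have "fourier (inv_fourier f) \<xi> = (LINT x|lborel. exp (- (\<i> * of_real (x \<bullet> \<xi>))) * fourier f (- x) * (1 / of_real ((2 * pi) ^ 3)))"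
    unfolding fourier_def[of "inv_fourier f"] inv_fourier_eq by simp
  also have "\<dots> = (LINT x|lborel. exp (- (\<i> * of_real (x \<bullet> \<xi>))) * fourier f (- x)) * (1 / of_real ((2 * pi) ^ 3))"
    by (rule integral_mult_left_zero)
  also have "(LINT x|lborel. exp (- (\<i> * of_real (x \<bullet> \<xi>))) * fourier f (- x)) = (LINT x|lborel. exp (\<i> * of_real (x \<bullet> \<xi>)) * fourier f x)"
    by (subst lborel_integral_affine_space[of "-1" _ 0]) simp_all
  also have "\<dots> = (LINT x|lborel. fourier (\<lambda>x. f (x + \<xi>)) x)"
    by (simp only: fourier_translate[OF schwartz_measurable[OF f]] inner_commute)
  also have "\<dots> = of_real ((2 * pi) ^ 3) * f \<xi>"
    using integral_fourier[OF tr] by simp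
  finally show "fourier (inv_fourier f) \<xi> = f \<xi>" by simp
qed

subsection \<open>The Littlewood-Paley cutoff\<close>

lemma lp_cutoff_deriv_near_0:
  assumes "lp_cutoff \<phi>0" "0 < x" "x < 1/4"
  shows "(deriv ^^ n) \<phi>0 x = (if n = 0 then 1 else 0)"
  using assms(2,3)
proof (induction n arbitrary: x)
  case 0
  then show ?case using assms(1) by (simp add: lp_cutoff_def)
next
  case (Suc n)
  have "\<forall>\<^sub>F y in nhds x. (deriv ^^ n) \<phi>0 y = (if n = 0 then 1 else 0)"
    using eventually_nhds_in_open[of "{0<..<1/4}" x] Suc by (auto elim!: eventually_mono)
  from deriv_cong_ev[OF this refl] show ?case by simp
qed

lemma lp_cutoff_deriv_beyond_1:
  assumes "lp_cutoff \<phi>0" "x > 1"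
  shows "(deriv ^^ n) \<phi>0 x = 0"
  using assms(2)
proof (induction n arbitrary: x)
  case 0
  then show ?case using assms(1) by (simp add: lp_cutoff_def)
next
  case (Suc n)
  have "\<forall>\<^sub>F y in nhds x. (deriv ^^ n) \<phi>0 y = 0"
    using eventually_nhds_in_open[of "{1<..}" x] Suc by (auto elim!: eventually_mono)
  from deriv_cong_ev[OF this refl] show ?case by simp
qed

text \<open>The derivatives of \<open>\<phi>0\<close>, with its unspecified values on the negative axis replaced by \<open>1\<close>.\<close>

definition cutoff_deriv :: "(real \<Rightarrow> real) \<Rightarrow> nat \<Rightarrow> real \<Rightarrow> real" where
  "cutoff_deriv \<phi>0 n x = (if x < 1/8 then (if n = 0 then 1 else 0) else (deriv ^^ n) \<phi>0 x)"

text \<open>The open half-lines below 1/4 and above 0 cover the line. On the first, the function is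
  constant; on the second, it agrees with the iterated derivative of \<open>\<phi>0\<close>. The
  switch at 1/8 lies in the overlap, where both descriptions hold.\<close>

lemma cutoff_deriv_has_derivative:
  assumes "lp_cutoff \<phi>0"
  shows "(cutoff_deriv \<phi>0 n has_real_derivative cutoff_deriv \<phi>0 (Suc n) x) (at x)"
proof -
  have lo: "cutoff_deriv \<phi>0 n y = (if n = 0 then 1 else 0)" if "y < 1/4" for n y
    using lp_cutoff_deriv_near_0[OF assms, of y n] that by (auto simp: cutoff_deriv_def)
  have hi: "cutoff_deriv \<phi>0 n y = (deriv ^^ n) \<phi>0 y" if "y > 0" for n y
    using lp_cutoff_deriv_near_0[OF assms that, of n] by (auto simp: cutoff_deriv_def)
  show ?thesis
  proof (cases "x < 1/4")
    case True
    have "((\<lambda>y. if n = 0 then 1 else 0) has_real_derivative cutoff_deriv \<phi>0 (Suc n) x) (at x)"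
      using lo[OF True, of "Suc n"] by simp
    then show ?thesis
      by (rule has_field_derivative_transform_within_open[of _ _ _ "{..<1/4}"]) (use True in \<open>auto simp: lo\<close>)
  next
    case False
    then have "((deriv ^^ n) \<phi>0 has_real_derivative cutoff_deriv \<phi>0 (Suc n) x) (at x)"
      using assms hi[of x "Suc n"] by (auto simp: lp_cutoff_def DERIV_deriv_iff_field_differentiable)
    then show ?thesis
      by (rule has_field_derivative_transform_within_open[of _ _ _ "{0<..}"]) (use False in \<open>auto simp: hi\<close>)
  qed
qed

lemma cutoff_deriv_bounded:
  assumes "lp_cutoff \<phi>0"
  shows "\<exists>C\<ge>0. \<forall>x\<ge>0. (1 + x) ^ k * \<bar>cutoff_deriv \<phi>0 n x\<bar> \<le> C"
proof -
  have "continuous_on {0..1} (cutoff_deriv \<phi>0 n)"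
    by (intro continuous_at_imp_continuous_on ballI DERIV_isCont[OF cutoff_deriv_has_derivative[OF assms]])
  then have "bounded (cutoff_deriv \<phi>0 n ` {0..1})"
    by (intro compact_imp_bounded compact_continuous_image compact_Icc)
  then obtain M where M: "M > 0" "\<forall>x\<in>{0..1}. \<bar>cutoff_deriv \<phi>0 n x\<bar> \<le> M"
    by (auto simp: bounded_pos)
  have "(1 + x) ^ k * \<bar>cutoff_deriv \<phi>0 n x\<bar> \<le> 2 ^ k * M" if "x \<ge> 0" for x
  proof (cases "x \<le> 1")
    case True
    then show ?thesis using that M by (intro mult_mono power_mono) auto
  next
    case False
    then show ?thesis using lp_cutoff_deriv_beyond_1[OF assms, of x n] M by (simp add: cutoff_deriv_def)
  qed
  then show ?thesis using M by (intro exI[of _ "2 ^ k * M"]) auto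
qed

lemma cutoff_deriv_0: "lp_cutoff \<phi>0 \<Longrightarrow> x \<ge> 0 \<Longrightarrow> cutoff_deriv \<phi>0 0 x = \<phi>0 x"
  by (auto simp: cutoff_deriv_def lp_cutoff_def)

lemma schwartz_cutoff:
  assumes "lp_cutoff \<phi>0" "c > 0"
  shows "(\<lambda>x::space. of_real (\<phi>0 (c * (norm x)\<^sup>2))) \<in> schwartz"
proof -
  have "(\<lambda>x::space. of_real (cutoff_deriv \<phi>0 0 (c * (norm x)\<^sup>2)) :: complex) \<in> schwartz"
    by (rule schwartz_radial[where \<psi>="cutoff_deriv \<phi>0", OF cutoff_deriv_has_derivative[OF assms(1)] _ assms(2)])
       (use cutoff_deriv_bounded[OF assms(1)] in blast)
  then show ?thesis using assms by (simp add: cutoff_deriv_0)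
qed

lemma lp_cutoff_bounded:
  assumes "lp_cutoff \<phi>0"
  shows "\<exists>M\<ge>0. \<forall>x\<ge>0. \<bar>\<phi>0 x\<bar> \<le> M"
  using cutoff_deriv_bounded[OF assms, of 0 0] cutoff_deriv_0[OF assms] by simp

lemma S_symbol_schwartz: "lp_cutoff \<phi>0 \<Longrightarrow> S_symbol \<phi>0 j \<in> schwartz"
  using schwartz_cutoff[of \<phi>0 "4 powi (- j)"] by (simp add: S_symbol_def[abs_def])

lemma S_symbol_minus [simp]: "S_symbol \<phi>0 j (- \<xi>) = S_symbol \<phi>0 j \<xi>"
  by (simp add: S_symbol_def)

lemma S_symbol_eq_1: "lp_cutoff \<phi>0 \<Longrightarrow> 4 powi (- j) * (norm \<xi>)\<^sup>2 \<le> 1/4 \<Longrightarrow> S_symbol \<phi>0 j \<xi> = 1"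
  by (simp add: S_symbol_def lp_cutoff_def)

lemma S_symbol_eq_0: "lp_cutoff \<phi>0 \<Longrightarrow> 4 powi (- j) * (norm \<xi>)\<^sup>2 > 1 \<Longrightarrow> S_symbol \<phi>0 j \<xi> = 0"
  by (simp add: S_symbol_def lp_cutoff_def)

text \<open>With x = |\<xi>|^2: as j tends to minus infinity, \<open>S_op\<close> eventually removes
  any given nonzero frequency.\<close>

lemma eventually_4_powi_gt:
  assumes "(x::real) > 0"
  shows "\<forall>\<^sub>F j in at_bot. 4 powi (- j) * x > 1"
proof -
  obtain n where n: "1 / x < 4 ^ n" using real_arch_pow[of 4 "1 / x"] by auto
  have "4 powi (- j) * x > 1" if "j \<le> - int n" for j
  proof -
    have "(4::real) ^ n \<le> 4 powi (- j)"
      using power_int_increasing[of "int n" "- j" "4::real"] that by simp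
    then have "1 / x < 4 powi (- j)" using n by linarith
    then show ?thesis using assms by (simp add: pos_divide_less_eq)
  qed
  then show ?thesis unfolding eventually_at_bot_linorder by blast
qed

text \<open>The counterpart for large j: every given frequency eventually lies where the cutoff
  equals 1.\<close>

lemma eventually_4_powi_le:
  assumes "(x::real) \<ge> 0"
  shows "\<forall>\<^sub>F j in at_top. 4 powi (- j) * x \<le> 1/4"
proof -
  obtain n where n: "4 * x < 4 ^ n" using real_arch_pow[of 4 "4 * x"] by auto
  have "4 powi (- j) * x \<le> 1/4" if "j \<ge> int n" for j
  proof -
    have "(4::real) ^ n \<le> 4 powi j"
      using power_int_increasing[of "int n" j "4::real"] that by simp
    then have "4 * x \<le> 4 powi j" using n by linarith
    then show ?thesis by (simp add: power_int_minus field_simps)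
  qed
  then show ?thesis unfolding eventually_at_top_linorder by blast
qed


subsection \<open>Trigonometric polynomials\<close>

text \<open>Frequencies are a function on an index set, so that they may coincide. This happens for
  products indexed by pairs, where all diagonal pairs share one frequency.\<close>

definition trig_fun :: "'i set \<Rightarrow> ('i \<Rightarrow> complex) \<Rightarrow> ('i \<Rightarrow> space) \<Rightarrow> space \<Rightarrow> complex" where
  "trig_fun A c \<xi> x = (\<Sum>j\<in>A. c j * exp (\<i> * of_real (x \<bullet> \<xi> j)))"

definition trig :: "'i set \<Rightarrow> ('i \<Rightarrow> complex) \<Rightarrow> ('i \<Rightarrow> space) \<Rightarrow> tdist" where
  "trig A c \<xi> = regular (trig_fun A c \<xi>)"

lemma on_schwartz_idem: "on_schwartz (on_schwartz T) = on_schwartz T"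
  by (auto simp: on_schwartz_def)

lemma trig_outside: "\<phi> \<notin> schwartz \<Longrightarrow> trig A c \<xi> \<phi> = 0"
  by (simp add: trig_def regular_def on_schwartz_def)

text \<open>Testing exp(i x.\<xi>) against \<phi> is evaluating the transform of \<phi> at -\<xi>.
  For infinite \<open>A\<close> both sides are 0, as sums over infinite sets are.\<close>

lemma trig_apply:
  assumes \<phi>: "\<phi> \<in> schwartz"
  shows "trig A c \<xi> \<phi> = (\<Sum>j\<in>A. c j * fourier \<phi> (- \<xi> j))"
proof -
  have eq: "trig_fun A c \<xi> x * \<phi> x = (\<Sum>j\<in>A. c j * (exp (- (\<i> * of_real (x \<bullet> (- \<xi> j)))) * \<phi> x))" for x
    unfolding trig_fun_def sum_distrib_right by (simp add: mult.assoc)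
  have "trig A c \<xi> \<phi> = (LINT x|lborel. (\<Sum>j\<in>A. c j * (exp (- (\<i> * of_real (x \<bullet> (- \<xi> j)))) * \<phi> x)))"
    using \<phi> unfolding trig_def regular_def on_schwartz_def eq by simp
  also have "\<dots> = (\<Sum>j\<in>A. (LINT x|lborel. c j * (exp (- (\<i> * of_real (x \<bullet> (- \<xi> j)))) * \<phi> x)))"
    by (intro Bochner_Integration.integral_sum integrable_mult_right fourier_integrable schwartz_integrable \<phi>)
  finally show ?thesis unfolding fourier_def by (simp only: integral_mult_right_zero)
qed

lemma trig_eqI:
  assumes "T = on_schwartz T" "\<And>\<phi>. \<phi> \<in> schwartz \<Longrightarrow> T \<phi> = (\<Sum>j\<in>A. c j * fourier \<phi> (- \<xi> j))"
  shows "T = trig A c \<xi>"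
proof
  fix \<phi> show "T \<phi> = trig A c \<xi> \<phi>"
  proof (cases "\<phi> \<in> schwartz")
    case True then show ?thesis by (simp add: trig_apply assms(2))
  next
    case False then show ?thesis using fun_cong[OF assms(1), of \<phi>] by (simp add: trig_outside on_schwartz_def)
  qed
qed

lemma finite_lists3_le: "finite {is::3 list. length is \<le> m}"
  using finite_lists_length_le[of "UNIV :: 3 set" m] by simp

text \<open>The real-valued supremum is meaningful only for a set bounded above. It is one here
  because only finitely many lists have length at most m and each derivative is controlled
  separately.\<close>

lemma schwartz_seminorm_upper:
  assumes \<phi>: "\<phi> \<in> schwartz" and l: "length is \<le> m"
  shows "(1 + norm x) ^ m * norm (partials is \<phi> x) \<le> schwartz_seminorm m \<phi>"
proof -
  let ?f = "\<lambda>(is, x). (1 + norm x) ^ m * norm (partials is \<phi> x)"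
  have "bdd_above (\<Union>is\<in>{is::3 list. length is \<le> m}. (\<lambda>x. (1 + norm x) ^ m * norm (partials is \<phi> x)) ` UNIV)"
  proof (intro bdd_above_UN[THEN iffD2, OF finite_lists3_le] ballI)
    fix "is" :: "3 list"
    have "bounded (range (\<lambda>x. (1 + norm x) ^ m *\<^sub>R partials is \<phi> x))" using \<phi> by (simp add: schwartz_def)
    then obtain C where C: "\<And>x. norm ((1 + norm x) ^ m *\<^sub>R partials is \<phi> x) \<le> C" unfolding bounded_iff by auto
    then show "bdd_above (range (\<lambda>x. (1 + norm x) ^ m * norm (partials is \<phi> x)))"
      by (intro bdd_aboveI[of _ C]) auto
  qed
  also have "(\<Union>is\<in>{is::3 list. length is \<le> m}. (\<lambda>x. (1 + norm x) ^ m * norm (partials is \<phi> x)) ` UNIV) = ?f ` ({is. length is \<le> m} \<times> UNIV)"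
    by auto
  finally have "?f (is, x) \<le> (SUP p\<in>{is. length is \<le> m} \<times> UNIV. ?f p)"
    using l by (intro cSUP_upper) auto
  then show ?thesis by (simp add: schwartz_seminorm_def)
qed

text \<open>Bounds the transform of \<phi> uniformly by a single seminorm, which is the continuity
  that \<open>tempered\<close> asks of trigonometric polynomials.\<close>

lemma schwartz_L1_le_seminorm:
  assumes \<phi>: "\<phi> \<in> schwartz"
  shows "(LINT x|lborel. norm (\<phi> x)) \<le> (LINT x|lborel. weight x) * schwartz_seminorm 6 \<phi>"
proof -
  have b: "(1 + norm x) ^ 6 * norm (\<phi> x) \<le> schwartz_seminorm 6 \<phi>" for x
    using schwartz_seminorm_upper[OF \<phi>, of "[]" 6 x] by simp
  have "0 \<le> (1 + norm (0::space)) ^ 6 * norm (\<phi> 0)" by simp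
  then have s: "schwartz_seminorm 6 \<phi> \<ge> 0" using b[of 0] by linarith
  have "(LINT x|lborel. norm (\<phi> x)) \<le> (LINT x|lborel. schwartz_seminorm 6 \<phi> * weight x)"
    by (intro Bochner_Integration.integral_mono integrable_norm schwartz_integrable \<phi> integrable_mult_right weight_integrable le_weightI b s)
  then show ?thesis by (simp add: mult.commute)
qed

lemma trig_tempered: "trig A c \<xi> \<in> tempered"
  unfolding tempered_def
proof (intro CollectI conjI ballI allI)
  show "trig A c \<xi> = on_schwartz (trig A c \<xi>)"
    by (simp add: trig_def regular_def on_schwartz_idem)
  show "trig A c \<xi> (\<lambda>x. \<phi> x + \<psi> x) = trig A c \<xi> \<phi> + trig A c \<xi> \<psi>" if "\<phi> \<in> schwartz" "\<psi> \<in> schwartz" for \<phi> \<psi>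
    using that by (simp add: trig_apply schwartz_add fourier_add schwartz_integrable distrib_left sum.distrib)
  show "trig A c \<xi> (\<lambda>x. d * \<phi> x) = d * trig A c \<xi> \<phi>" if "\<phi> \<in> schwartz" for \<phi> d
    using that by (simp add: trig_apply schwartz_scale fourier_scale sum_distrib_left mult.left_commute)
  show "\<exists>C m. \<forall>\<phi>\<in>schwartz. norm (trig A c \<xi> \<phi>) \<le> C * schwartz_seminorm m \<phi>"
  proof (intro exI ballI)
    fix \<phi> assume \<phi>: "\<phi> \<in> schwartz"
    have "norm (trig A c \<xi> \<phi>) \<le> (\<Sum>j\<in>A. norm (c j) * ((LINT x|lborel. weight x) * schwartz_seminorm 6 \<phi>))"
      unfolding trig_apply[OF \<phi>]
      by (intro order_trans[OF norm_sum] sum_mono order_trans[OF eq_refl[OF norm_mult]] mult_left_mono order_trans[OF norm_fourier_le schwartz_L1_le_seminorm[OF \<phi>]]) auto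
    then show "norm (trig A c \<xi> \<phi>) \<le> (\<Sum>j\<in>A. norm (c j)) * (LINT x|lborel. weight x) * schwartz_seminorm 6 \<phi>"
      by (simp add: sum_distrib_right mult.assoc)
  qed
qed

lemma mult_op_trig_apply:
  assumes \<phi>: "\<phi> \<in> schwartz" and m: "(\<lambda>\<zeta>. m (- \<zeta>) * fourier \<phi> \<zeta>) \<in> schwartz"
  shows "mult_op m (trig A c \<xi>) \<phi> = (\<Sum>j\<in>A. c j * (m (\<xi> j) * fourier \<phi> (- \<xi> j)))"
  using \<phi> unfolding mult_op_def on_schwartz_def mult_fun_def
  by (simp add: trig_apply inv_fourier_schwartz[OF m] fourier_inv_fourier[OF m])

lemma mult_op_trig:
  assumes "\<And>\<phi>. \<phi> \<in> schwartz \<Longrightarrow> (\<lambda>\<zeta>. m (- \<zeta>) * fourier \<phi> \<zeta>) \<in> schwartz"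
  shows "mult_op m (trig A c \<xi>) = trig A (\<lambda>j. c j * m (\<xi> j)) \<xi>"
proof (rule trig_eqI)
  show "mult_op m (trig A c \<xi>) = on_schwartz (mult_op m (trig A c \<xi>))"
    by (simp add: mult_op_def on_schwartz_idem)
qed (simp add: mult_op_trig_apply assms mult.assoc)

lemma heat_trig: "t > 0 \<Longrightarrow> heat t (trig A c \<xi>) = trig A (\<lambda>j. c j * of_real (exp (- t * (norm (\<xi> j))\<^sup>2))) \<xi>"
  unfolding heat_def
  by (rule mult_op_trig) (use schwartz_mult[OF schwartz_gaussian fourier_schwartz] in simp)

lemma S_op_trig:
  assumes "lp_cutoff \<phi>0"
  shows "S_op \<phi>0 j (trig A c \<xi>) = trig A (\<lambda>a. c a * S_symbol \<phi>0 j (\<xi> a)) \<xi>"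
  unfolding S_op_def
  by (rule mult_op_trig) (use schwartz_mult[OF S_symbol_schwartz[OF assms] fourier_schwartz] in simp)

text \<open>The reflected and translated kernel of \<open>S_op\<close> has the transform exp(i
  x.\<zeta>) times the cutoff at -\<zeta>, so the convolution multiplies each coefficient by the
  symbol.\<close>

lemma S_fun_trig:
  assumes "lp_cutoff \<phi>0"
  shows "S_fun \<phi>0 j (trig A c \<xi>) x = trig_fun A (\<lambda>a. c a * S_symbol \<phi>0 j (\<xi> a)) \<xi> x"
proof -
  define K where "K = inv_fourier (S_symbol \<phi>0 j)"
  have K: "K \<in> schwartz" unfolding K_def by (intro inv_fourier_schwartz S_symbol_schwartz assms)
  have FK: "fourier K = S_symbol \<phi>0 j" unfolding K_def by (rule fourier_inv_fourier[OF S_symbol_schwartz[OF assms]])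
  have Kx: "(\<lambda>y. K (x - y)) \<in> schwartz" using schwartz_affine[OF K, of "-1" x] by simp
  have "fourier (\<lambda>y. K (x - y)) (- \<zeta>) = exp (\<i> * of_real (x \<bullet> \<zeta>)) * S_symbol \<phi>0 j \<zeta>" for \<zeta>
    using fourier_affine[of "-1" K "- \<zeta>" x] schwartz_measurable[OF K]
    by (simp add: FK exp_minus field_simps)
  then show ?thesis
    unfolding S_fun_def K_def[symmetric] trig_apply[OF Kx] trig_fun_def by (simp add: ac_simps)
qed

lemma affine_comp_trig:
  assumes "r > 0"
  shows "affine_comp r 0 (trig A c \<xi>) = trig A c (\<lambda>j. r *\<^sub>R \<xi> j)"
proof (rule trig_eqI)
  show "affine_comp r 0 (trig A c \<xi>) = on_schwartz (affine_comp r 0 (trig A c \<xi>))"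
    by (simp add: affine_comp_def on_schwartz_idem)
  fix \<phi> assume \<phi>: "\<phi> \<in> schwartz"
  have d: "(\<lambda>y. \<phi> (y /\<^sub>R r)) \<in> schwartz" using schwartz_affine[OF \<phi>, of "inverse r" 0] assms by simp
  have "fourier (\<lambda>y. \<phi> (y /\<^sub>R r)) \<zeta> = of_real (r ^ 3) * fourier \<phi> (r *\<^sub>R \<zeta>)" for \<zeta>
    using fourier_affine[of "inverse r" \<phi> \<zeta> 0] schwartz_measurable[OF \<phi>] assms by (simp add: field_simps)
  then show "affine_comp r 0 (trig A c \<xi>) \<phi> = (\<Sum>j\<in>A. c j * fourier \<phi> (- (r *\<^sub>R \<xi> j)))"
    using \<phi> assms unfolding affine_comp_def on_schwartz_def
    by (simp add: trig_apply[OF d] sum_divide_distrib)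
qed

lemma cscale_trig: "cscale d (trig A c \<xi>) = trig A (\<lambda>j. d * c j) \<xi>"
proof (rule trig_eqI)
  show "cscale d (trig A c \<xi>) = on_schwartz (cscale d (trig A c \<xi>))"
    by (auto simp: cscale_def on_schwartz_def trig_outside)
qed (simp add: cscale_def trig_apply sum_distrib_left mult.assoc)

lemma trig_diff: "trig A c \<xi> - trig A d \<xi> = trig A (\<lambda>j. c j - d j) \<xi>"
proof (rule trig_eqI)
  show "trig A c \<xi> - trig A d \<xi> = on_schwartz (trig A c \<xi> - trig A d \<xi>)"
    by (auto simp: on_schwartz_def trig_outside)
qed (simp add: trig_apply sum_subtractf left_diff_distrib)

lemma trig_insert:
  assumes "finite A" "a \<notin> A"
  shows "trig (insert a A) c \<xi> = cscale (c a) (trig {a} (\<lambda>_. 1) \<xi>) + trig A c \<xi>"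
  by (rule trig_eqI[symmetric]) (auto simp: on_schwartz_def trig_outside cscale_def trig_apply assms)

section \<open>Sup norms and Besov norms of trigonometric polynomials\<close>

lemma linf_norm_trig_le: "linf_norm (trig A c \<xi>) \<le> ennreal (\<Sum>j\<in>A. norm (c j))"
  unfolding linf_norm_def
proof (rule Inf_lower, intro CollectI exI conjI)
  show "0 \<le> (\<Sum>j\<in>A. norm (c j))" by (intro sum_nonneg) auto
  show "\<exists>g\<in>borel_measurable lborel. (AE x in lborel. norm (g x) \<le> (\<Sum>j\<in>A. norm (c j))) \<and> trig A c \<xi> = regular g"
  proof (intro bexI conjI)
    show "trig_fun A c \<xi> \<in> borel_measurable lborel" unfolding trig_fun_def[abs_def] by measurable
    show "trig A c \<xi> = regular (trig_fun A c \<xi>)" by (rule trig_def)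
    show "AE x in lborel. norm (trig_fun A c \<xi> x) \<le> (\<Sum>j\<in>A. norm (c j))"
      unfolding trig_fun_def
      by (intro AE_I2 order_trans[OF norm_sum] sum_mono) (simp add: norm_mult)
  qed
qed simp

lemma trig_eq_0: "(\<And>a. a \<in> A \<Longrightarrow> c a = 0) \<Longrightarrow> trig A c \<xi> = 0"
  by (rule trig_eqI[symmetric]) (auto simp: on_schwartz_def)

text \<open>Finitely many nonzero frequencies stay away from 0. Hence \<open>S_op\<close>
  annihilates the polynomial for very negative j, and 2^(-j) is bounded by a multiple of 1 / |\<xi>|
  whenever the j-th block sees the frequency \<xi>.\<close>

lemma trig_besov:
  assumes lp: "lp_cutoff \<phi>0" and A: "finite A" and \<xi>: "\<And>a. a \<in> A \<Longrightarrow> \<xi> a \<noteq> 0"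
  shows "trig A c \<xi> \<in> besov \<phi>0"
  unfolding besov_def
proof (intro CollectI conjI trig_tempered)
  have "\<forall>\<^sub>F j in at_bot. \<forall>a\<in>A. 4 powi (- j) * (norm (\<xi> a))\<^sup>2 > 1"
    using A \<xi> by (intro eventually_ball_finite ballI eventually_4_powi_gt) auto
  then have "\<forall>\<^sub>F j in at_bot. S_op \<phi>0 j (trig A c \<xi>) = 0"
  proof eventually_elim
    case (elim j)
    then have "c a * S_symbol \<phi>0 j (\<xi> a) = 0" if "a \<in> A" for a using S_symbol_eq_0[OF lp] that by simp
    then show ?case unfolding S_op_trig[OF lp] by (rule trig_eq_0)
  qed
  then show "((\<lambda>j. S_op \<phi>0 j (trig A c \<xi>)) \<longlongrightarrow> 0) at_bot"
    by (rule tendsto_eventually)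
next
  obtain M where M: "M \<ge> 0" "\<And>x. x \<ge> 0 \<Longrightarrow> \<bar>\<phi>0 x\<bar> \<le> M" using lp_cutoff_bounded[OF lp] by blast
  have S: "norm (S_symbol \<phi>0 j \<zeta>) \<le> M" for j \<zeta> using M(2) by (simp add: S_symbol_def)
  \<comment> \<open>Per frequency: 2 / |\<xi>| bounds 2^(-j), and 2 M bounds the difference of two
    cutoff values.\<close>
  define D where "D = (\<Sum>a\<in>A. norm (c a) * (4 * M / norm (\<xi> a)))"
  have "ennreal (2 powi (- j)) * linf_norm (Delta_op \<phi>0 j (trig A c \<xi>)) \<le> ennreal D" for j
  proof -
    let ?d = "\<lambda>a. c a * S_symbol \<phi>0 (j + 1) (\<xi> a) - c a * S_symbol \<phi>0 j (\<xi> a)"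
    have bd: "2 powi (- j) * norm (?d a) \<le> norm (c a) * (4 * M / norm (\<xi> a))" if "a \<in> A" for a
    \<comment> \<open>The threshold is 4 because the wider cutoff, of index j + 1, vanishes once
      4^(-j) |\<xi>|^2 exceeds 4; the narrower one then vanishes too.\<close>
    proof (cases "4 powi (- j) * (norm (\<xi> a))\<^sup>2 > 4")
      case True
      have "(4::real) powi (- (j + 1)) = 4 powi (- j) / 4" by (simp add: power_int_diff)
      then have "4 powi (- (j + 1)) * (norm (\<xi> a))\<^sup>2 = 4 powi (- j) * (norm (\<xi> a))\<^sup>2 / 4" by simp
      then have "4 powi (- (j + 1)) * (norm (\<xi> a))\<^sup>2 > 1" using True by linarith
      then show ?thesis using True M(1) by (simp add: S_symbol_eq_0[OF lp])
    next
      case False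
      have n: "norm (\<xi> a) > 0" using \<xi> that by simp
      have "(2 powi (- j) * norm (\<xi> a))\<^sup>2 = 4 powi (- j) * (norm (\<xi> a))\<^sup>2"
        by (simp add: power_mult_distrib power2_eq_square flip: power_int_mult_distrib)
      then have "(2 powi (- j) * norm (\<xi> a))\<^sup>2 \<le> 2\<^sup>2" using False by simp
      then have "2 powi (- j) * norm (\<xi> a) \<le> 2" by (rule power2_le_imp_le) simp
      then have l: "2 powi (- j) \<le> 2 / norm (\<xi> a)" using n by (simp add: pos_le_divide_eq)
      have "norm (?d a) \<le> norm (c a) * (2 * M)"
        unfolding right_diff_distrib[symmetric] norm_mult
        by (intro mult_left_mono order_trans[OF norm_triangle_ineq4]) (use S[of "j + 1" "\<xi> a"] S[of j "\<xi> a"] in auto)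
      then have "2 powi (- j) * norm (?d a) \<le> 2 / norm (\<xi> a) * (norm (c a) * (2 * M))"
        using M(1) by (intro mult_mono l) auto
      then show ?thesis by (simp add: ac_simps)
    qed
    have "ennreal (2 powi (- j)) * linf_norm (Delta_op \<phi>0 j (trig A c \<xi>)) \<le> ennreal (2 powi (- j)) * ennreal (\<Sum>a\<in>A. norm (?d a))"
      unfolding Delta_op_def S_op_trig[OF lp] trig_diff by (intro mult_left_mono linf_norm_trig_le) auto
    also have "\<dots> = ennreal (\<Sum>a\<in>A. 2 powi (- j) * norm (?d a))"
      by (simp add: ennreal_mult[symmetric] sum_nonneg sum_distrib_left)
    also have "\<dots> \<le> ennreal D" unfolding D_def by (intro ennreal_leI sum_mono bd)
    finally show ?thesis .
  qed
  then have "(SUP j. ennreal (2 powi (- j)) * linf_norm (Delta_op \<phi>0 j (trig A c \<xi>))) \<le> ennreal D"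
    by (intro SUP_least)
  also have "\<dots> < \<infinity>" by simp
  finally show "(SUP j. ennreal (2 powi (- j)) * linf_norm (Delta_op \<phi>0 j (trig A c \<xi>))) < \<infinity>" .
qed

lemma besov_norm_trig_le:
  assumes "\<And>t. t > 0 \<Longrightarrow> sqrt t * (\<Sum>a\<in>A. norm (c a) * exp (- t * (norm (\<xi> a))\<^sup>2)) \<le> C" and "C \<ge> 0"
  shows "besov_norm (trig A c \<xi>) \<le> C"
  unfolding besov_norm_def
proof (intro enn2real_leI SUP_least assms(2))
  fix t :: real assume "t \<in> {0<..}"
  then have t: "t > 0" by simp
  have "ennreal (sqrt t) * linf_norm (heat t (trig A c \<xi>)) \<le> ennreal (sqrt t) * ennreal (\<Sum>a\<in>A. norm (c a * of_real (exp (- t * (norm (\<xi> a))\<^sup>2))))"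
    unfolding heat_trig[OF t] by (intro mult_left_mono linf_norm_trig_le) auto
  also have "\<dots> = ennreal (sqrt t * (\<Sum>a\<in>A. norm (c a) * exp (- t * (norm (\<xi> a))\<^sup>2)))"
    using t by (simp add: ennreal_mult[symmetric] sum_nonneg norm_mult)
  also have "\<dots> \<le> ennreal C" by (intro ennreal_leI assms t)
  finally show "ennreal (sqrt t) * linf_norm (heat t (trig A c \<xi>)) \<le> ennreal C" .
qed

section \<open>Localising a symbol that is smooth on an open set only\<close>

lemma has_derivative_zero_on_open:
  assumes "open S" "x \<in> S" "\<And>y. y \<in> S \<Longrightarrow> f y = (0::complex)"
  shows "(f has_derivative (\<lambda>_. 0)) (at x)"
  by (rule has_derivative_transform_within_open[OF has_derivative_const assms(1,2)]) (use assms(3) in auto)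

text \<open>The generators are derivatives of q times Schwartz functions vanishing off
  \<open>K\<close>. Off \<open>K\<close>, where nothing is known about the derivatives of q, the
  second factor is 0 on an open set, so the product and its derivatives vanish there; on
  \<open>K\<close> the product rule and compactness apply.\<close>

lemma schwartz_smooth_mult:
  assumes q: "smooth_on U q" and K: "compact K" "K \<subseteq> U"
    and \<kappa>: "\<kappa> \<in> schwartz" "\<And>x. x \<notin> K \<Longrightarrow> \<kappa> x = 0"
  shows "(\<lambda>x. q x * \<kappa> x) \<in> schwartz"
proof -
  define X where "X = {f \<in> schwartz. \<forall>x. x \<notin> K \<longrightarrow> f x = 0}"
  have oK: "open (- K)" using K by (simp add: compact_imp_closed open_Compl)
  have pdX: "pd i f \<in> X" if "f \<in> X" for i f
  proof -
    have "pd i f x = 0" if "x \<notin> K" for x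
      using pd_eqI[OF has_derivative_zero_on_open[OF oK, of x f]] \<open>f \<in> X\<close> that unfolding X_def by auto
    then show ?thesis using that schwartz_pd unfolding X_def by blast
  qed
  have dq: "partials is q differentiable (at x)" if "x \<in> K" for "is" x
    using q that K(2) unfolding smooth_on_def by blast
  define B where "B = {\<lambda>x. partials is q x * f x | is f. f \<in> X}"
  have "closure_span B \<subseteq> schwartz"
  proof (rule closure_span_subset_schwartz)
    fix h assume "h \<in> B"
    then obtain "is" f where h: "h = (\<lambda>x. partials is q x * f x)" and f: "f \<in> X" by (auto simp: B_def)
    then have fs: "f \<in> schwartz" and f0: "\<And>x. x \<notin> K \<Longrightarrow> f x = 0" by (auto simp: X_def)
    have z: "(h has_derivative (\<lambda>_. 0)) (at x)" if "x \<notin> K" for x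
      by (rule has_derivative_zero_on_open[OF oK]) (use that f0 h in auto)
    show "h differentiable (at x)" for x
    proof (cases "x \<in> K")
      case True
      then show ?thesis unfolding h by (intro differentiable_mult dq schwartz_differentiable fs)
    next
      case False
      then show ?thesis using z differentiable_def by blast
    qed
    have "pd i h x = partials (i # is) q x * f x + partials is q x * pd i f x" for i x
    proof (cases "x \<in> K")
      case True
      then show ?thesis unfolding h partials_Cons_pd
        using pd_mult[OF dq schwartz_differentiable[OF fs]] by simp
    next
      case False
      then show ?thesis using pd_eqI[OF z] f0 pdX[OF f] by (simp add: X_def)
    qed
    then have "pd i h = (\<lambda>x. partials (i # is) q x * f x + partials is q x * pd i f x)" for i by blast
    moreover have "(\<lambda>x. partials (i # is) q x * f x) \<in> B" "(\<lambda>x. partials is q x * pd i f x) \<in> B" for i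
      unfolding B_def using f pdX[OF f] by blast+
    ultimately show "pd i h \<in> closure_span B" for i
      by (simp only: closure_span.base closure_span.add)
    have "bounded (partials is q ` K)"
      by (intro compact_imp_bounded compact_continuous_image K continuous_at_imp_continuous_on ballI
          differentiable_imp_continuous_within dq)
    then obtain M where M: "M > 0" "\<forall>x\<in>K. norm (partials is q x) \<le> M" by (auto simp: bounded_pos)
    show "rapid h"
    proof (rule rapid_dominated[OF schwartz_rapid[OF fs], of _ M 0])
      show "norm (h x) \<le> M * (1 + norm x) ^ 0 * norm (f x)" for x
        using M f0 by (cases "x \<in> K") (auto simp: h norm_mult intro: mult_right_mono)
    qed (use M in simp)
  qed
  moreover have "(\<lambda>x. partials [] q x * \<kappa> x) \<in> B" unfolding B_def X_def using \<kappa> by blast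
  ultimately have "(\<lambda>x. partials [] q x * \<kappa> x) \<in> schwartz" by (meson closure_span.base subsetD)
  then show ?thesis by simp
qed

text \<open>Telescoping against \<open>y / (1 + y)\<close>, whose increment from \<open>y\<close> to \<open>2 y\<close> dominates the summand.\<close>

lemma dyadic_gaussian_sum_le:
  fixes x :: real
  assumes "x > 0"
  shows "(\<Sum>j<n. x * 2 ^ j * exp (- (x * 2 ^ j)\<^sup>2)) \<le> 4"
proof -
  define F where "F y = y / (1 + y)" for y :: real
  \<comment> \<open>The increment of \<open>F\<close> equals y / ((1 + 2 y) (1 + y)), so the claim
    is (1 + 2 y) (1 + y) \<le> 4 exp(y^2).\<close>
  have step: "y * exp (- y\<^sup>2) \<le> 4 * (F (2 * y) - F y)" if "y > 0" for y
  proof -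
    have "2 * y \<le> 1 + y\<^sup>2" using zero_le_power2[of "y - 1"] by (simp add: power2_diff)
    moreover have "(1 + 2 * y) * (1 + y) = 1 + 3 * y + 2 * y\<^sup>2" by (simp add: power2_eq_square algebra_simps)
    moreover have "4 * (1 + y\<^sup>2) = 4 + 4 * y\<^sup>2" "0 \<le> y\<^sup>2" by simp_all
    ultimately have "(1 + 2 * y) * (1 + y) \<le> 4 * (1 + y\<^sup>2)" by linarith
    also have "4 * (1 + y\<^sup>2) \<le> 4 * exp (y\<^sup>2)" by (intro mult_left_mono exp_ge_add_one_self) simp
    finally have a: "(1 + 2 * y) * (1 + y) \<le> 4 * exp (y\<^sup>2)" .
    have d: "(1 + 2 * y) * (1 + y) > 0" using that by (intro mult_pos_pos) auto
    have "y * exp (- y\<^sup>2) = 4 * (y / (4 * exp (y\<^sup>2)))" by (simp add: exp_minus field_simps)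
    also have "\<dots> \<le> 4 * (y / ((1 + 2 * y) * (1 + y)))"
      using a d that by (intro mult_left_mono divide_left_mono mult_pos_pos) auto
    also have "y / ((1 + 2 * y) * (1 + y)) = F (2 * y) - F y"
      using that by (simp add: F_def diff_frac_eq) (simp add: algebra_simps)
    finally show ?thesis .
  qed
  have "(\<Sum>j<n. x * 2 ^ j * exp (- (x * 2 ^ j)\<^sup>2)) \<le> (\<Sum>j<n. 4 * (F (x * 2 ^ Suc j) - F (x * 2 ^ j)))"
    using step[of "x * 2 ^ _"] assms by (intro sum_mono) (simp add: mult.left_commute)
  also have "\<dots> = 4 * (F (x * 2 ^ n) - F x)"
    using sum_lessThan_telescope[of "\<lambda>j. F (x * 2 ^ j)" n] by (simp only: sum_distrib_left[symmetric]) simp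
  also have "\<dots> \<le> 4"
  proof -
    have "F (x * 2 ^ n) \<le> 1" unfolding F_def using assms by (subst divide_le_eq_1_pos) (auto intro: add_pos_pos)
    moreover have "F x \<ge> 0" unfolding F_def using assms by simp
    ultimately show ?thesis by simp
  qed
  finally show ?thesis .
qed

subsection \<open>Norm topologies\<close>

text \<open>Stated for any functional on differences, so that it serves both the spaces of
  distributions and the path space.\<close>

lemma Metric_space_norm_dist:
  assumes "\<And>f g. f \<in> V \<Longrightarrow> g \<in> V \<Longrightarrow> 0 \<le> N (f - g)"
    and "\<And>f g. f \<in> V \<Longrightarrow> g \<in> V \<Longrightarrow> N (f - g) = 0 \<longleftrightarrow> f = g"
    and "\<And>f g. f \<in> V \<Longrightarrow> g \<in> V \<Longrightarrow> N (f - g) = N (g - f)"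
    and "\<And>f g h. f \<in> V \<Longrightarrow> g \<in> V \<Longrightarrow> h \<in> V \<Longrightarrow> N (f - h) \<le> N (f - g) + N (g - h)"
  shows "Metric_space V (norm_dist V N)"
proof
  show "0 \<le> norm_dist V N f g" for f g by (simp add: norm_dist_def assms(1))
  show "norm_dist V N f g = norm_dist V N g f" for f g using assms(3)[of f g] by (simp add: norm_dist_def)
  show "norm_dist V N f g = 0 \<longleftrightarrow> f = g" if "f \<in> V" "g \<in> V" for f g
    using that by (simp add: norm_dist_def assms(2))
  show "norm_dist V N f h \<le> norm_dist V N f g + norm_dist V N g h" if "f \<in> V" "g \<in> V" "h \<in> V" for f g h
    using that by (simp add: norm_dist_def assms(4))
qed

lemma cscale_minus_one: "cscale (- 1) f = - f"
  by (auto simp: cscale_def)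

lemma cscale_0: "cscale 0 f = 0"
  by (auto simp: cscale_def)

context
  fixes V N
  assumes V: "banach_distributions V N"
begin

lemma banach_tempered: "V \<subseteq> tempered"
  and banach_zero: "0 \<in> V"
  and banach_add: "f \<in> V \<Longrightarrow> g \<in> V \<Longrightarrow> f + g \<in> V"
  and banach_cscale: "f \<in> V \<Longrightarrow> cscale c f \<in> V"
  and banach_norm_nonneg: "f \<in> V \<Longrightarrow> 0 \<le> N f"
  and banach_norm_eq_0: "f \<in> V \<Longrightarrow> N f = 0 \<longleftrightarrow> f = 0"
  and banach_norm_add: "f \<in> V \<Longrightarrow> g \<in> V \<Longrightarrow> N (f + g) \<le> N f + N g"
  and banach_norm_cscale: "f \<in> V \<Longrightarrow> N (cscale c f) = norm c * N f"
proof -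
  note * = V[unfolded banach_distributions_def]
  show "V \<subseteq> tempered" "0 \<in> V" using * by simp_all
  show "f \<in> V \<Longrightarrow> g \<in> V \<Longrightarrow> f + g \<in> V" using * by simp
  show "f \<in> V \<Longrightarrow> cscale c f \<in> V" using * by simp
  show "f \<in> V \<Longrightarrow> 0 \<le> N f" using * by simp
  show "f \<in> V \<Longrightarrow> N f = 0 \<longleftrightarrow> f = 0" using * by simp
  show "f \<in> V \<Longrightarrow> g \<in> V \<Longrightarrow> N (f + g) \<le> N f + N g" using * by simp
  show "f \<in> V \<Longrightarrow> N (cscale c f) = norm c * N f" using * by simp
qed

lemma banach_uminus: "f \<in> V \<Longrightarrow> - f \<in> V"
  using banach_cscale[of f "- 1"] by (simp add: cscale_minus_one)

lemma banach_diff: "f \<in> V \<Longrightarrow> g \<in> V \<Longrightarrow> f - g \<in> V"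
  using banach_add[OF _ banach_uminus, of f g] by simp

lemma banach_norm_minus: "f \<in> V \<Longrightarrow> N (- f) = N f"
  using banach_norm_cscale[of f "- 1"] by (simp add: cscale_minus_one)

lemma banach_norm_minus_commute: "f \<in> V \<Longrightarrow> g \<in> V \<Longrightarrow> N (f - g) = N (g - f)"
  using banach_norm_minus[OF banach_diff, of f g] by simp

lemma banach_norm_triangle: "f \<in> V \<Longrightarrow> g \<in> V \<Longrightarrow> h \<in> V \<Longrightarrow> N (f - h) \<le> N (f - g) + N (g - h)"
  using banach_norm_add[OF banach_diff banach_diff, of f g g h] by simp

lemma banach_Metric_space: "Metric_space V (norm_dist V N)"
proof (rule Metric_space_norm_dist)
  show "0 \<le> N (f - g)" if "f \<in> V" "g \<in> V" for f g by (rule banach_norm_nonneg[OF banach_diff[OF that]])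
  show "N (f - g) = 0 \<longleftrightarrow> f = g" if "f \<in> V" "g \<in> V" for f g
    using banach_norm_eq_0[OF banach_diff[OF that]] by simp
qed (rule banach_norm_minus_commute banach_norm_triangle; assumption)+

end

lemma norm_topology_continuousD:
  assumes V: "Metric_space V (norm_dist V N)" and W: "Metric_space W (norm_dist W M)"
    and T: "continuous_map (norm_topology V N) (norm_topology W M) T"
    and x: "x \<in> V" and e: "e > 0"
  shows "\<exists>d>0. \<forall>y\<in>V. N (x - y) < d \<longrightarrow> T y \<in> W \<and> M (T x - T y) < e"
proof -
  have "x \<in> topspace (norm_topology V N)" using x by (simp add: Metric_space.topspace_mtopology[OF V])
  then obtain U where U: "openin (norm_topology V N) U" "x \<in> U"
      "\<forall>y\<in>U. T y \<in> Metric_space.mball W (norm_dist W M) (T x) e"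
    using T e unfolding Metric_space.continuous_map_to_metric[OF W] by blast
  obtain d where d: "d > 0" "Metric_space.mball V (norm_dist V N) x d \<subseteq> U"
    using U(1,2) unfolding Metric_space.openin_mtopology[OF V] by blast
  show ?thesis
  proof (intro exI[of _ d] conjI ballI impI d)
    fix y assume y: "y \<in> V" "N (x - y) < d"
    then have "y \<in> Metric_space.mball V (norm_dist V N) x d"
      using x by (simp add: Metric_space.in_mball[OF V] norm_dist_def)
    then have "T y \<in> Metric_space.mball W (norm_dist W M) (T x) e" using d U(3) by blast
    then show "T y \<in> W" "M (T x - T y) < e" by (auto simp: Metric_space.in_mball[OF W] norm_dist_def)
  qed
qed

text \<open>Rescaling f to norm d/2 turns a bound on a ball into a linear bound. It is applied to
  the norm of the image under an operator and to the modulus of an evaluation.\<close>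

lemma banach_bounded_functional:
  assumes V: "banach_distributions V N" and d: "d > 0"
    and bd: "\<And>f. f \<in> V \<Longrightarrow> N f < d \<Longrightarrow> p f < 1"
    and hom: "\<And>r f. r > 0 \<Longrightarrow> f \<in> V \<Longrightarrow> p (cscale (of_real r) f) = r * p f"
    and p0: "p 0 \<le> 0"
  shows "\<forall>f\<in>V. p f \<le> 2 / d * N f"
proof
  fix f assume f: "f \<in> V"
  show "p f \<le> 2 / d * N f"
  proof (cases "N f = 0")
    case True
    then show ?thesis using banach_norm_eq_0[OF V f] p0 by simp
  next
    case False
    then have n: "N f > 0" using banach_norm_nonneg[OF V f] by simp
    define r where "r = d / (2 * N f)"
    have r: "r > 0" unfolding r_def using d n by simp
    have "N (cscale (of_real r) f) = r * N f" using r by (simp add: banach_norm_cscale[OF V f])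
    also have "\<dots> = d / 2" using n by (simp add: r_def)
    finally have "N (cscale (of_real r) f) = d / 2" .
    then have "r * p f < 1" using bd[OF banach_cscale[OF V f], of "of_real r"] hom[OF r f] d by simp
    then show ?thesis using n d by (simp add: r_def field_simps)
  qed
qed

text \<open>Makes the continuity of e^\<Delta> from E to F quantitative: near 0 the image has norm
  less than 1, and homogeneity does the rest.\<close>

lemma banach_bounded_linear:
  assumes V: "banach_distributions V N" and W: "banach_distributions W M"
    and T: "continuous_map (norm_topology V N) (norm_topology W M) T"
    and hom: "\<And>c f. T (cscale c f) = cscale c (T f)"
  shows "T ` V \<subseteq> W" "\<exists>C\<ge>0. \<forall>f\<in>V. M (T f) \<le> C * N f"
proof -
  note MV = banach_Metric_space[OF V] and MW = banach_Metric_space[OF W]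
  show TV: "T ` V \<subseteq> W"
    using continuous_map_image_subset_topspace[OF T] by (simp add: Metric_space.topspace_mtopology[OF MV] Metric_space.topspace_mtopology[OF MW])
  have T0: "T 0 = 0" using hom[of 0 0] by (simp add: cscale_0)
  obtain d where d: "d > 0" "\<forall>y\<in>V. N (0 - y) < d \<longrightarrow> T y \<in> W \<and> M (T 0 - T y) < 1"
    using norm_topology_continuousD[OF MV MW T banach_zero[OF V], of 1] by auto
  have "\<forall>f\<in>V. M (T f) \<le> 2 / d * N f"
  proof (rule banach_bounded_functional[OF V d(1)])
    show "M (T f) < 1" if "f \<in> V" "N f < d" for f
    proof -
      have "M (- T f) < 1" using d(2) that banach_norm_minus[OF V that(1)] by (auto simp: T0)
      moreover have "T f \<in> W" using TV that by blast
      ultimately show ?thesis by (simp add: banach_norm_minus[OF W])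
    qed
    show "M (T (cscale (of_real r) f)) = r * M (T f)" if "r > 0" "f \<in> V" for r f
      using that TV by (simp add: hom banach_norm_cscale[OF W] image_subset_iff)
    show "M (T 0) \<le> 0" using banach_norm_eq_0[OF W banach_zero[OF W]] by (simp add: T0)
  qed
  then show "\<exists>C\<ge>0. \<forall>f\<in>V. M (T f) \<le> C * N f" using d(1) by (intro exI[of _ "2 / d"]) auto
qed

lemma tdist_eval_continuous: "continuous_on S (\<lambda>T::tdist. T \<phi>)"
  by (rule continuous_on_subset[OF continuous_on_product_coordinates]) simp

text \<open>Evaluation at \<phi> is continuous for the topology of pointwise convergence, so some
  ball of V is mapped into the unit disc. This is how a lower bound on one value becomes a lower
  bound on the unknown norm of F.\<close>

lemma injects_continuously_eval:
  assumes V: "banach_distributions V N" and inj: "injects_continuously V N"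
  shows "\<exists>C. \<forall>f\<in>V. norm (f \<phi>) \<le> C * N f"
proof -
  note MV = banach_Metric_space[OF V]
  have "open ((\<lambda>T::tdist. T \<phi>) -` ball 0 1)"
    by (rule open_vimage[OF open_ball tdist_eval_continuous])
  then have o: "openin (top_of_set tempered) (tempered \<inter> ((\<lambda>T::tdist. T \<phi>) -` ball 0 1))"
    by (rule openin_open_Int)
  have z: "(0::tdist) \<in> tempered" using banach_zero[OF V] banach_tempered[OF V] by blast
  have "\<exists>d>0. \<forall>x. x \<in> V \<and> norm_dist V N 0 x < d \<longrightarrow> id x \<in> tempered \<inter> ((\<lambda>T::tdist. T \<phi>) -` ball 0 1)"
  proof -
    note c = inj[unfolded injects_continuously_def Metric_space.continuous_map_from_metric[OF MV], THEN conjunct2]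
    have "id (0::tdist) \<in> tempered \<inter> ((\<lambda>T::tdist. T \<phi>) -` ball 0 1)" using z by simp
    with c banach_zero[OF V] o show ?thesis by blast
  qed
  then obtain d where d: "d > 0" "\<And>x. x \<in> V \<Longrightarrow> norm_dist V N 0 x < d \<Longrightarrow> norm (x \<phi>) < 1" by auto
  have "\<forall>f\<in>V. norm (f \<phi>) \<le> 2 / d * N f"
  proof (rule banach_bounded_functional[OF V d(1)])
    show "norm (f \<phi>) < 1" if "f \<in> V" "N f < d" for f
      using d(2)[OF that(1)] that banach_zero[OF V] by (simp add: norm_dist_def banach_norm_minus[OF V])
  qed (auto simp: cscale_def norm_mult)
  then show ?thesis by blast
qed

lemma continuous_map_norm_topology_iff:
  fixes u :: "real \<Rightarrow> 'a::minus"
  assumes W: "Metric_space W (norm_dist W M)"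
  shows "continuous_map (top_of_set {0<..}) (norm_topology W M) u \<longleftrightarrow>
    (\<forall>t>0. u t \<in> W) \<and> (\<forall>t>0. \<forall>e>0. \<exists>d>0. \<forall>s>0. \<bar>s - t\<bar> < d \<longrightarrow> M (u t - u s) < e)"
    (is "?L \<longleftrightarrow> ?R")
proof
  assume L: ?L
  have W': "u t \<in> W" if "t > 0" for t
    using continuous_map_image_subset_topspace[OF L] that by (auto simp: Metric_space.topspace_mtopology[OF W])
  moreover have "\<exists>d>0. \<forall>s>0. \<bar>s - t\<bar> < d \<longrightarrow> M (u t - u s) < e" if t: "t > 0" and e: "e > 0" for t e
  proof -
    obtain U where U: "openin (top_of_set {0<..}) U" "t \<in> U" "\<forall>y\<in>U. u y \<in> Metric_space.mball W (norm_dist W M) (u t) e"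
      using L[unfolded Metric_space.continuous_map_to_metric[OF W], rule_format, of t e] t e by auto
    obtain d where d: "d > 0" "\<forall>s\<in>{0<..}. dist s t < d \<longrightarrow> s \<in> U"
      using U(1,2) unfolding openin_euclidean_subtopology_iff by blast
    show ?thesis
    proof (intro exI[of _ d] conjI allI impI d)
      fix s :: real assume "s > 0" "\<bar>s - t\<bar> < d"
      then have "s \<in> U" using d by (auto simp: dist_real_def)
      then have "u s \<in> Metric_space.mball W (norm_dist W M) (u t) e" using U by blast
      then show "M (u t - u s) < e" by (auto simp: Metric_space.in_mball[OF W] norm_dist_def)
    qed
  qed
  ultimately show ?R by blast
next
  assume R: ?R
  show ?L
    unfolding Metric_space.continuous_map_to_metric[OF W]
  proof (intro ballI allI impI)
    fix t e :: real assume "t \<in> topspace (top_of_set {0<..})" "e > 0"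
    then have t: "t > 0" by simp
    obtain d where d: "d > 0" "\<And>s. s > 0 \<Longrightarrow> \<bar>s - t\<bar> < d \<Longrightarrow> M (u t - u s) < e" using R t \<open>e > 0\<close> by blast
    show "\<exists>U. openin (top_of_set {0<..}) U \<and> t \<in> U \<and> (\<forall>y\<in>U. u y \<in> Metric_space.mball W (norm_dist W M) (u t) e)"
    proof (intro exI[of _ "{0<..} \<inter> ball t d"] conjI ballI)
      show "openin (top_of_set {0<..}) ({0<..} \<inter> ball t d)" by (rule openin_open_Int[OF open_ball])
      show "t \<in> {0<..} \<inter> ball t d" using t d by simp
      fix s assume "s \<in> {0<..} \<inter> ball t d"
      then show "u s \<in> Metric_space.mball W (norm_dist W M) (u t) e"
        using R d t by (auto simp: Metric_space.in_mball[OF W] norm_dist_def dist_real_def abs_minus_commute)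
    qed
  qed
qed

section \<open>Dilations and the path space\<close>

lemma tempered_on_schwartz: "T \<in> tempered \<Longrightarrow> T = on_schwartz T"
  by (simp add: tempered_def)

text \<open>Testing against the dilated function \<phi>(r y) recovers the value of T at \<phi> up to
  the factor r^3.\<close>

lemma affine_comp_eq_0:
  assumes T: "T \<in> tempered" and r: "r > 0" and z: "affine_comp r 0 T = 0"
  shows "T = 0"
proof
  fix \<phi>
  show "T \<phi> = 0 \<phi>"
  proof (cases "\<phi> \<in> schwartz")
    case True
    have s: "(\<lambda>y. \<phi> (r *\<^sub>R y)) \<in> schwartz" using schwartz_affine[OF True, of r 0] r by simp
    have "affine_comp r 0 T (\<lambda>y. \<phi> (r *\<^sub>R y)) = T \<phi> / of_real (r ^ 3)"
      using s r by (simp add: affine_comp_def on_schwartz_def)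
    then show ?thesis using z r by simp
  next
    case False
    then show ?thesis using fun_cong[OF tempered_on_schwartz[OF T], of \<phi>] by (simp add: on_schwartz_def)
  qed
qed

lemma affine_comp_1:
  assumes "T \<in> tempered"
  shows "affine_comp 1 0 T = T"
  using tempered_on_schwartz[OF assms] by (simp add: affine_comp_def)

lemma affine_comp_diff: "affine_comp r a (S - T) = affine_comp r a S - affine_comp r a T"
  by (auto simp: affine_comp_def on_schwartz_def diff_divide_distrib)

lemma affine_comp_0: "affine_comp r a 0 = 0"
  by (auto simp: affine_comp_def on_schwartz_def)

lemma path_spaceI:
  assumes F: "banach_distributions F N"
    and "\<And>t. t \<le> 0 \<Longrightarrow> u t = 0" "\<And>t. t > 0 \<Longrightarrow> u t \<in> F"
    and "\<And>t e. t > 0 \<Longrightarrow> e > 0 \<Longrightarrow> \<exists>d>0. \<forall>s>0. \<bar>s - t\<bar> < d \<longrightarrow> N (u t - u s) < e"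
    and "\<And>t. t > 0 \<Longrightarrow> scaled_norm N t (u t) \<le> C"
  shows "u \<in> path_space F N"
  unfolding path_space_def continuous_map_norm_topology_iff[OF banach_Metric_space[OF F]]
  using assms(2-5) by (auto intro!: bdd_aboveI[of _ C])

lemma path_spaceD:
  assumes F: "banach_distributions F N" and u: "u \<in> path_space F N"
  shows "\<And>t. t \<le> 0 \<Longrightarrow> u t = 0" "\<And>t. t > 0 \<Longrightarrow> u t \<in> F"
    and "\<And>t e. t > 0 \<Longrightarrow> e > 0 \<Longrightarrow> \<exists>d>0. \<forall>s>0. \<bar>s - t\<bar> < d \<longrightarrow> N (u t - u s) < e"
    and "\<And>t. t > 0 \<Longrightarrow> scaled_norm N t (u t) \<le> path_norm N u"
proof -
  note * = u[unfolded path_space_def continuous_map_norm_topology_iff[OF banach_Metric_space[OF F]]]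
  show "\<And>t. t \<le> 0 \<Longrightarrow> u t = 0" "\<And>t. t > 0 \<Longrightarrow> u t \<in> F"
    "\<And>t e. t > 0 \<Longrightarrow> e > 0 \<Longrightarrow> \<exists>d>0. \<forall>s>0. \<bar>s - t\<bar> < d \<longrightarrow> N (u t - u s) < e"
    using * by blast+
  show "scaled_norm N t (u t) \<le> path_norm N u" if "t > 0" for t
    unfolding path_norm_def using * that by (intro cSUP_upper) auto
qed

lemma path_norm_le: "(\<And>t. t > 0 \<Longrightarrow> scaled_norm N t (u t) \<le> C) \<Longrightarrow> path_norm N u \<le> C"
  unfolding path_norm_def by (rule cSUP_least) auto

context
  fixes F N
  assumes F: "banach_distributions F N"
    and inv: "\<And>f r. f \<in> F \<Longrightarrow> r > 0 \<Longrightarrow> affine_comp r 0 f \<in> F"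
begin

lemma scaled_norm_nonneg: "f \<in> F \<Longrightarrow> t > 0 \<Longrightarrow> scaled_norm N t f \<ge> 0"
  unfolding scaled_norm_def by (intro mult_nonneg_nonneg banach_norm_nonneg[OF F] inv) auto

lemma scaled_norm_minus_commute:
  "f \<in> F \<Longrightarrow> g \<in> F \<Longrightarrow> t > 0 \<Longrightarrow> scaled_norm N t (f - g) = scaled_norm N t (g - f)"
  unfolding scaled_norm_def affine_comp_diff by (simp add: banach_norm_minus_commute[OF F inv inv])

lemma scaled_norm_triangle:
  "f \<in> F \<Longrightarrow> g \<in> F \<Longrightarrow> h \<in> F \<Longrightarrow> t > 0 \<Longrightarrow>
    scaled_norm N t (f - h) \<le> scaled_norm N t (f - g) + scaled_norm N t (g - h)"
  unfolding scaled_norm_def affine_comp_diff distrib_left[symmetric]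
  by (intro mult_left_mono banach_norm_triangle[OF F] inv) auto

lemma scaled_norm_eq_0:
  assumes "f \<in> F" "t > 0" "scaled_norm N t f = 0"
  shows "f = 0"
proof -
  have "affine_comp (sqrt t) 0 f = 0"
    using assms inv[of f "sqrt t"] banach_norm_eq_0[OF F] by (simp add: scaled_norm_def)
  then show ?thesis using affine_comp_eq_0[of f "sqrt t"] assms banach_tempered[OF F] by auto
qed

lemma zero_path_space: "0 \<in> path_space F N"
proof -
  have "N 0 = 0" using banach_norm_eq_0[OF F banach_zero[OF F]] by simp
  then show ?thesis
    by (intro path_spaceI[OF F, of _ 0])
       (auto simp: banach_zero[OF F] scaled_norm_def affine_comp_0 intro: exI[of _ 1])
qed

lemma path_space_diff:
  assumes u: "u \<in> path_space F N" and v: "v \<in> path_space F N"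
  shows "u - v \<in> path_space F N"
proof (rule path_spaceI[OF F])
  note uD = path_spaceD[OF F u] and vD = path_spaceD[OF F v]
  show "(u - v) t = 0" if "t \<le> 0" for t using uD(1) vD(1) that by simp
  show "(u - v) t \<in> F" if "t > 0" for t using uD(2) vD(2) that by (simp add: banach_diff[OF F])
  show "scaled_norm N t ((u - v) t) \<le> path_norm N u + path_norm N v" if t: "t > 0" for t
  proof -
    have "scaled_norm N t (u t - v t) \<le> scaled_norm N t (u t - 0) + scaled_norm N t (0 - v t)"
      by (intro scaled_norm_triangle uD vD banach_zero[OF F] t)
    also have "scaled_norm N t (0 - v t) = scaled_norm N t (v t - 0)"
      by (intro scaled_norm_minus_commute vD banach_zero[OF F] t)
    finally show ?thesis using uD(4)[OF t] vD(4)[OF t] unfolding minus_apply[of u v t] diff_0_right by linarith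
  qed
  show "\<exists>d>0. \<forall>s>0. \<bar>s - t\<bar> < d \<longrightarrow> N ((u - v) t - (u - v) s) < e" if t: "t > 0" "e > 0" for t e
  proof -
    obtain d1 where d1: "d1 > 0" "\<And>s. s > 0 \<Longrightarrow> \<bar>s - t\<bar> < d1 \<Longrightarrow> N (u t - u s) < e / 2" using uD(3)[OF t(1), of "e/2"] t(2) by auto
    obtain d2 where d2: "d2 > 0" "\<And>s. s > 0 \<Longrightarrow> \<bar>s - t\<bar> < d2 \<Longrightarrow> N (v t - v s) < e / 2" using vD(3)[OF t(1), of "e/2"] t(2) by auto
    show ?thesis
    proof (intro exI[of _ "min d1 d2"] conjI allI impI)
      fix s assume s: "s > 0" "\<bar>s - t\<bar> < min d1 d2"
      have eq: "(u - v) t - (u - v) s = (u t - u s) + - (v t - v s)" by (simp add: algebra_simps)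
      have "u t - u s \<in> F" "- (v t - v s) \<in> F"
        by (intro banach_diff[OF F] banach_uminus[OF F] uD vD s t)+
      then have "N ((u - v) t - (u - v) s) \<le> N (u t - u s) + N (- (v t - v s))"
        unfolding eq by (rule banach_norm_add[OF F])
      also have "N (- (v t - v s)) = N (v t - v s)"
        by (intro banach_norm_minus[OF F] banach_diff[OF F] vD s t)
      finally have "N ((u - v) t - (u - v) s) \<le> N (u t - u s) + N (v t - v s)" .
      moreover have "N (u t - u s) < e / 2" "N (v t - v s) < e / 2" using d1(2) d2(2) s by simp_all
      ultimately show "N ((u - v) t - (u - v) s) < e" by linarith
    qed (use d1 d2 in simp)
  qed
qed

lemma path_norm_nonneg:
  assumes u: "u \<in> path_space F N"
  shows "0 \<le> path_norm N u"
  using scaled_norm_nonneg[OF path_spaceD(2)[OF F u zero_less_one] zero_less_one] path_spaceD(4)[OF F u zero_less_one]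
  by (rule order_trans)

text \<open>The topology in \<open>property_P3\<close> can be described by balls once the metric
  axioms are known. Definiteness combines injectivity of dilations for t > 0 with the convention
  that paths vanish for t \<le> 0.\<close>

lemma path_Metric_space: "Metric_space (path_space F N) (norm_dist (path_space F N) (path_norm N))"
proof (rule Metric_space_norm_dist)
  fix u v assume u: "u \<in> path_space F N" and v: "v \<in> path_space F N"
  note uD = path_spaceD[OF F u] and vD = path_spaceD[OF F v]
  note dD = path_spaceD[OF F path_space_diff[OF u v]]
  show "0 \<le> path_norm N (u - v)" by (rule path_norm_nonneg[OF path_space_diff[OF u v]])
  show "path_norm N (u - v) = path_norm N (v - u)"
    unfolding path_norm_def by (intro SUP_cong refl) (simp add: scaled_norm_minus_commute uD vD)
  show "path_norm N (u - v) = 0 \<longleftrightarrow> u = v"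
  proof
    assume z: "path_norm N (u - v) = 0"
    show "u = v"
    proof
      fix t show "u t = v t"
      proof (cases "t > 0")
        case True
        then have "scaled_norm N t ((u - v) t) = 0"
          using dD(4)[OF True] scaled_norm_nonneg[OF dD(2)[OF True] True] z by simp
        then have "(u - v) t = 0" by (rule scaled_norm_eq_0[OF dD(2)[OF True] True])
        then show ?thesis by simp
      qed (simp add: uD(1) vD(1))
    qed
  next
    assume "u = v"
    then show "path_norm N (u - v) = 0"
      by (simp add: path_norm_def scaled_norm_def affine_comp_0 banach_norm_eq_0[OF F banach_zero[OF F], THEN iffD2])
  qed
  fix w assume w: "w \<in> path_space F N"
  note wD = path_spaceD[OF F w]
  show "path_norm N (u - w) \<le> path_norm N (u - v) + path_norm N (v - w)"
  proof (rule path_norm_le)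
    fix t :: real assume t: "t > 0"
    have "scaled_norm N t (u t - w t) \<le> scaled_norm N t (u t - v t) + scaled_norm N t (v t - w t)"
      by (intro scaled_norm_triangle uD vD wD t)
    then show "scaled_norm N t ((u - w) t) \<le> path_norm N (u - v) + path_norm N (v - w)"
      using dD(4)[OF t] path_spaceD(4)[OF F path_space_diff[OF v w] t] by simp
  qed
qed

text \<open>Continuity at (0,0): a product of two balls is mapped within path distance 1 of B(0,0).
  At time 1 the scaled norm is the norm of F itself, so 1 + N(B(0,0)(1)) serves as the
  bound.\<close>

lemma bilinear_path_bound:
  assumes B: "continuous_map (prod_topology (norm_topology (path_space F N) (path_norm N)) (norm_topology (path_space F N) (path_norm N)))
      (norm_topology (path_space F N) (path_norm N)) (\<lambda>(u, v). B u v)"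
  shows "\<exists>d>0. \<exists>C. \<forall>u\<in>path_space F N. \<forall>v\<in>path_space F N. path_norm N u < d \<longrightarrow> path_norm N v < d \<longrightarrow>
      B u v 1 \<in> F \<and> N (B u v 1) \<le> C"
proof -
  let ?X = "path_space F N" and ?d = "norm_dist (path_space F N) (path_norm N)"
  note M = path_Metric_space
  have z: "(0, 0) \<in> topspace (prod_topology (norm_topology ?X (path_norm N)) (norm_topology ?X (path_norm N)))"
    using zero_path_space by (simp add: Metric_space.topspace_mtopology[OF M])
  then obtain U where U: "openin (prod_topology (norm_topology ?X (path_norm N)) (norm_topology ?X (path_norm N))) U" "(0, 0) \<in> U"
      "\<forall>y\<in>U. (case y of (u, v) \<Rightarrow> B u v) \<in> Metric_space.mball ?X ?d (B 0 0) 1"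
    using B[unfolded Metric_space.continuous_map_to_metric[OF M], rule_format, OF z, of 1] by auto
  then obtain U1 U2 where U12: "openin (norm_topology ?X (path_norm N)) U1" "openin (norm_topology ?X (path_norm N)) U2"
      "0 \<in> U1" "0 \<in> U2" "U1 \<times> U2 \<subseteq> U"
    using U(1)[unfolded openin_prod_topology_alt, rule_format, OF U(2)] by auto
  obtain d1 where d1: "d1 > 0" "Metric_space.mball ?X ?d 0 d1 \<subseteq> U1" using U12 unfolding Metric_space.openin_mtopology[OF M] by blast
  obtain d2 where d2: "d2 > 0" "Metric_space.mball ?X ?d 0 d2 \<subseteq> U2" using U12 unfolding Metric_space.openin_mtopology[OF M] by blast
  have ball: "u \<in> Metric_space.mball ?X ?d 0 d" if "u \<in> ?X" "path_norm N u < d" for u d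
  proof -
    have "path_norm N (0 - u) = path_norm N (u - 0)"
      using Metric_space.commute[OF M, of 0 u] that zero_path_space by (simp add: norm_dist_def)
    then show ?thesis using that zero_path_space by (simp add: Metric_space.in_mball[OF M] norm_dist_def)
  qed
  show ?thesis
  proof (rule exI[of _ "min d1 d2"], intro conjI exI[of _ "1 + N (B 0 0 1)"] ballI impI)
    fix u v assume uv: "u \<in> ?X" "v \<in> ?X" "path_norm N u < min d1 d2" "path_norm N v < min d1 d2"
    then have "(u, v) \<in> U" using ball[of u d1] ball[of v d2] d1 d2 U12(5) by auto
    then have Buv: "B u v \<in> ?X" and B0: "B 0 0 \<in> ?X" and lt: "path_norm N (B 0 0 - B u v) < 1"
      using U(3) by (auto simp: Metric_space.in_mball[OF M] norm_dist_def)
    show F1: "B u v 1 \<in> F" using path_spaceD(2)[OF F Buv, of 1] by simp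
    have F0: "B 0 0 1 \<in> F" using path_spaceD(2)[OF F B0, of 1] by simp
    have "scaled_norm N 1 ((B 0 0 - B u v) 1) < 1"
      using path_spaceD(4)[OF F path_space_diff[OF B0 Buv], of 1] lt by simp
    moreover have "B 0 0 1 - B u v 1 \<in> tempered" using banach_diff[OF F F0 F1] banach_tempered[OF F] by blast
    ultimately have "N (B 0 0 1 - B u v 1) < 1" by (simp add: scaled_norm_def affine_comp_1)
    then have "N (B u v 1 - B 0 0 1) < 1" using banach_norm_minus_commute[OF F F0 F1] by simp
    moreover have "N (B u v 1) \<le> N (B u v 1 - B 0 0 1) + N (B 0 0 1)"
      using banach_norm_add[OF F banach_diff[OF F F1 F0] F0] by simp
    ultimately show "N (B u v 1) \<le> 1 + N (B 0 0 1)" by simp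
  qed (use d1 d2 in simp)
qed

end

subsection \<open>The bilinear operator on trigonometric polynomials\<close>

lemma tendsto_tdist_eval: "(f \<longlongrightarrow> (T::tdist)) G \<Longrightarrow> ((\<lambda>x. f x \<phi>) \<longlongrightarrow> T \<phi>) G"
  by (rule continuous_on_tendsto_compose[OF tdist_eval_continuous[of UNIV]]) auto

lemma tdist_tendsto_unique:
  assumes "G \<noteq> bot" "(f \<longlongrightarrow> (S::tdist)) G" "(f \<longlongrightarrow> T) G"
  shows "S = T"
  by (rule ext, rule tendsto_unique[OF assms(1) tendsto_tdist_eval tendsto_tdist_eval]) (use assms in auto)

lemma has_product_unique: "has_product \<phi>0 f g h \<Longrightarrow> has_product \<phi>0 f g h' \<Longrightarrow> h = h'"
  unfolding has_product_def by (rule tdist_tendsto_unique[of at_top]) auto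

lemma has_heat_P_unique: "has_heat_P \<phi>0 P s g h \<Longrightarrow> has_heat_P \<phi>0 P s g h' \<Longrightarrow> h = h'"
  unfolding has_heat_P_def by (rule tdist_tendsto_unique[of at_bot]) auto

text \<open>\<open>bilinear\<close> is a definite description, so its value can be used only after
  uniqueness. Product and operator value are unique as limits in a Hausdorff topology, and then the
  integrands agree at every time in the open interval.\<close>

lemma has_bilinear_unique:
  assumes "has_bilinear \<phi>0 P u v t w" "has_bilinear \<phi>0 P u v t w'"
  shows "w = w'"
proof -
  obtain g h where 1: "\<And>\<tau>. \<tau> \<in> {0<..<t} \<Longrightarrow> has_product \<phi>0 (u \<tau>) (v \<tau>) (g \<tau>)"
      "\<And>\<tau>. \<tau> \<in> {0<..<t} \<Longrightarrow> has_heat_P \<phi>0 P (t - \<tau>) (g \<tau>) (h \<tau>)"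
      "\<And>\<phi>. \<phi> \<in> schwartz \<Longrightarrow> w \<phi> = (LINT \<tau>:{0<..<t}|lborel. h \<tau> \<phi>)"
    using assms(1) unfolding has_bilinear_def by blast
  obtain g' h' where 2: "\<And>\<tau>. \<tau> \<in> {0<..<t} \<Longrightarrow> has_product \<phi>0 (u \<tau>) (v \<tau>) (g' \<tau>)"
      "\<And>\<tau>. \<tau> \<in> {0<..<t} \<Longrightarrow> has_heat_P \<phi>0 P (t - \<tau>) (g' \<tau>) (h' \<tau>)"
      "\<And>\<phi>. \<phi> \<in> schwartz \<Longrightarrow> w' \<phi> = (LINT \<tau>:{0<..<t}|lborel. h' \<tau> \<phi>)"
    using assms(2) unfolding has_bilinear_def by blast
  have h: "h \<tau> = h' \<tau>" if "\<tau> \<in> {0<..<t}" for \<tau>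
    using has_product_unique[OF 1(1) 2(1), OF that that] has_heat_P_unique 1(2)[OF that] 2(2)[OF that] by metis
  show ?thesis
  proof
    fix \<phi> show "w \<phi> = w' \<phi>"
    proof (cases "\<phi> \<in> schwartz")
      case True
      then show ?thesis unfolding 1(3)[OF True] 2(3)[OF True]
        by (intro set_lebesgue_integral_cong) (auto simp: h)
    next
      case False
      have "w = on_schwartz w" "w' = on_schwartz w'"
        using assms tempered_on_schwartz unfolding has_bilinear_def by blast+
      then show ?thesis using False by (metis on_schwartz_def)
    qed
  qed
qed

lemma has_bilinear_bilinear:
  assumes "\<exists>w. has_bilinear \<phi>0 P u v t w" "t > 0"
  shows "has_bilinear \<phi>0 P u v t (bilinear \<phi>0 P u v t)"
proof -
  have "\<exists>!w. has_bilinear \<phi>0 P u v t w" using assms(1) has_bilinear_unique by blast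
  from theI'[OF this] show ?thesis using assms(2) by (simp add: bilinear_def)
qed

lemma trig_fun_mult:
  "trig_fun A c \<xi> x * trig_fun B d \<zeta> x = trig_fun (A \<times> B) (\<lambda>(a, b). c a * d b) (\<lambda>(a, b). \<xi> a + \<zeta> b) x"
  unfolding trig_fun_def sum_product sum.cartesian_product
  by (intro sum.cong refl) (auto simp: inner_add_right exp_add distrib_left)

text \<open>For large j the cutoff is 1 at all of the finitely many frequencies, so the
  approximating sequence is eventually constant.\<close>

lemma has_product_trig:
  assumes lp: "lp_cutoff \<phi>0" and fin: "finite A" "finite B"
    and h: "has_product \<phi>0 (trig A c \<xi>) (trig B d \<zeta>) h"
  shows "h = trig (A \<times> B) (\<lambda>(a, b). c a * d b) (\<lambda>(a, b). \<xi> a + \<zeta> b)"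
proof -
  have "\<forall>\<^sub>F j in at_top. \<forall>a\<in>A. 4 powi (- j) * (norm (\<xi> a))\<^sup>2 \<le> 1/4"
    using fin by (intro eventually_ball_finite ballI eventually_4_powi_le) auto
  moreover have "\<forall>\<^sub>F j in at_top. \<forall>b\<in>B. 4 powi (- j) * (norm (\<zeta> b))\<^sup>2 \<le> 1/4"
    using fin by (intro eventually_ball_finite ballI eventually_4_powi_le) auto
  ultimately have "\<forall>\<^sub>F j in at_top. regular (\<lambda>x. S_fun \<phi>0 j (trig A c \<xi>) x * S_fun \<phi>0 j (trig B d \<zeta>) x)
      = trig (A \<times> B) (\<lambda>(a, b). c a * d b) (\<lambda>(a, b). \<xi> a + \<zeta> b)"
  proof eventually_elim
    case (elim j)
    have "trig_fun A (\<lambda>a. c a * S_symbol \<phi>0 j (\<xi> a)) \<xi> = trig_fun A c \<xi>"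
      unfolding trig_fun_def[abs_def] using elim by (intro ext sum.cong refl) (simp add: S_symbol_eq_1[OF lp])
    moreover have "trig_fun B (\<lambda>a. d a * S_symbol \<phi>0 j (\<zeta> a)) \<zeta> = trig_fun B d \<zeta>"
      unfolding trig_fun_def[abs_def] using elim by (intro ext sum.cong refl) (simp add: S_symbol_eq_1[OF lp])
    ultimately show ?case unfolding S_fun_trig[OF lp] unfolding trig_def by (simp only: trig_fun_mult)
  qed
  from tendsto_eventually[OF this] show ?thesis
    using h unfolding has_product_def by (intro tdist_tendsto_unique[of at_top]) auto
qed

text \<open>A test function whose Fourier transform is a bump around \<open>- \<eta>\<close>: it sees the frequency \<open>\<eta>\<close> only.\<close>

definition bump :: "(real \<Rightarrow> real) \<Rightarrow> space \<Rightarrow> space \<Rightarrow> complex" where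
  "bump \<phi>0 \<eta> x = of_real (\<phi>0 (4 / (norm \<eta>)\<^sup>2 * (norm (x + \<eta>))\<^sup>2))"

lemma bump_schwartz:
  assumes "lp_cutoff \<phi>0" "\<eta> \<noteq> 0"
  shows "bump \<phi>0 \<eta> \<in> schwartz"
proof -
  have "4 / (norm \<eta>)\<^sup>2 > 0" using assms by simp
  from schwartz_affine[OF schwartz_cutoff[OF assms(1) this], of 1 \<eta>] show ?thesis by (simp add: bump_def[abs_def])
qed

text \<open>The factor 4 / |\<eta>|^2 makes the argument of the cutoff exceed 1 exactly beyond
  distance |\<eta>|/2 from -\<eta>; the remaining ball avoids the origin.\<close>

lemma bump_eq_0:
  assumes "lp_cutoff \<phi>0" "\<eta> \<noteq> 0" "norm (x + \<eta>) > norm \<eta> / 2"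
  shows "bump \<phi>0 \<eta> x = 0"
proof -
  have "(norm \<eta> / 2)\<^sup>2 < (norm (x + \<eta>))\<^sup>2" using assms by (intro power_strict_mono) auto
  then have "4 / (norm \<eta>)\<^sup>2 * (norm (x + \<eta>))\<^sup>2 > 1" using assms(2) by (simp add: field_simps)
  then show ?thesis using assms(1) by (simp add: bump_def lp_cutoff_def)
qed

lemma bump_eq_1: "lp_cutoff \<phi>0 \<Longrightarrow> bump \<phi>0 \<eta> (- \<eta>) = 1"
  by (simp add: bump_def lp_cutoff_def)

text \<open>The bump hides the singularity of P at 0. Localisation is done after the reflection
  \<zeta> to -\<zeta>, where P appears unreflected and the bump surrounds \<eta>.\<close>

lemma symbol_mult_bump_schwartz:
  assumes lp: "lp_cutoff \<phi>0" and P: "smooth_on (- {0}) P" and \<eta>: "\<eta> \<noteq> 0"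
  shows "(\<lambda>\<zeta>. P (- \<zeta>) * bump \<phi>0 \<eta> \<zeta>) \<in> schwartz"
proof -
  have "(\<lambda>\<zeta>. P \<zeta> * bump \<phi>0 \<eta> (- \<zeta>)) \<in> schwartz"
  proof (rule schwartz_smooth_mult[OF P])
    show "compact (cball \<eta> (norm \<eta> / 2))" by simp
    show "cball \<eta> (norm \<eta> / 2) \<subseteq> - {0}" using \<eta> by (auto simp: dist_norm)
    show "(\<lambda>\<zeta>. bump \<phi>0 \<eta> (- \<zeta>)) \<in> schwartz"
      using schwartz_affine[OF bump_schwartz[OF lp \<eta>], of "- 1" 0] by simp
    show "bump \<phi>0 \<eta> (- \<zeta>) = 0" if "\<zeta> \<notin> cball \<eta> (norm \<eta> / 2)" for \<zeta>
      by (rule bump_eq_0[OF lp \<eta>]) (use that in \<open>simp add: dist_norm\<close>)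
  qed
  from schwartz_affine[OF this, of "- 1" 0] show ?thesis by simp
qed

text \<open>On the support of the bump |\<zeta>| is at least |\<eta>|/2, so for very negative j the
  factor 1 - S_j equals 1 there. The approximations tested against this function are then eventually
  constant, and the multiplier acts diagonally.\<close>

lemma has_heat_P_trig:
  assumes lp: "lp_cutoff \<phi>0" and P: "smooth_on (- {0}) P" and \<eta>: "\<eta> \<noteq> 0" and s: "s > 0"
    and h: "has_heat_P \<phi>0 P s (trig A c \<xi>) h"
  shows "h (inv_fourier (bump \<phi>0 \<eta>)) = (\<Sum>a\<in>A. c a * (of_real (exp (- s * (norm (\<xi> a))\<^sup>2)) * P (\<xi> a) * bump \<phi>0 \<eta> (- \<xi> a)))"
proof -
  let ?\<phi> = "inv_fourier (bump \<phi>0 \<eta>)"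
  let ?m = "\<lambda>j \<xi>. (1 - S_symbol \<phi>0 j \<xi>) * of_real (exp (- s * (norm \<xi>)\<^sup>2)) * P \<xi>"
  have \<phi>: "?\<phi> \<in> schwartz" by (intro inv_fourier_schwartz bump_schwartz lp \<eta>)
  have F\<phi>: "fourier ?\<phi> = bump \<phi>0 \<eta>" by (intro fourier_inv_fourier bump_schwartz lp \<eta>)
  have "\<forall>\<^sub>F j in at_bot. 4 powi (- j) * ((norm \<eta> / 2)\<^sup>2) > 1"
    using \<eta> by (intro eventually_4_powi_gt) simp
  then have "\<forall>\<^sub>F j in at_bot. mult_op (?m j) (trig A c \<xi>) ?\<phi>
      = (\<Sum>a\<in>A. c a * (of_real (exp (- s * (norm (\<xi> a))\<^sup>2)) * P (\<xi> a) * bump \<phi>0 \<eta> (- \<xi> a)))"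
  proof eventually_elim
    case (elim j)
    have eq: "?m j (- \<zeta>) * bump \<phi>0 \<eta> \<zeta> = of_real (exp (- s * (norm \<zeta>)\<^sup>2)) * (P (- \<zeta>) * bump \<phi>0 \<eta> \<zeta>)" for \<zeta>
    proof (cases "norm (\<zeta> + \<eta>) > norm \<eta> / 2")
      case True
      then show ?thesis by (simp add: bump_eq_0[OF lp \<eta>])
    next
      case False
      have "norm \<eta> \<le> norm (\<zeta> + \<eta>) + norm \<zeta>" using norm_triangle_ineq4[of "\<zeta> + \<eta>" \<zeta>] by simp
      then have "norm \<eta> / 2 \<le> norm \<zeta>" using False by simp
      then have "(norm \<eta> / 2)\<^sup>2 \<le> (norm \<zeta>)\<^sup>2" by (intro power_mono) auto
      then have "4 powi (- j) * (norm \<eta> / 2)\<^sup>2 \<le> 4 powi (- j) * (norm \<zeta>)\<^sup>2" by (intro mult_left_mono) auto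
      then have "S_symbol \<phi>0 j \<zeta> = 0" by (intro S_symbol_eq_0[OF lp] less_le_trans[OF elim])
      then show ?thesis by simp
    qed
    have "(\<lambda>\<zeta>. ?m j (- \<zeta>) * fourier ?\<phi> \<zeta>) \<in> schwartz"
      unfolding F\<phi> eq by (intro schwartz_mult schwartz_gaussian s symbol_mult_bump_schwartz lp P \<eta>)
    note m = mult_op_trig_apply[OF \<phi> this, of A c \<xi>]
    have eq': "?m j \<zeta> * bump \<phi>0 \<eta> (- \<zeta>) = of_real (exp (- s * (norm \<zeta>)\<^sup>2)) * P \<zeta> * bump \<phi>0 \<eta> (- \<zeta>)" for \<zeta>
      using eq[of "- \<zeta>"] by (simp only: minus_minus norm_minus_cancel mult.assoc)
    show ?case using m unfolding F\<phi> eq' .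
  qed
  then have "((\<lambda>j. mult_op (?m j) (trig A c \<xi>) ?\<phi>) \<longlongrightarrow> (\<Sum>a\<in>A. c a * (of_real (exp (- s * (norm (\<xi> a))\<^sup>2)) * P (\<xi> a) * bump \<phi>0 \<eta> (- \<xi> a)))) at_bot"
    by (rule tendsto_eventually)
  moreover have "((\<lambda>j. mult_op (?m j) (trig A c \<xi>) ?\<phi>) \<longlongrightarrow> h ?\<phi>) at_bot"
    using h unfolding has_heat_P_def by (intro tendsto_tdist_eval) blast
  ultimately show ?thesis by (intro tendsto_unique[of at_bot]) auto
qed

text \<open>The contribution of one scale, with k = 4^j in mind. On ]0,1/k[ the exponent is at least
  -9 R: 8 R for \<tau> a, because \<tau> k < 1, and R for the second term. The length 1/k cancels
  the factor k, so the bound is the same at every scale; this is the logarithmic divergence.\<close>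

lemma exp_interpolation_integral:
  fixes k a R :: real
  assumes k: "k \<ge> 1" and a: "0 \<le> a" "a \<le> 8 * k * R" and R: "R \<ge> 0"
  shows "set_integrable lborel {0<..<1} (\<lambda>\<tau>. k * exp (- \<tau> * a - (1 - \<tau>) * R))"
    and "exp (- 9 * R) \<le> (LINT \<tau>:{0<..<1}|lborel. k * exp (- \<tau> * a - (1 - \<tau>) * R))"
proof -
  have "set_integrable lborel {0..1} (\<lambda>\<tau>. k * exp (- \<tau> * a - (1 - \<tau>) * R))"
    unfolding set_integrable_def by (intro borel_integrable_compact continuous_intros) simp
  then show I: "set_integrable lborel {0<..<1} (\<lambda>\<tau>. k * exp (- \<tau> * a - (1 - \<tau>) * R))"
    by (rule set_integrable_subset) auto
  have ind: "integrable lborel (indicat_real {0<..<1/k})"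
    using k by (intro integrable_real_indicator) auto
  have "exp (- 9 * R) = (LINT \<tau>:{0<..<1/k}|lborel. k * exp (- 9 * R))"
    using k by (simp add: set_lebesgue_integral_def)
  also have "\<dots> \<le> (LINT \<tau>:{0<..<1}|lborel. k * exp (- \<tau> * a - (1 - \<tau>) * R))"
    unfolding set_lebesgue_integral_def
  proof (rule Bochner_Integration.integral_mono)
    show "integrable lborel (\<lambda>\<tau>. indicat_real {0<..<1/k} \<tau> *\<^sub>R (k * exp (- 9 * R)))"
      unfolding real_scaleR_def by (intro Bochner_Integration.integrable_mult_left ind)
    show "integrable lborel (\<lambda>\<tau>. indicat_real {0<..<1} \<tau> *\<^sub>R (k * exp (- \<tau> * a - (1 - \<tau>) * R)))"
      using I unfolding set_integrable_def .
    fix \<tau> :: real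
    show "indicat_real {0<..<1/k} \<tau> *\<^sub>R (k * exp (- 9 * R)) \<le> indicat_real {0<..<1} \<tau> *\<^sub>R (k * exp (- \<tau> * a - (1 - \<tau>) * R))"
    proof (cases "\<tau> \<in> {0<..<1/k}")
      case True
      then have \<tau>: "0 < \<tau>" "\<tau> * k < 1" using k by (auto simp: pos_less_divide_eq)
      have "\<tau> \<le> \<tau> * k" using \<tau> k by (simp add: mult_le_cancel_left1)
      then have \<tau>1: "\<tau> < 1" using \<tau>(2) by (rule le_less_trans)
      have "\<tau> * a \<le> \<tau> * (8 * k * R)" using a \<tau> by (intro mult_left_mono) auto
      also have "\<dots> = (\<tau> * k) * (8 * R)" by simp
      also have "\<dots> \<le> 1 * (8 * R)" using \<tau> R by (intro mult_right_mono) auto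
      finally have "\<tau> * a \<le> 8 * R" by simp
      moreover have "(1 - \<tau>) * R \<le> 1 * R" using \<tau> R by (intro mult_right_mono) auto
      ultimately have "- 9 * R \<le> - \<tau> * a - (1 - \<tau>) * R" by simp
      then show ?thesis using True \<tau> \<tau>1 k by simp
    next
      case False
      then show ?thesis using k by (auto simp: indicator_def)
    qed
  qed
  finally show "exp (- 9 * R) \<le> (LINT \<tau>:{0<..<1}|lborel. k * exp (- \<tau> * a - (1 - \<tau>) * R))" .
qed


subsection \<open>Lacunary heat flows\<close>

text \<open>The heat flow of e times the sum of 2^j exp(i x.\<theta>_j), in closed form. The value 0
  for t \<le> 0 is the convention of \<open>path_space\<close>.\<close>

definition lacunary_flow :: "nat \<Rightarrow> real \<Rightarrow> (nat \<Rightarrow> space) \<Rightarrow> real \<Rightarrow> tdist" where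
  "lacunary_flow n e \<theta> t = (if t > 0 then trig {..<n} (\<lambda>j. of_real (e * 2 ^ j * exp (- t * (norm (\<theta> j))\<^sup>2))) \<theta> else 0)"

lemma heat_cscale: "heat t (cscale c f) = cscale c (heat t f)"
  by (auto simp: heat_def mult_op_def cscale_def on_schwartz_def)

text \<open>Reduces the continuity of a flow in F to that of finitely many scalar
  coefficients.\<close>

lemma norm_trig_le:
  assumes F: "banach_distributions F N" and A: "finite A"
    and mem: "\<And>B c. finite B \<Longrightarrow> B \<subseteq> A \<Longrightarrow> trig B c \<theta> \<in> F"
  shows "N (trig A c \<theta>) \<le> (\<Sum>a\<in>A. norm (c a) * N (trig {a} (\<lambda>_. 1) \<theta>))"
  using A mem
proof (induction A rule: finite_induct)
  case empty
  have "trig {} c \<theta> = 0" by (rule trig_eq_0) simp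
  moreover have "N 0 = 0" using banach_norm_eq_0[OF F banach_zero[OF F]] by blast
  ultimately show ?case by (simp only: sum.empty order_refl)
next
  case (insert a A)
  have 1: "trig {a} (\<lambda>_. 1) \<theta> \<in> F" and 2: "trig A c \<theta> \<in> F" using insert.prems insert.hyps by auto
  have "N (trig (insert a A) c \<theta>) \<le> N (cscale (c a) (trig {a} (\<lambda>_. 1) \<theta>)) + N (trig A c \<theta>)"
    unfolding trig_insert[OF insert.hyps] by (intro banach_norm_add[OF F] banach_cscale[OF F] 1 2)
  also have "\<dots> \<le> norm (c a) * N (trig {a} (\<lambda>_. 1) \<theta>) + (\<Sum>a\<in>A. norm (c a) * N (trig {a} (\<lambda>_. 1) \<theta>))"
    using insert.IH insert.prems by (intro add_mono) (auto simp: banach_norm_cscale[OF F 1] subset_insertI2)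
  finally show ?case using insert.hyps by simp
qed

text \<open>The scaled norm at time t equals the norm in F of e^\<Delta> applied to a rescaled
  datum, whose Besov norm is bounded independently of t and n; the constant 4 is that of
  \<open>dyadic_gaussian_sum_le\<close>.\<close>

lemma lacunary_flow_path_space:
  assumes lp: "lp_cutoff \<phi>0" and F: "banach_distributions F N"
    and heat: "\<And>f. f \<in> besov \<phi>0 \<Longrightarrow> heat 1 f \<in> F"
    and C: "\<And>f. f \<in> besov \<phi>0 \<Longrightarrow> N (heat 1 f) \<le> C * besov_norm f" "C \<ge> 0"
    and e: "e \<ge> 0" and r: "r > 0" and \<theta>: "\<And>j. norm (\<theta> j) \<ge> 2 ^ j * r"
  shows "lacunary_flow n e \<theta> \<in> path_space F N"
    and "path_norm N (lacunary_flow n e \<theta>) \<le> C * (4 * e / r)"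
proof -
  have \<theta>0: "\<theta> j \<noteq> 0" for j
  proof
    assume "\<theta> j = 0"
    moreover have "0 < 2 ^ j * r" using r by simp
    ultimately show False using \<theta>[of j] by simp
  qed
  have mem: "trig A c \<theta> \<in> F" if "finite A" for A :: "nat set" and c
  proof -
    \<comment> \<open>Undoing the heat flow on finitely many modes: multiplying the coefficients by
      exp(|\<theta>_j|^2) gives a Besov element with the prescribed image.\<close>
    have "trig A c \<theta> = heat 1 (trig A (\<lambda>j. c j * of_real (exp ((norm (\<theta> j))\<^sup>2))) \<theta>)"
      unfolding heat_trig[OF zero_less_one] by (simp add: mult.assoc flip: of_real_mult exp_add)
    then show ?thesis using heat[OF trig_besov[OF lp that]] \<theta>0 by simp
  qed
  have sn: "scaled_norm N t (lacunary_flow n e \<theta> t) \<le> C * (4 * e / r)" if t: "t > 0" for t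
  proof -
    \<comment> \<open>The initial datum in the form sqrt t f(sqrt t x), the scaling that leaves the
      norm of E invariant.\<close>
    let ?f = "trig {..<n} (\<lambda>j. of_real (sqrt t * (e * 2 ^ j))) (\<lambda>j. sqrt t *\<^sub>R \<theta> j)"
    have fb: "?f \<in> besov \<phi>0" using t \<theta>0 by (intro trig_besov[OF lp]) auto
    have a: "affine_comp (sqrt t) 0 (lacunary_flow n e \<theta> t)
        = trig {..<n} (\<lambda>j. of_real (e * 2 ^ j * exp (- t * (norm (\<theta> j))\<^sup>2))) (\<lambda>j. sqrt t *\<^sub>R \<theta> j)"
      using t by (simp add: lacunary_flow_def affine_comp_trig)
    have h: "heat 1 ?f = cscale (of_real (sqrt t)) (affine_comp (sqrt t) 0 (lacunary_flow n e \<theta> t))"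
      unfolding a cscale_trig heat_trig[OF zero_less_one] using t
      by (simp add: power_mult_distrib ac_simps)
    have "cscale (of_real (1 / sqrt t)) (heat 1 ?f) = affine_comp (sqrt t) 0 (lacunary_flow n e \<theta> t)"
      unfolding h using t by (auto simp: cscale_def)
    then have "affine_comp (sqrt t) 0 (lacunary_flow n e \<theta> t) \<in> F"
      using banach_cscale[OF F heat[OF fb]] by metis
    then have "scaled_norm N t (lacunary_flow n e \<theta> t) = N (heat 1 ?f)"
      unfolding scaled_norm_def h using t by (simp add: banach_norm_cscale[OF F])
    also have "\<dots> \<le> C * besov_norm ?f" by (rule C(1)[OF fb])
    also have "besov_norm ?f \<le> 4 * e / r"
    proof (rule besov_norm_trig_le)
      fix s :: real assume s: "s > 0"
      \<comment> \<open>After the lower bound on the frequencies, s and t enter only through this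
        parabolic variable, which makes the bound uniform in both.\<close>
      define x where "x = sqrt (s * t) * r"
      have x: "x > 0" unfolding x_def using s t r by simp
      have "sqrt s * (\<Sum>j<n. norm (of_real (sqrt t * (e * 2 ^ j)) :: complex) * exp (- s * (norm (sqrt t *\<^sub>R \<theta> j))\<^sup>2))
          \<le> (\<Sum>j<n. e / r * (x * 2 ^ j * exp (- (x * 2 ^ j)\<^sup>2)))"
        unfolding sum_distrib_left
      proof (rule sum_mono)
        fix j
        have "(2 ^ j * r)\<^sup>2 \<le> (norm (\<theta> j))\<^sup>2" using \<theta>[of j] r by (intro power_mono) auto
        then have "s * t * (2 ^ j * r)\<^sup>2 \<le> s * t * (norm (\<theta> j))\<^sup>2" using s t by (intro mult_left_mono) auto
        moreover have "(x * 2 ^ j)\<^sup>2 = s * t * (2 ^ j * r)\<^sup>2" using s t by (simp add: x_def power_mult_distrib)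
        moreover have "s * (norm (sqrt t *\<^sub>R \<theta> j))\<^sup>2 = s * t * (norm (\<theta> j))\<^sup>2" using t by (simp add: power_mult_distrib)
        ultimately have "(x * 2 ^ j)\<^sup>2 \<le> s * (norm (sqrt t *\<^sub>R \<theta> j))\<^sup>2" by (simp only:)
        then have E: "exp (- s * (norm (sqrt t *\<^sub>R \<theta> j))\<^sup>2) \<le> exp (- (x * 2 ^ j)\<^sup>2)"
          by (simp only: exp_le_cancel_iff mult_minus_left neg_le_iff_le)
        have "sqrt s * (norm (of_real (sqrt t * (e * 2 ^ j)) :: complex) * exp (- s * (norm (sqrt t *\<^sub>R \<theta> j))\<^sup>2))
            = (e / r * (x * 2 ^ j)) * exp (- s * (norm (sqrt t *\<^sub>R \<theta> j))\<^sup>2)"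
          using s t e r by (simp add: x_def real_sqrt_mult norm_mult norm_power)
        also have "\<dots> \<le> (e / r * (x * 2 ^ j)) * exp (- (x * 2 ^ j)\<^sup>2)"
          using E e r x by (intro mult_left_mono) auto
        finally show "sqrt s * (norm (of_real (sqrt t * (e * 2 ^ j)) :: complex) * exp (- s * (norm (sqrt t *\<^sub>R \<theta> j))\<^sup>2))
            \<le> e / r * (x * 2 ^ j * exp (- (x * 2 ^ j)\<^sup>2))" by (simp only: mult.assoc)
      qed
      also have "\<dots> = e / r * (\<Sum>j<n. x * 2 ^ j * exp (- (x * 2 ^ j)\<^sup>2))" by (rule sum_distrib_left[symmetric])
      also have "\<dots> \<le> e / r * 4" using e r by (intro mult_left_mono dyadic_gaussian_sum_le x) auto
      finally show "sqrt s * (\<Sum>j<n. norm (of_real (sqrt t * (e * 2 ^ j)) :: complex) * exp (- s * (norm (sqrt t *\<^sub>R \<theta> j))\<^sup>2)) \<le> 4 * e / r"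
        by (simp add: mult.commute)
    qed (use e r in simp)
    finally show ?thesis using C(2) by (simp add: mult_left_mono)
  qed
  show "lacunary_flow n e \<theta> \<in> path_space F N"
  proof (rule path_spaceI[OF F _ _ _ sn])
    show "lacunary_flow n e \<theta> t = 0" if "t \<le> 0" for t using that by (simp add: lacunary_flow_def)
    show "lacunary_flow n e \<theta> t \<in> F" if "t > 0" for t using that mem by (simp add: lacunary_flow_def)
    fix t d :: real assume t: "t > 0" and d: "d > 0"
    \<comment> \<open>A scalar majorant of the increment: continuous in s and equal to 0 at s =
      t.\<close>
    define g where "g s = (\<Sum>j<n. norm (of_real (e * 2 ^ j * exp (- t * (norm (\<theta> j))\<^sup>2)) - of_real (e * 2 ^ j * exp (- s * (norm (\<theta> j))\<^sup>2)) :: complex)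
       * N (trig {j} (\<lambda>_. 1) \<theta>))" for s
    have "isCont g t" unfolding g_def by (intro continuous_intros)
    then have "(g \<longlongrightarrow> 0) (at t)" by (simp add: isCont_def) (simp add: g_def)
    then obtain b where b: "b > 0" "\<And>s. s \<noteq> t \<Longrightarrow> \<bar>s - t\<bar> < b \<Longrightarrow> \<bar>g s\<bar> < d"
      using d unfolding LIM_eq by (auto simp: real_norm_def)
    show "\<exists>b>0. \<forall>s>0. \<bar>s - t\<bar> < b \<longrightarrow> N (lacunary_flow n e \<theta> t - lacunary_flow n e \<theta> s) < d"
    proof (intro exI[of _ b] conjI b allI impI)
      fix s :: real assume s: "s > 0" "\<bar>s - t\<bar> < b"
      have "N (lacunary_flow n e \<theta> t - lacunary_flow n e \<theta> s) \<le> g s"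
        using s t unfolding lacunary_flow_def g_def
        by (simp only: if_True trig_diff) (intro norm_trig_le[OF F] mem, auto)
      also have "g s < d"
      proof (cases "s = t")
        case True then show ?thesis using d by (simp add: g_def)
      next
        case False then show ?thesis using b(2)[OF False s(2)] by simp
      qed
      finally show "N (lacunary_flow n e \<theta> t - lacunary_flow n e \<theta> s) < d" .
    qed
  qed
  show "path_norm N (lacunary_flow n e \<theta>) \<le> C * (4 * e / r)"
    by (rule path_norm_le[OF sn])
qed

text \<open>The test function keeps the diagonal of the double sum. There every term is P(\<eta>)
  times a positive number whose time integral is bounded below independently of j, so n terms add up
  without cancellation.\<close>

lemma bilinear_lacunary_flow_lower:
  fixes \<eta> :: space
  assumes lp: "lp_cutoff \<phi>0" and P: "smooth_on (- {0}) P" and \<eta>: "\<eta> \<noteq> 0"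
    and w: "has_bilinear \<phi>0 P (lacunary_flow n e (\<lambda>j. 2 ^ Suc j *\<^sub>R \<eta>)) (lacunary_flow n e (\<lambda>j. (1 - 2 ^ Suc j) *\<^sub>R \<eta>)) 1 w"
  shows "real n * (norm (P \<eta>) * e\<^sup>2 * exp (- 9 * (norm \<eta>)\<^sup>2)) \<le> norm (w (inv_fourier (bump \<phi>0 \<eta>)))"
proof -
  let ?\<phi> = "inv_fourier (bump \<phi>0 \<eta>)"
  let ?\<xi> = "\<lambda>j::nat. 2 ^ Suc j *\<^sub>R \<eta>" and ?\<zeta> = "\<lambda>j::nat. (1 - 2 ^ Suc j) *\<^sub>R \<eta>"
  let ?R = "(norm \<eta>)\<^sup>2"
  have \<phi>: "?\<phi> \<in> schwartz" by (intro inv_fourier_schwartz bump_schwartz lp \<eta>)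
  obtain g h where gh: "\<And>\<tau>. \<tau> \<in> {0<..<1} \<Longrightarrow> has_product \<phi>0 (lacunary_flow n e ?\<xi> \<tau>) (lacunary_flow n e ?\<zeta> \<tau>) (g \<tau>)"
      "\<And>\<tau>. \<tau> \<in> {0<..<1} \<Longrightarrow> has_heat_P \<phi>0 P (1 - \<tau>) (g \<tau>) (h \<tau>)"
      and wh: "w ?\<phi> = (LINT \<tau>:{0<..<1}|lborel. h \<tau> ?\<phi>)"
    using w \<phi> unfolding has_bilinear_def by blast
  \<comment> \<open>The joint decay rate of the two factors up to time \<tau>; \<open>G\<close> adds
    the decay of the product, at frequency \<eta>, from time \<tau> to time 1.\<close>
  define a where "a j = (norm (?\<xi> j))\<^sup>2 + (norm (?\<zeta> j))\<^sup>2" for j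
  define G where "G j \<tau> = 4 ^ j * exp (- \<tau> * a j - (1 - \<tau>) * ?R)" for j \<tau>
  have hG: "h \<tau> ?\<phi> = P \<eta> * of_real (e\<^sup>2 * (\<Sum>j<n. G j \<tau>))" if \<tau>: "\<tau> \<in> {0<..<1}" for \<tau>
  proof -
    let ?c = "\<lambda>j. of_real (e * 2 ^ j * exp (- \<tau> * (norm (?\<xi> j))\<^sup>2)) :: complex"
    let ?d = "\<lambda>j. of_real (e * 2 ^ j * exp (- \<tau> * (norm (?\<zeta> j))\<^sup>2)) :: complex"
    have "has_product \<phi>0 (trig {..<n} ?c ?\<xi>) (trig {..<n} ?d ?\<zeta>) (g \<tau>)"
      using gh(1)[OF \<tau>] \<tau> by (simp add: lacunary_flow_def)
    then have "g \<tau> = trig ({..<n} \<times> {..<n}) (\<lambda>(a, b). ?c a * ?d b) (\<lambda>(a, b). ?\<xi> a + ?\<zeta> b)"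
      by (intro has_product_trig[OF lp]) auto
    with gh(2)[OF \<tau>] have "has_heat_P \<phi>0 P (1 - \<tau>) (trig ({..<n} \<times> {..<n}) (\<lambda>(a, b). ?c a * ?d b) (\<lambda>(a, b). ?\<xi> a + ?\<zeta> b)) (h \<tau>)"
      by simp
    from has_heat_P_trig[OF lp P \<eta> _ this]
    have "h \<tau> ?\<phi> = (\<Sum>(j,k)\<in>{..<n} \<times> {..<n}. ?c j * ?d k * (of_real (exp (- (1 - \<tau>) * (norm (?\<xi> j + ?\<zeta> k))\<^sup>2)) * P (?\<xi> j + ?\<zeta> k) * bump \<phi>0 \<eta> (- (?\<xi> j + ?\<zeta> k))))"
      using \<tau> by (simp add: case_prod_unfold)
    also have "\<dots> = (\<Sum>(j,k)\<in>{..<n} \<times> {..<n}. if k = j then P \<eta> * of_real (e\<^sup>2 * G j \<tau>) else 0)"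
    proof (intro sum.cong refl, clarify)
      fix j k
      show "?c j * ?d k * (of_real (exp (- (1 - \<tau>) * (norm (?\<xi> j + ?\<zeta> k))\<^sup>2)) * P (?\<xi> j + ?\<zeta> k) * bump \<phi>0 \<eta> (- (?\<xi> j + ?\<zeta> k)))
          = (if k = j then P \<eta> * of_real (e\<^sup>2 * G j \<tau>) else 0)"
      proof (cases "k = j")
        case True
        have eq: "?\<xi> j + ?\<zeta> k = \<eta>" unfolding True by (simp add: algebra_simps)
        have "(2::real) ^ j * 2 ^ j = 4 ^ j" by (simp flip: power_mult_distrib)
        then have "(e * 2 ^ j * exp (- \<tau> * (norm (?\<xi> j))\<^sup>2)) * (e * 2 ^ j * exp (- \<tau> * (norm (?\<zeta> j))\<^sup>2)) * exp (- (1 - \<tau>) * ?R)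
            = e\<^sup>2 * G j \<tau>"
          unfolding G_def a_def by (simp add: power2_eq_square exp_add exp_diff exp_minus field_simps)
        from arg_cong[OF this, of complex_of_real]
        have "?c j * ?d j * of_real (exp (- (1 - \<tau>) * ?R)) = of_real (e\<^sup>2 * G j \<tau>)"
          by (simp only: of_real_mult)
        then show ?thesis unfolding eq bump_eq_1[OF lp] by (simp add: True mult.commute mult.assoc)
      next
        case False
        \<comment> \<open>Distinct powers of 2 with positive exponents differ by at least 2; hence
          an off-diagonal frequency is at distance at least 2 |\<eta>| from \<eta>, outside the
          reach of the bump.\<close>
        have "2 \<le> \<bar>(2::real) ^ Suc k - 2 ^ Suc j\<bar>"
        proof -
          have lt: "2 \<le> (2::real) ^ Suc k - 2 ^ Suc j" if "j < k" for j k :: nat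
          proof -
            have "(2::real) ^ Suc j \<le> 2 ^ k" using that by (intro power_increasing) auto
            moreover have "(2::real) ^ 1 \<le> 2 ^ k" using that by (intro power_increasing) auto
            ultimately show ?thesis by simp
          qed
          show ?thesis using lt[of j k] lt[of k j] False by (cases j k rule: linorder_cases) auto
        qed
        moreover have "- (?\<xi> j + ?\<zeta> k) + \<eta> = (2 ^ Suc k - 2 ^ Suc j) *\<^sub>R \<eta>" by (simp add: algebra_simps)
        ultimately have "norm (- (?\<xi> j + ?\<zeta> k) + \<eta>) \<ge> 2 * norm \<eta>" by (simp only: norm_scaleR mult_right_mono norm_ge_zero)
        moreover have "2 * norm \<eta> > norm \<eta> / 2" using \<eta> by simp
        ultimately have "norm (- (?\<xi> j + ?\<zeta> k) + \<eta>) > norm \<eta> / 2" by linarith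
        then show ?thesis using False by (simp only: bump_eq_0[OF lp \<eta>]) simp
      qed
    qed
    also have "\<dots> = (\<Sum>j<n. P \<eta> * of_real (e\<^sup>2 * G j \<tau>))"
      by (simp add: sum.cartesian_product[symmetric])
    finally show ?thesis by (simp add: sum_distrib_left)
  qed
  \<comment> \<open>Both squared frequencies are at most 4 * 4^j |\<eta>|^2, which gives the 8
    expected by \<open>exp_interpolation_integral\<close>.\<close>
  have a: "0 \<le> a j" "a j \<le> 8 * 4 ^ j * ?R" for j
  proof -
    show "0 \<le> a j" unfolding a_def by simp
    have "\<bar>1 - 2 ^ Suc j\<bar> \<le> (2::real) ^ Suc j" using one_le_power[of "2::real" "Suc j"] by simp
    then have "norm (?\<zeta> j) \<le> 2 ^ Suc j * norm \<eta>"
      unfolding norm_scaleR real_norm_def by (intro mult_right_mono) auto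
    then have "(norm (?\<zeta> j))\<^sup>2 \<le> (2 ^ Suc j * norm \<eta>)\<^sup>2" by (intro power_mono) auto
    moreover have "(norm (?\<xi> j))\<^sup>2 = (2 ^ Suc j * norm \<eta>)\<^sup>2" by simp
    moreover have "(2 ^ Suc j * norm \<eta>)\<^sup>2 = 4 * 4 ^ j * ?R"
    proof -
      have "((2::real) ^ j)\<^sup>2 = 4 ^ j" by (simp add: power2_eq_square flip: power_mult_distrib)
      then show ?thesis by (simp add: power_mult_distrib)
    qed
    ultimately show "a j \<le> 8 * 4 ^ j * ?R" unfolding a_def by linarith
  qed
  have GI: "set_integrable lborel {0<..<1} (G j)" and GL: "exp (- 9 * ?R) \<le> (LINT \<tau>:{0<..<1}|lborel. G j \<tau>)" for j
    unfolding G_def[abs_def] by (rule exp_interpolation_integral[OF _ a]; simp)+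
  have "w ?\<phi> = (LINT \<tau>:{0<..<1}|lborel. P \<eta> * of_real (e\<^sup>2 * (\<Sum>j<n. G j \<tau>)))"
    unfolding wh by (intro set_lebesgue_integral_cong) (auto simp: hG)
  also have "\<dots> = (LINT \<tau>|lborel. P \<eta> * of_real (e\<^sup>2 * (\<Sum>j<n. indicat_real {0<..<1} \<tau> *\<^sub>R G j \<tau>)))"
    unfolding set_lebesgue_integral_def
    by (intro Bochner_Integration.integral_cong refl) (simp add: indicator_def)
  also have "\<dots> = P \<eta> * of_real (e\<^sup>2 * (LINT \<tau>|lborel. (\<Sum>j<n. indicat_real {0<..<1} \<tau> *\<^sub>R G j \<tau>)))"
    by (simp only: integral_mult_right_zero integral_complex_of_real)
  also have "(LINT \<tau>|lborel. (\<Sum>j<n. indicat_real {0<..<1} \<tau> *\<^sub>R G j \<tau>)) = (\<Sum>j<n. (LINT \<tau>:{0<..<1}|lborel. G j \<tau>))"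
    unfolding set_lebesgue_integral_def
    by (intro Bochner_Integration.integral_sum GI[unfolded set_integrable_def])
  finally have "norm (w ?\<phi>) = norm (P \<eta>) * \<bar>e\<^sup>2 * (\<Sum>j<n. (LINT \<tau>:{0<..<1}|lborel. G j \<tau>))\<bar>"
    by (simp add: norm_mult del: of_real_sum of_real_mult)
  moreover have "real n * exp (- 9 * ?R) \<le> (\<Sum>j<n. (LINT \<tau>:{0<..<1}|lborel. G j \<tau>))"
    using sum_mono[of "{..<n}" "\<lambda>_. exp (- 9 * ?R)", OF GL] by simp
  then have "norm (P \<eta>) * (e\<^sup>2 * (real n * exp (- 9 * ?R))) \<le> norm (P \<eta>) * \<bar>e\<^sup>2 * (\<Sum>j<n. (LINT \<tau>:{0<..<1}|lborel. G j \<tau>))\<bar>"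
    by (intro mult_left_mono order_trans[OF _ abs_ge_self]) auto
  ultimately show ?thesis by (simp add: ac_simps)
qed

section \<open>Unbounded values of B on pairs of small path norm\<close>

theorem mainTheorem4:
  fixes \<phi>0 :: "real \<Rightarrow> real" and P :: "real ^ 3 \<Rightarrow> complex"
  assumes "lp_cutoff \<phi>0" and "degree_one_symbol P"
  shows "\<not> (\<exists>F NF. admissible_couple \<phi>0 P (besov \<phi>0) besov_norm F NF)"
proof
  assume "\<exists>F NF. admissible_couple \<phi>0 P (besov \<phi>0) besov_norm F NF"
  then obtain F N where adm: "admissible_couple \<phi>0 P (besov \<phi>0) besov_norm F N" by blast
  note lp = assms(1)
  obtain \<eta> where \<eta>: "\<eta> \<noteq> 0" "P \<eta> \<noteq> 0" and P: "smooth_on (- {0}) P"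
    using assms(2) unfolding degree_one_symbol_def by blast
  let ?X = "path_space F N"
  have E: "banach_distributions (besov \<phi>0) besov_norm" and F: "banach_distributions F N"
    and P2: "property_P2 (besov \<phi>0) besov_norm F N" and P3: "property_P3 \<phi>0 P F N"
    using adm unfolding admissible_couple_def by blast+
  have inv: "affine_comp r 0 f \<in> F" if "f \<in> F" "r > 0" for f r
  proof -
    have "\<forall>f\<in>tempered. \<forall>r>0. affine_comp r 0 f \<in> F \<longleftrightarrow> f \<in> F"
      using P2 unfolding property_P2_def by (elim conjE)
    then show ?thesis using that banach_tempered[OF F] by blast
  qed
  have inj: "injects_continuously F N"
    and H: "continuous_map (norm_topology (besov \<phi>0) besov_norm) (norm_topology F N) (heat 1)"
    using P2 unfolding property_P2_def by simp_all
  note ex = P3[unfolded property_P3_def Let_def, THEN conjunct1, rule_format]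
    and cont = P3[unfolded property_P3_def Let_def, THEN conjunct2, THEN conjunct1]
  obtain C where C: "C \<ge> 0" "\<And>f. f \<in> besov \<phi>0 \<Longrightarrow> N (heat 1 f) \<le> C * besov_norm f"
    and HF: "\<And>f. f \<in> besov \<phi>0 \<Longrightarrow> heat 1 f \<in> F"
    using banach_bounded_linear[OF E F H heat_cscale] by blast
  obtain d K where d: "d > 0" and K: "\<And>u v. u \<in> ?X \<Longrightarrow> v \<in> ?X \<Longrightarrow> path_norm N u < d \<Longrightarrow> path_norm N v < d \<Longrightarrow>
      bilinear \<phi>0 P u v 1 \<in> F \<and> N (bilinear \<phi>0 P u v 1) \<le> K"
    using bilinear_path_bound[OF F inv cont] by blast
  let ?\<phi> = "inv_fourier (bump \<phi>0 \<eta>)"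
  obtain L where L: "\<And>f. f \<in> F \<Longrightarrow> norm (f ?\<phi>) \<le> L * N f"
    using injects_continuously_eval[OF F inj] by blast
  define r where "r = norm \<eta>"
  have r: "r > 0" using \<eta> by (simp add: r_def)
  \<comment> \<open>The path norms will be at most C (4 e / r) = C q, and this q makes that less
    than d; C + 1 keeps the quotient defined when C = 0.\<close>
  define q where "q = d / (2 * (C + 1))"
  define e where "e = q * r / 4"
  have e: "e > 0" unfolding e_def q_def using d r C(1) by simp
  have small: "C * (4 * e / r) < d"
  proof -
    have "4 * e / r = q" using r by (simp add: e_def)
    then have "C * (4 * e / r) = d * (C / (2 * (C + 1)))" by (simp add: q_def)
    also have "\<dots> < d * 1" using C(1) d by (intro mult_strict_left_mono) (auto simp: divide_less_eq)
    finally show ?thesis by simp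
  qed
  \<comment> \<open>The growth of the tested component of B per additional scale; it does not depend
    on n.\<close>
  define c where "c = norm (P \<eta>) * e\<^sup>2 * exp (- 9 * r\<^sup>2)"
  have c: "c > 0" unfolding c_def using \<eta> e by simp
  have "real n * c \<le> \<bar>L\<bar> * \<bar>K\<bar>" for n
  proof -
    let ?u = "lacunary_flow n e (\<lambda>j. 2 ^ Suc j *\<^sub>R \<eta>)" and ?v = "lacunary_flow n e (\<lambda>j. (1 - 2 ^ Suc j) *\<^sub>R \<eta>)"
    have \<theta>1: "2 ^ j * r \<le> norm (2 ^ Suc j *\<^sub>R \<eta>)" for j using r by (simp add: r_def)
    \<comment> \<open>Here 2^(j+1) - 1 \<ge> 2^j, so the shift by \<eta> preserves the dyadic lower
      bound, even for j = 0.\<close>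
    have \<theta>2: "2 ^ j * r \<le> norm ((1 - 2 ^ Suc j) *\<^sub>R \<eta>)" for j
    proof -
      have "(1::real) \<le> 2 ^ j" by simp
      then have "(2::real) ^ j \<le> - (1 - 2 ^ Suc j)" unfolding power_Suc by linarith
      then have "(2::real) ^ j \<le> \<bar>1 - 2 ^ Suc j\<bar>" using abs_ge_minus_self by (rule order_trans)
      then show ?thesis unfolding norm_scaleR r_def real_norm_def by (intro mult_right_mono) auto
    qed
    note u = lacunary_flow_path_space[OF lp F HF C(2) C(1) less_imp_le[OF e] r \<theta>1, of n]
    note v = lacunary_flow_path_space[OF lp F HF C(2) C(1) less_imp_le[OF e] r \<theta>2, of n]
    let ?w = "bilinear \<phi>0 P ?u ?v 1"
    have w: "?w \<in> F" "N ?w \<le> K"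
      using K[OF u(1) v(1) le_less_trans[OF u(2) small] le_less_trans[OF v(2) small]] by auto
    have "has_bilinear \<phi>0 P ?u ?v 1 ?w"
      by (intro has_bilinear_bilinear ex u v) auto
    from bilinear_lacunary_flow_lower[OF lp P \<eta>(1) this]
    have "real n * c \<le> norm (?w ?\<phi>)" by (simp add: c_def r_def)
    also have "\<dots> \<le> L * N ?w" by (rule L[OF w(1)])
    \<comment> \<open>Absolute values, because L and K come from existence statements without a
      sign.\<close>
    also have "\<dots> \<le> \<bar>L\<bar> * \<bar>K\<bar>"
      using w banach_norm_nonneg[OF F w(1)] by (intro mult_mono) auto
    finally show ?thesis .
  qed
  moreover obtain n where "\<bar>L\<bar> * \<bar>K\<bar> < real n * c" using reals_Archimedean3[OF c] by blast
  ultimately show False by (metis not_le)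
qed

end
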